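(* Let $\{P_\theta\}_{\theta\in\Theta}$ be a family as described in the context, which is differentiable in quadratic mean, satisfies: for every compact $K\subset\Theta$ and every $h\in\mathbb{R}^m$, $\sup_{\theta\in K}\mathrm{E}_\theta e^{h^T\ell_\theta}<\infty$, and has $J_\theta$ nonsingular. Let $(\Omega',\mathcal{X}'):=(\mathbb{R}^m\times[0,1],\mathcal{B}(\mathbb{R}^m\times[0,1]))$ and fix $\theta\in\Theta$. Then there exist probability measures $\tilde P^n_{\theta'}$ on $(\Omega^n\times\Omega',\mathcal{X}^{\otimes n}\otimes\mathcal{X}')$ whose marginal on $\Omega^n$ is $P^n_{\theta'}$, and Markov kernels $x\mapsto R^n_\theta(\cdot|x)$ from $\mathbb{R}^m$ to $\Omega^n\times\Omega'$ (depending on $\theta,n$ but not on $h$), such that, with $\lambda^n_h$ of law $\mathrm{N}(h,J_\theta^{-1})$ and $Q^n_{\theta,h}(A):=\mathrm{E}^{\lambda^n_h}R^n_\theta(A|\lambda^n_h)=\int R^n_\theta(A|x)\,\mathrm{N}(h,J_\theta^{-1})(dx)$, for every compact $K'\subset\mathbb{R}^m$, \[ \lim_{n\to\infty}\sup_{h\in K'}\left\Vert\tilde P^n_{\theta+hn^{-1/2}}-Q^n_{\theta,h}\right\Vert_1=0 . \]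
   Context: $\Theta$ is an open subset of $\mathbb{R}^m$, $(\Omega,\mathcal{X})$ is a Polish space with its Borel $\sigma$-algebra, each $P_\theta$ has density $p_\theta$ with respect to a fixed measure $\mu$, and $P^n_\theta:=P_\theta^{\otimes n}$; $\mathrm{E}_\theta$ is expectation under $P_\theta$. Differentiability in quadratic mean: there is a measurable $\ell_\theta:\Omega\to\mathbb{R}^m$ with $\lim_{h\to0}\Vert h\Vert^{-2}\int\big(\sqrt{p_{\theta+h}}-\sqrt{p_\theta}-\tfrac12 h^T\ell_\theta\sqrt{p_\theta}\big)^2d\mu=0$ for all $\theta$. $J_\theta:=[\mathrm{E}_\theta\ell_{\theta,i}\ell_{\theta,j}]_{i,j}$. $\mathrm{N}(\mu,\Sigma)$ is the Gaussian law; $\Vert\cdot\Vert_1$ is the total variation ($L^1$) norm. *)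

theory Defs
  imports "HOL-Probability.Probability"
begin

text \<open>Multivariate Gaussian law N(h, Sigma) on real^'m (Sigma assumed positive definite),
  given by its Lebesgue density.\<close>
definition mvnormal_density :: "real^'m \<Rightarrow> real^'m^'m \<Rightarrow> real^'m \<Rightarrow> real" where
  "mvnormal_density h S x =
     exp (- (1/2) * ((x - h) \<bullet> (matrix_inv S *v (x - h)))) / sqrt ((2 * pi) ^ CARD('m) * det S)"

definition mvnormal :: "real^'m \<Rightarrow> real^'m^'m \<Rightarrow> (real^'m) measure" where
  "mvnormal h S = density lborel (\<lambda>x. ennreal (mvnormal_density h S x))"

definition fisher_info :: "(real^'m \<Rightarrow> 'a measure) \<Rightarrow> (real^'m \<Rightarrow> 'a \<Rightarrow> real^'m) \<Rightarrow> real^'m \<Rightarrow> real^'m^'m" where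
  "fisher_info P l \<theta> = (\<chi> i j. \<integral>x. (l \<theta> x $ i) * (l \<theta> x $ j) \<partial>P \<theta>)"

text \<open>Total variation (L1) distance of two probability measures:
  ||P - Q||_1 = 2 sup_A |P(A) - Q(A)|.\<close>
definition tv_dist :: "'a measure \<Rightarrow> 'a measure \<Rightarrow> ennreal" where
  "tv_dist M N = 2 * (SUP A \<in> sets M. ennreal \<bar>measure M A - measure N A\<bar>)"

definition sample_space :: "nat \<Rightarrow> (nat \<Rightarrow> 'a::topological_space) measure" where
  "sample_space n = PiM {..<n} (\<lambda>_. borel)"

definition Omega' :: "((real^'m) \<times> real) measure" where
  "Omega' = restrict_space borel (UNIV \<times> {0..1})"

definition ext_space :: "nat \<Rightarrow> ((nat \<Rightarrow> 'a::topological_space) \<times> ((real^'m) \<times> real)) measure" where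
  "ext_space n = sample_space n \<Otimes>\<^sub>M Omega'"

end

theory Submission
  imports Defs
begin

text \<open>
  Whitening the score by \<open>B\<close> with \<open>B\<^sup>T J B = 1\<close> reduces to unit Fisher information. By
  differentiability in quadratic mean and the exponential moments, the law at the local parameter \<open>h\<close>
  is within Hellinger distance \<open>o(n\<^sup>-\<^sup>1\<^sup>/\<^sup>2)\<close> of the exponentially tilted law with density proportional to
  \<open>exp (h \<bullet> s / \<surd>n)\<close>, so the \<open>n\<close>-fold products merge in total variation, and the likelihood
  ratio of the tilted products is exactly \<open>exp (h \<bullet> \<Delta>\<^sub>n - \<kappa>\<^sub>n)\<close> with the normalised score sum \<open>\<Delta>\<^sub>n\<close>.

  For \<open>a\<^sup>2 + e\<^sup>2 = 1\<close> the smoothed statistic \<open>a \<Delta>\<^sub>n + e Z\<close> with an independent Gaussian \<open>Z\<close> has a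
  density which, by Fourier inversion and the central limit theorem for characteristic functions,
  converges pointwise to the standard Gaussian density. The kernel is the conditional law of the sample
  given the value of this statistic, at the base parameter. The Hellinger affinity between the tilted
  joint law of sample and statistic and the law generated by the kernel from a shifted Gaussian is an
  integral whose integrand converges pointwise; Fatou's lemma bounds its lower limit below by
  \<open>exp (- (1 - a) |h|\<^sup>2 / 4)\<close>, which tends to \<open>1\<close> as \<open>a\<close> tends to \<open>1\<close>. A diagonal choice of \<open>a\<close> along \<open>n\<close>
  serves all compact sets of \<open>h\<close> at once. The auxiliary coordinate in \<open>Omega'\<close> is a point mass at \<open>0\<close>.
\<close>

subsection \<open>Hellinger affinity and total variation\<close>

text \<open>The score sum may have a discrete law; the added noise gives it a density that is
  positive everywhere. In the tilted family the score sum is sufficient, so conditioning on it would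
  not involve \<open>h\<close>. Conditioning on the noisy statistic does, and doing so at the base
  parameter leaves an error. In the Gaussian limit the two joint laws of score sum and statistic
  have means \<open>(h, a h)\<close> and \<open>(a h, h)\<close>, unit variances and correlation
  \<open>a\<close>; their affinity is \<open>exp (- (1 - a) |h|^2 / 4)\<close>, the origin of that
  bound. Affinity suits the argument because it is multiplicative over products and never exceeds 1:
  lower bounds suffice, and Fatou's lemma needs no dominating function for a ratio of densities. The
  condition \<open>a^2 + e^2 = 1\<close> makes the limit of the smoothed statistic exactly standard
  Gaussian. Limits are taken along convergent sequences \<open>h n\<close> rather than at fixed
  \<open>h\<close>, because a compactness argument turns such sequential statements into uniform
  ones.\<close>

lemma measure_density_diff_le:
  fixes f g :: "'a \<Rightarrow> real"
  assumes [measurable]: "f \<in> borel_measurable M" "g \<in> borel_measurable M" "A \<in> sets M"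
    and nn: "\<And>x. x \<in> space M \<Longrightarrow> 0 \<le> f x" "\<And>x. x \<in> space M \<Longrightarrow> 0 \<le> g x"
    and f1: "(\<integral>\<^sup>+x. ennreal (f x) \<partial>M) = 1" and g1: "(\<integral>\<^sup>+x. ennreal (g x) \<partial>M) = 1"
    and aff: "ennreal (1 - \<delta>\<^sup>2 / 8) \<le> (\<integral>\<^sup>+x. ennreal (sqrt (f x * g x)) \<partial>M)" and \<delta>: "0 < \<delta>"
  shows "\<bar>measure (density M (\<lambda>x. ennreal (f x))) A - measure (density M (\<lambda>x. ennreal (g x))) A\<bar> \<le> \<delta>"
proof -
  have fi: "integrable M f" "integral\<^sup>L M f = 1"
    using f1 nn by (auto intro!: integrableI_nonneg integral_eq_nn_integral[THEN trans])
  have gi: "integrable M g" "integral\<^sup>L M g = 1"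
    using g1 nn by (auto intro!: integrableI_nonneg integral_eq_nn_integral[THEN trans])
  have am: "sqrt (f x * g x) \<le> f x + g x" if "x \<in> space M" for x
    using arith_geo_mean_sqrt[of "f x" "g x"] nn[OF that] by simp
  have si: "integrable M (\<lambda>x. sqrt (f x * g x))"
    by (rule Bochner_Integration.integrable_bound[OF Bochner_Integration.integrable_add[OF fi(1) gi(1)]])
       (use am nn in auto)
  have "ennreal (1 - \<delta>\<^sup>2 / 8) \<le> ennreal (\<integral>x. sqrt (f x * g x) \<partial>M)"
    using aff by (subst nn_integral_eq_integral[symmetric]) (use si nn in auto)
  then have af: "1 - \<delta>\<^sup>2 / 8 \<le> (\<integral>x. sqrt (f x * g x) \<partial>M)"
    by (subst (asm) ennreal_le_iff) (auto intro!: integral_nonneg_AE simp: nn)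
  have md: "measure (density M (\<lambda>x. ennreal (u x))) A = (\<integral>x. indicator A x * u x \<partial>M)"
    if "integrable M u" "\<And>x. x \<in> space M \<Longrightarrow> 0 \<le> u x" for u :: "'a \<Rightarrow> real"
  proof -
    have [measurable]: "u \<in> borel_measurable M" using that by auto
    have "emeasure (density M (\<lambda>x. ennreal (u x))) A = (\<integral>\<^sup>+x. ennreal (indicator A x * u x) \<partial>M)"
      by (subst emeasure_density) (auto intro!: nn_integral_cong simp: indicator_def)
    also have "\<dots> = ennreal (\<integral>x. indicator A x * u x \<partial>M)"
      by (rule nn_integral_eq_integral)
         (auto intro!: integrable_real_mult_indicator that simp: that(2) mult.commute[of "indicator A _"])
    finally show ?thesis
      by (simp add: measure_def integral_nonneg_AE that(2))
  qed
  \<comment> \<open>AM-GM applied to the factorisation \<open>f - g = (\<surd>f - \<surd>g) (\<surd>f + \<surd>g)\<close> replaces Cauchy-Schwarz.\<close>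
  have pw: "\<bar>indicator A x * f x - indicator A x * g x\<bar>
      \<le> (f x + g x - 2 * sqrt (f x * g x)) * (2 / \<delta>) + (2 * f x + 2 * g x) * (\<delta> / 8)"
    (is "_ \<le> ?r x") if x: "x \<in> space M" for x
  proof -
    define p q where "p = \<bar>sqrt (f x) - sqrt (g x)\<bar>" and "q = sqrt (f x) + sqrt (g x)"
    have fx: "f x = (sqrt (f x))\<^sup>2" "g x = (sqrt (g x))\<^sup>2" using nn[OF x] by auto
    have pq: "\<bar>f x - g x\<bar> = p * q"
    proof -
      have "f x - g x = (sqrt (f x) - sqrt (g x)) * (sqrt (f x) + sqrt (g x))"
        using fx by (simp add: algebra_simps power2_eq_square)
      then have "\<bar>f x - g x\<bar> = p * \<bar>q\<bar>" unfolding p_def q_def by (simp only: abs_mult)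
      then show ?thesis using nn[OF x] by (simp add: q_def)
    qed
    have p2: "p\<^sup>2 = f x + g x - 2 * sqrt (f x * g x)"
      unfolding p_def power2_abs using nn[OF x] by (simp add: power2_diff real_sqrt_mult)
    have q2: "q\<^sup>2 \<le> 2 * f x + 2 * g x"
    proof -
      have "q\<^sup>2 + p\<^sup>2 = 2 * f x + 2 * g x"
        unfolding p_def q_def power2_abs using nn[OF x] by (simp add: power2_diff power2_sum)
      then show ?thesis by (smt (verit) zero_le_power2)
    qed
    have "0 \<le> (p * (2 / \<delta>) - q * (1/2))\<^sup>2 * (\<delta> / 2)" using \<delta> by simp
    also have "\<dots> = p\<^sup>2 * (2 / \<delta>) + q\<^sup>2 * (\<delta> / 8) - p * q"
      using \<delta> by (simp add: power2_diff field_simps power2_eq_square)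
    finally have "p * q \<le> p\<^sup>2 * (2 / \<delta>) + q\<^sup>2 * (\<delta> / 8)" by simp
    also have "\<dots> \<le> ?r x" unfolding p2 using mult_right_mono[OF q2, of "\<delta>/8"] \<delta> by simp
    finally show ?thesis using pq by (cases "x \<in> A") (auto simp: abs_mult p_def q_def nn[OF x] intro: order_trans[rotated])
  qed
  have ri: "integrable M ?r" using fi gi si by auto
  have ind: "integrable M (\<lambda>x. indicator A x * f x)" "integrable M (\<lambda>x. indicator A x * g x)"
    using integrable_real_mult_indicator[of A M] fi gi by (auto simp: mult.commute[of "indicator A _"])
  have "\<bar>(\<integral>x. indicator A x * f x \<partial>M) - (\<integral>x. indicator A x * g x \<partial>M)\<bar>
      = \<bar>\<integral>x. indicator A x * f x - indicator A x * g x \<partial>M\<bar>"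
    using ind by simp
  also have "\<dots> \<le> (\<integral>x. \<bar>indicator A x * f x - indicator A x * g x\<bar> \<partial>M)"
    by (rule integral_abs_bound)
  also have "\<dots> \<le> integral\<^sup>L M ?r"
    using ind ri pw by (intro integral_mono) auto
  also have "\<dots> = (2 - 2 * (\<integral>x. sqrt (f x * g x) \<partial>M)) * (2/\<delta>) + \<delta> / 2"
    using fi gi si by simp
  \<comment> \<open>The weights \<open>2 / \<delta>\<close> and \<open>\<delta> / 8\<close> are
    balanced: affinity at least \<open>1 - \<delta>\<^sup>2 / 8\<close> means squared Hellinger
    distance at most \<open>\<delta>\<^sup>2 / 4\<close>, and each of the two terms then contributes
    at most \<open>\<delta> / 2\<close>.\<close>
  also have "\<dots> \<le> (\<delta>\<^sup>2 / 4) * (2 / \<delta>) + \<delta> / 2"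
    using af \<delta> by (intro add_mono mult_right_mono) auto
  also have "\<dots> = \<delta>" using \<delta> by (simp add: power2_eq_square field_simps)
  finally show ?thesis using md fi gi nn by simp
qed

text \<open>Tonelli factorises both sides on rectangles, which determine the product measure.
  Sigma-finiteness of \<open>density M f\<close> is a separate hypothesis because \<open>f\<close>
  may take the value infinity.\<close>

lemma PiM_density:
  assumes M: "sigma_finite_measure M" and D: "sigma_finite_measure (density M f)"
    and [measurable]: "f \<in> borel_measurable M" and I: "finite I"
  shows "PiM I (\<lambda>_. density M f) = density (PiM I (\<lambda>_. M)) (\<lambda>x. \<Prod>i\<in>I. f (x i))"
proof -
  interpret M: product_sigma_finite "\<lambda>_. M" using M by (simp add: product_sigma_finite_def)
  interpret D: product_sigma_finite "\<lambda>_. density M f" using D by (simp add: product_sigma_finite_def)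
  have sets: "sets (PiM I (\<lambda>_. density M f)) = sets (PiM I (\<lambda>_. M))"
    by (intro sets_PiM_cong) auto
  show ?thesis
  proof (rule D.PiM_eqI[symmetric])
    fix A assume "\<And>i. i \<in> I \<Longrightarrow> A i \<in> sets (density M f)"
    then have A[measurable]: "\<And>i. i \<in> I \<Longrightarrow> A i \<in> sets M" by simp
    have [measurable]: "Pi\<^sub>E I A \<in> sets (PiM I (\<lambda>_. M))"
      using A by (intro sets_PiM_I_finite I) auto
    have "emeasure (density (PiM I (\<lambda>_. M)) (\<lambda>x. \<Prod>i\<in>I. f (x i))) (Pi\<^sub>E I A)
       = (\<integral>\<^sup>+x. (\<Prod>i\<in>I. f (x i)) * indicator (Pi\<^sub>E I A) x \<partial>PiM I (\<lambda>_. M))"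
      by (subst emeasure_density) (use I in auto)
    also have "\<dots> = (\<integral>\<^sup>+x. (\<Prod>i\<in>I. f (x i) * indicator (A i) (x i)) \<partial>PiM I (\<lambda>_. M))"
    proof (intro nn_integral_cong)
      fix x assume "x \<in> space (PiM I (\<lambda>_. M))"
      then have "indicator (Pi\<^sub>E I A) x = (\<Prod>i\<in>I. indicator (A i) (x i) :: ennreal)"
        using I by (auto simp: indicator_def PiE_iff space_PiM extensional_def)
      then show "(\<Prod>i\<in>I. f (x i)) * indicator (Pi\<^sub>E I A) x = (\<Prod>i\<in>I. f (x i) * indicator (A i) (x i))"
        by (simp add: prod.distrib)
    qed
    also have "\<dots> = (\<Prod>i\<in>I. \<integral>\<^sup>+x. f x * indicator (A i) x \<partial>M)"
      by (rule M.product_nn_integral_prod) (use I A in auto)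
    also have "\<dots> = (\<Prod>i\<in>I. emeasure (density M f) (A i))"
      by (intro prod.cong refl) (simp add: emeasure_density A)
    finally show "emeasure (density (PiM I (\<lambda>_. M)) (\<lambda>x. \<Prod>i\<in>I. f (x i))) (Pi\<^sub>E I A)
      = (\<Prod>i\<in>I. emeasure (density M f) (A i))" .
  qed (use I sets in auto)
qed

lemma prod_sqrt: "finite I \<Longrightarrow> sqrt (\<Prod>i\<in>I. f i) = (\<Prod>i\<in>I. sqrt (f i))"
  by (induction I rule: finite_induct) (auto simp: real_sqrt_mult)

text \<open>The affinity \<open>\<rho>\<close> of one factor becomes \<open>\<rho> ^ n\<close> for
  the product, and Bernoulli's inequality \<open>1 + n (\<rho> - 1) \<le> \<rho> ^ n\<close> turns a
  squared Hellinger distance of order \<open>\<delta>\<^sup>2 / n\<close> per factor into the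
  affinity bound for the product.\<close>

lemma measure_PiM_diff_le:
  fixes f g :: "'a \<Rightarrow> real"
  assumes M: "sigma_finite_measure M"
    and [measurable]: "f \<in> borel_measurable M" "g \<in> borel_measurable M"
    and A: "A \<in> sets (PiM {..<n} (\<lambda>_. M))"
    and nn: "\<And>x. x \<in> space M \<Longrightarrow> 0 \<le> f x" "\<And>x. x \<in> space M \<Longrightarrow> 0 \<le> g x"
    and f1: "prob_space (density M (\<lambda>x. ennreal (f x)))"
    and g1: "prob_space (density M (\<lambda>x. ennreal (g x)))"
    and hel: "real n * (\<integral>x. (sqrt (f x) - sqrt (g x))\<^sup>2 \<partial>M) \<le> \<delta>\<^sup>2 / 4" and \<delta>: "0 < \<delta>"
  shows "\<bar>measure (PiM {..<n} (\<lambda>_. density M (\<lambda>x. ennreal (f x)))) A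
      - measure (PiM {..<n} (\<lambda>_. density M (\<lambda>x. ennreal (g x)))) A\<bar> \<le> \<delta>"
proof -
  interpret M: product_sigma_finite "\<lambda>_. M" using M by (simp add: product_sigma_finite_def)
  have I1: "(\<integral>\<^sup>+x. ennreal (f x) \<partial>M) = 1"
    using prob_space.emeasure_space_1[OF f1] by (simp add: emeasure_density cong: nn_integral_cong)
  have I2: "(\<integral>\<^sup>+x. ennreal (g x) \<partial>M) = 1"
    using prob_space.emeasure_space_1[OF g1] by (simp add: emeasure_density cong: nn_integral_cong)
  have fi: "integrable M f" "integral\<^sup>L M f = 1"
    using I1 nn by (auto intro!: integrableI_nonneg integral_eq_nn_integral[THEN trans])
  have gi: "integrable M g" "integral\<^sup>L M g = 1"
    using I2 nn by (auto intro!: integrableI_nonneg integral_eq_nn_integral[THEN trans])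
  have am: "sqrt (f x * g x) \<le> f x + g x" if "x \<in> space M" for x
    using arith_geo_mean_sqrt[of "f x" "g x"] nn[OF that] by simp
  have si: "integrable M (\<lambda>x. sqrt (f x * g x))"
    by (rule Bochner_Integration.integrable_bound[OF Bochner_Integration.integrable_add[OF fi(1) gi(1)]])
       (use am nn in auto)
  define \<rho> where "\<rho> = (\<integral>x. sqrt (f x * g x) \<partial>M)"
  have "(\<integral>x. (sqrt (f x) - sqrt (g x))\<^sup>2 \<partial>M) = (\<integral>x. f x + g x - 2 * sqrt (f x * g x) \<partial>M)"
    by (intro Bochner_Integration.integral_cong) (auto simp: power2_diff nn real_sqrt_mult)
  also have "\<dots> = 2 - 2 * \<rho>" using fi gi si by (simp add: \<rho>_def)
  finally have "real n * (2 - 2 * \<rho>) \<le> \<delta>\<^sup>2 / 4" using hel by simp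
  then have \<rho>: "real n * (1 - \<rho>) \<le> \<delta>\<^sup>2 / 8" by (simp add: algebra_simps)
  have \<rho>0: "0 \<le> \<rho>" unfolding \<rho>_def by (intro integral_nonneg_AE) (auto simp: nn)
  have "1 - \<delta>\<^sup>2 / 8 \<le> 1 + real n * (\<rho> - 1)" using \<rho> by (simp add: algebra_simps)
  also have "\<dots> \<le> \<rho> ^ n" using Bernoulli_inequality[of "\<rho> - 1" n] \<rho>0 by simp
  finally have \<rho>n: "1 - \<delta>\<^sup>2 / 8 \<le> \<rho> ^ n" .
  have dens: "PiM {..<n} (\<lambda>_. density M (\<lambda>x. ennreal (u x)))
     = density (PiM {..<n} (\<lambda>_. M)) (\<lambda>x. ennreal (\<Prod>i<n. u (x i)))"
    and int1: "(\<integral>\<^sup>+x. ennreal (\<Prod>i<n. u (x i)) \<partial>PiM {..<n} (\<lambda>_. M)) = (\<integral>\<^sup>+x. ennreal (u x) \<partial>M) ^ n"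
    if [measurable]: "u \<in> borel_measurable M" and u: "\<And>x. x \<in> space M \<Longrightarrow> 0 \<le> u x"
      and "sigma_finite_measure (density M (\<lambda>x. ennreal (u x)))" for u :: "'a \<Rightarrow> real"
  proof -
    have eq: "(\<Prod>i<n. ennreal (u (x i))) = ennreal (\<Prod>i<n. u (x i))" if "x \<in> space (PiM {..<n} (\<lambda>_. M))" for x
      using that by (intro prod_ennreal) (auto simp: space_PiM PiE_iff u)
    show "PiM {..<n} (\<lambda>_. density M (\<lambda>x. ennreal (u x)))
     = density (PiM {..<n} (\<lambda>_. M)) (\<lambda>x. ennreal (\<Prod>i<n. u (x i)))"
      by (subst PiM_density[OF M that(3)]) (auto intro!: density_cong simp: eq)
    have "(\<integral>\<^sup>+x. ennreal (\<Prod>i<n. u (x i)) \<partial>PiM {..<n} (\<lambda>_. M))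
       = (\<integral>\<^sup>+x. (\<Prod>i<n. ennreal (u (x i))) \<partial>PiM {..<n} (\<lambda>_. M))"
      by (intro nn_integral_cong) (simp add: eq)
    also have "\<dots> = (\<integral>\<^sup>+x. ennreal (u x) \<partial>M) ^ n"
      by (subst M.product_nn_integral_prod) auto
    finally show "(\<integral>\<^sup>+x. ennreal (\<Prod>i<n. u (x i)) \<partial>PiM {..<n} (\<lambda>_. M)) = (\<integral>\<^sup>+x. ennreal (u x) \<partial>M) ^ n" .
  qed
  note sf = prob_space_imp_sigma_finite[OF f1] prob_space_imp_sigma_finite[OF g1]
  have sq: "(\<integral>\<^sup>+x. ennreal (sqrt ((\<Prod>i<n. f (x i)) * (\<Prod>i<n. g (x i)))) \<partial>PiM {..<n} (\<lambda>_. M)) = ennreal (\<rho> ^ n)"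
  proof -
    have "(\<integral>\<^sup>+x. ennreal (sqrt ((\<Prod>i<n. f (x i)) * (\<Prod>i<n. g (x i)))) \<partial>PiM {..<n} (\<lambda>_. M))
       = (\<integral>\<^sup>+x. (\<Prod>i<n. ennreal (sqrt (f (x i) * g (x i)))) \<partial>PiM {..<n} (\<lambda>_. M))"
      by (intro nn_integral_cong, subst prod_ennreal)
         (auto simp: prod_sqrt real_sqrt_mult space_PiM PiE_iff nn prod.distrib)
    also have "\<dots> = (\<integral>\<^sup>+x. ennreal (sqrt (f x * g x)) \<partial>M) ^ n"
      by (subst M.product_nn_integral_prod) auto
    also have "(\<integral>\<^sup>+x. ennreal (sqrt (f x * g x)) \<partial>M) = ennreal \<rho>"
      unfolding \<rho>_def by (rule nn_integral_eq_integral) (use si nn in auto)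
    finally show ?thesis using \<rho>0 by (simp add: ennreal_power)
  qed
  have df: "PiM {..<n} (\<lambda>_. density M (\<lambda>x. ennreal (f x)))
     = density (PiM {..<n} (\<lambda>_. M)) (\<lambda>x. ennreal (\<Prod>i<n. f (x i)))"
    by (rule dens) (use nn sf in auto)
  have dg: "PiM {..<n} (\<lambda>_. density M (\<lambda>x. ennreal (g x)))
     = density (PiM {..<n} (\<lambda>_. M)) (\<lambda>x. ennreal (\<Prod>i<n. g (x i)))"
    by (rule dens) (use nn sf in auto)
  show ?thesis
    unfolding df dg
    by (rule measure_density_diff_le)
       (use A \<delta> \<rho>n in \<open>auto intro!: prod_nonneg nn ennreal_leI
          simp: sq int1[OF assms(2) nn(1) sf(1)] int1[OF assms(3) nn(2) sf(2)] I1 I2 space_PiM PiE_iff\<close>)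
qed

subsection \<open>Linear change of variables\<close>

text \<open>A coordinate swap is its own inverse and carries boxes to boxes with permuted side
  lengths, so it preserves Lebesgue measure, which is determined by boxes.\<close>

lemma nn_integral_lborel_swap_coordinates:
  fixes F :: "real^'n \<Rightarrow> ennreal"
  assumes [measurable]: "F \<in> borel_measurable borel"
  shows "(\<integral>\<^sup>+x. F (\<chi> i. x $ Transposition.transpose k l i) \<partial>lborel) = (\<integral>\<^sup>+x. F x \<partial>lborel)"
proof -
  let ?T = "\<lambda>x::real^'n. \<chi> i. x $ Transposition.transpose k l i"
  have [measurable]: "?T \<in> borel_measurable borel"
    by (intro borel_measurable_continuous_onI continuous_intros)
  have "lborel = distr lborel borel ?T"
  proof (rule lborel_eqI)
    fix a b :: "real^'n" assume le: "\<And>c. c \<in> Basis \<Longrightarrow> a \<bullet> c \<le> b \<bullet> c"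
    have le': "a $ i \<le> b $ i" for i using le[of "axis i 1"] by (simp add: inner_axis axis_in_Basis_iff)
    have "?T -` box a b = box (?T a) (?T b)"
    proof -
      have "(\<forall>i. P (Transposition.transpose k l i) i) \<longleftrightarrow> (\<forall>i. P i (Transposition.transpose k l i))" for P
        by (metis transpose_involutory)
      then show ?thesis
        by (auto simp: mem_box_cart set_eq_iff) (metis transpose_involutory)+
    qed
    then have "emeasure (distr lborel borel ?T) (box a b) = emeasure lborel (box (?T a) (?T b))"
      by (simp add: emeasure_distr)
    also have "\<dots> = ennreal (\<Prod>c\<in>Basis. (?T b - ?T a) \<bullet> c)"
      by (rule emeasure_lborel_box) (use le' in \<open>auto simp: Basis_vec_def inner_axis\<close>)
    also have "(\<Prod>c\<in>Basis. (?T b - ?T a) \<bullet> c) = (\<Prod>i\<in>UNIV. (?T b - ?T a) $ i)"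
      by (simp add: Basis_vec_def prod.UNION_disjoint inj_on_def axis_eq_axis inner_axis prod.reindex cong: prod.cong)
    also have "\<dots> = (\<Prod>i\<in>UNIV. (b - a) $ i)"
      using prod.reindex_bij_betw[of "Transposition.transpose k l" UNIV UNIV "\<lambda>i. (b - a) $ i"] by simp
    also have "\<dots> = (\<Prod>c\<in>Basis. (b - a) \<bullet> c)"
      by (simp add: Basis_vec_def prod.UNION_disjoint inj_on_def axis_eq_axis inner_axis prod.reindex cong: prod.cong)
    finally show "emeasure (distr lborel borel ?T) (box a b) = ennreal (\<Prod>c\<in>Basis. (b - a) \<bullet> c)" .
  qed simp
  then have "(\<integral>\<^sup>+x. F x \<partial>lborel) = (\<integral>\<^sup>+x. F x \<partial>distr lborel borel ?T)" by metis
  then show ?thesis by (simp add: nn_integral_distr)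
qed

text \<open>Fubini in the direction \<open>b\<close>: with the other coordinates fixed,
  \<open>x \<bullet> c\<close> is constant because \<open>c \<noteq> b\<close>, and the shear is a
  translation of a line.\<close>

lemma nn_integral_lborel_coordinate_shift:
  fixes F :: "'v::euclidean_space \<Rightarrow> ennreal"
  assumes [measurable]: "F \<in> borel_measurable borel" and b: "b \<in> Basis" and c: "c \<in> Basis" and bc: "b \<noteq> c"
  shows "(\<integral>\<^sup>+x. F (x + (x \<bullet> c) *\<^sub>R b) \<partial>lborel) = (\<integral>\<^sup>+x. F x \<partial>lborel)"
proof -
  interpret product_sigma_finite "\<lambda>_::'v. lborel :: real measure"
    by (simp add: product_sigma_finite_def sigma_finite_lborel)
  define I where "I = Basis - {b}"
  have I: "finite I" "b \<notin> I" "insert b I = Basis" "c \<in> I" using b c bc by (auto simp: I_def)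
  let ?S = "\<lambda>f::'v \<Rightarrow> real. \<Sum>d\<in>Basis. f d *\<^sub>R d"
  have conv: "(\<integral>\<^sup>+x. G x \<partial>lborel)
      = (\<integral>\<^sup>+f. (\<integral>\<^sup>+y. G (?S (f(b := y))) \<partial>lborel) \<partial>PiM I (\<lambda>_. lborel))"
    if [measurable]: "G \<in> borel_measurable borel" for G :: "'v \<Rightarrow> ennreal"
  proof -
    have "(\<integral>\<^sup>+x. G x \<partial>lborel) = (\<integral>\<^sup>+f. G (?S f) \<partial>PiM (insert b I) (\<lambda>_. lborel))"
      unfolding I(3) by (subst lborel_eq) (simp add: nn_integral_distr)
    also have "\<dots> = (\<integral>\<^sup>+f. (\<integral>\<^sup>+y. G (?S (f(b := y))) \<partial>lborel) \<partial>PiM I (\<lambda>_. lborel))"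
    proof (rule product_nn_integral_insert[OF I(1,2)])
      show "(\<lambda>f. G (?S f)) \<in> borel_measurable (PiM (insert b I) (\<lambda>_. lborel))"
        unfolding I(3) by measurable
    qed
    finally show ?thesis .
  qed
  have "(\<integral>\<^sup>+y. F (?S (f(b := y)) + (?S (f(b := y)) \<bullet> c) *\<^sub>R b) \<partial>lborel)
      = (\<integral>\<^sup>+y. F (?S (f(b := y))) \<partial>lborel)" for f :: "'v \<Rightarrow> real"
  proof -
    have "?S (f(b := y)) \<bullet> c = f c" for y
      using c bc by (simp add: inner_sum_left inner_Basis if_distrib[of "\<lambda>t. _ * t"] sum.delta cong: if_cong)
    moreover have S: "?S (f(b := y)) = (\<Sum>d\<in>I. f d *\<^sub>R d) + y *\<^sub>R b" for y
      using I by (subst I(3)[symmetric], subst sum.insert) (auto intro!: sum.cong simp: add.commute)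
    ultimately have "?S (f(b := y)) + (?S (f(b := y)) \<bullet> c) *\<^sub>R b = ?S (f(b := f c + 1 * y))" for y
      by (simp add: algebra_simps)
    then have "(\<integral>\<^sup>+y. F (?S (f(b := y)) + (?S (f(b := y)) \<bullet> c) *\<^sub>R b) \<partial>lborel)
        = (\<integral>\<^sup>+y. F (?S (f(b := f c + 1 * y))) \<partial>lborel)" by simp
    also have "\<dots> = (\<integral>\<^sup>+y. F (?S (f(b := y))) \<partial>lborel)"
      using nn_integral_real_affine[of "\<lambda>y. F (?S (f(b := y)))" 1 "f c"] unfolding S by simp
    finally show ?thesis .
  qed
  then show ?thesis by (subst (1 2) conv) (auto intro!: nn_integral_cong)
qed

text \<open>Linear maps are generated by diagonal maps, swaps, shears and maps with an identically
  zero coordinate; the last are vacuous here since their determinant is zero.\<close>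

lemma nn_integral_lborel_linear:
  fixes f :: "real^'n \<Rightarrow> real^'n" and F :: "real^'n \<Rightarrow> ennreal"
  assumes "linear f" "F \<in> borel_measurable borel" "det (matrix f) \<noteq> 0"
  shows "ennreal \<bar>det (matrix f)\<bar> * (\<integral>\<^sup>+x. F (f x) \<partial>lborel) = (\<integral>\<^sup>+x. F x \<partial>lborel)"
proof -
  \<comment> \<open>The quantification over \<open>F\<close> belongs to the induction predicate
    because the composition case applies the hypothesis for \<open>g\<close> to
    \<open>\<lambda>x. F (f x)\<close>.\<close>
  define P where "P f \<longleftrightarrow> (det (matrix f) \<noteq> 0 \<longrightarrow> (\<forall>F\<in>borel_measurable borel.
      ennreal \<bar>det (matrix f)\<bar> * (\<integral>\<^sup>+x. F (f x) \<partial>lborel) = (\<integral>\<^sup>+x. F x \<partial>lborel)))"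
    for f :: "real^'n \<Rightarrow> real^'n"
  have "P f"
  proof (rule induct_linear_elementary[OF assms(1)])
    fix f g :: "real^'n \<Rightarrow> real^'n" assume lin: "linear f" "linear g" and *: "P f" "P g"
    have d: "det (matrix (f \<circ> g)) = det (matrix f) * det (matrix g)"
      using lin by (simp add: matrix_compose det_mul)
    have [measurable]: "f \<in> borel_measurable borel"
      by (intro borel_measurable_continuous_onI linear_continuous_on) (use lin linear_conv_bounded_linear in blast)
    show "P (f \<circ> g)"
      unfolding P_def
    proof (intro impI ballI)
      fix F :: "real^'n \<Rightarrow> ennreal" assume nz: "det (matrix (f \<circ> g)) \<noteq> 0" and [measurable]: "F \<in> borel_measurable borel"
      have 1: "ennreal \<bar>det (matrix g)\<bar> * (\<integral>\<^sup>+x. F (f (g x)) \<partial>lborel) = (\<integral>\<^sup>+x. F (f x) \<partial>lborel)"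
        using *(2) nz d unfolding P_def by (auto elim!: bspec[where x="\<lambda>x. F (f x)"])
      have 2: "ennreal \<bar>det (matrix f)\<bar> * (\<integral>\<^sup>+x. F (f x) \<partial>lborel) = (\<integral>\<^sup>+x. F x \<partial>lborel)"
        using *(1) nz d unfolding P_def by auto
      show "ennreal \<bar>det (matrix (f \<circ> g))\<bar> * (\<integral>\<^sup>+x. F ((f \<circ> g) x) \<partial>lborel) = (\<integral>\<^sup>+x. F x \<partial>lborel)"
        unfolding d 2[symmetric] 1[symmetric] by (simp add: abs_mult ennreal_mult mult.assoc)
    qed
  next
    fix f :: "real^'n \<Rightarrow> real^'n" and i assume "linear f" "\<And>x. f x $ i = 0"
    then have "row i (matrix f) = 0" by (simp add: row_def matrix_def vec_eq_iff)
    then show "P f" unfolding P_def using det_zero_row(2) by blast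
  next
    fix c :: "'n \<Rightarrow> real"
    have m: "matrix (\<lambda>x. \<chi> i. c i * x $ i) $ i $ j = (if i = j then c i else 0)" for i j
      by (simp add: matrix_def axis_def)
    have d: "det (matrix (\<lambda>x. \<chi> i. c i * x $ i)) = (\<Prod>i\<in>UNIV. c i)"
      by (subst det_diagonal) (auto simp: m)
    \<comment> \<open>The affine change of variables indexes scalings by basis vectors;
      \<open>c'\<close> recovers the coordinate from \<open>axis i 1\<close>.\<close>
    define c' where "c' b = c (THE i. b = axis i (1::real))" for b
    have c': "c' (axis i 1) = c i" for i
      by (simp add: c'_def axis_eq_axis)
    have B: "(\<Prod>b\<in>Basis. u b) = (\<Prod>i\<in>UNIV. u (axis i (1::real)))" for u :: "real^'n \<Rightarrow> real"
      by (simp add: Basis_vec_def prod.UNION_disjoint inj_on_def axis_eq_axis prod.reindex cong: prod.cong)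
    have B': "(\<Sum>b\<in>Basis. u b) = (\<Sum>i\<in>UNIV. u (axis i (1::real)))" for u :: "real^'n \<Rightarrow> real^'n"
      by (simp add: Basis_vec_def sum.UNION_disjoint inj_on_def axis_eq_axis sum.reindex cong: sum.cong)
    have T: "(\<lambda>x. \<chi> i. c i * x $ i) = (\<lambda>x::real^'n. 0 + (\<Sum>b\<in>Basis. (c' b * (x \<bullet> b)) *\<^sub>R b))"
      unfolding B' c' inner_axis by (auto simp: fun_eq_iff vec_eq_iff axis_def if_distrib cong: if_cong)
    have [measurable]: "(\<lambda>x::real^'n. \<chi> i. c i * x $ i) \<in> borel_measurable borel"
      by (intro borel_measurable_continuous_onI continuous_intros)
    show "P (\<lambda>x. \<chi> i. c i * x $ i)"
      unfolding P_def d
    proof (intro impI ballI)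
      fix F :: "real^'n \<Rightarrow> ennreal" assume nz: "(\<Prod>i\<in>UNIV. c i) \<noteq> 0" and [measurable]: "F \<in> borel_measurable borel"
      have eq: "lborel = density (distr lborel borel (\<lambda>x::real^'n. \<chi> i. c i * x $ i)) (\<lambda>_. (\<Prod>b\<in>Basis. \<bar>c' b\<bar>))"
        unfolding T by (rule lborel_affine_euclidean) (use nz in \<open>auto simp: Basis_vec_def c'\<close>)
      show "ennreal \<bar>\<Prod>i\<in>UNIV. c i\<bar> * (\<integral>\<^sup>+x. F (\<chi> i. c i * x $ i) \<partial>lborel) = (\<integral>\<^sup>+x. F x \<partial>lborel)"
        by (subst (2) eq) (simp add: nn_integral_density nn_integral_distr nn_integral_cmult B c' abs_prod)
    qed
  next
    fix k l :: 'n assume kl: "k \<noteq> l"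
    have "matrix (\<lambda>x. \<chi> i. x $ Transposition.transpose k l i)
        = (\<chi> i. (mat 1 :: real^'n^'n) $ Transposition.transpose k l i)"
      by (auto simp: matrix_def mat_def axis_def vec_eq_iff)
    then have "\<bar>det (matrix (\<lambda>x::real^'n. \<chi> i. x $ Transposition.transpose k l i))\<bar> = 1"
      using kl by (simp add: det_permute_rows permutes_swap_id sign_swap_id)
    then show "P (\<lambda>x. \<chi> i. x $ Transposition.transpose k l i)"
      unfolding P_def by (simp add: nn_integral_lborel_swap_coordinates)
  next
    fix k l :: 'n assume kl: "k \<noteq> l"
    have eq: "(\<lambda>x::real^'n. \<chi> i. if i = k then x $ k + x $ l else x $ i) = (\<lambda>x. x + (x \<bullet> axis l 1) *\<^sub>R axis k 1)"
      unfolding inner_axis by (auto simp: fun_eq_iff vec_eq_iff axis_def)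
    have "matrix (\<lambda>x. \<chi> i. if i = k then x $ k + x $ l else x $ i)
        = (\<chi> i. if i = k then row k (mat 1 :: real^'n^'n) + 1 *s row l (mat 1) else row i (mat 1))"
      by (auto simp: matrix_def mat_def axis_def vec_eq_iff row_def)
    then have "det (matrix (\<lambda>x::real^'n. \<chi> i. if i = k then x $ k + x $ l else x $ i)) = 1"
      using det_row_operation[OF kl, of "mat 1 :: real^'n^'n" 1] by simp
    moreover have "axis k (1::real) \<noteq> axis l 1" using kl by (simp add: axis_eq_axis)
    ultimately show "P (\<lambda>x. \<chi> i. if i = k then x $ k + x $ l else x $ i)"
      unfolding P_def eq by (simp add: nn_integral_lborel_coordinate_shift)
  qed
  then show ?thesis using assms unfolding P_def by blast
qed

subsection \<open>Gaussian laws\<close>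

definition gauss :: "'v::euclidean_space \<Rightarrow> real" where
  "gauss x = exp (- (norm x)\<^sup>2 / 2) / sqrt (2 * pi) ^ DIM('v)"

definition gauss_scaled :: "real \<Rightarrow> 'v::euclidean_space \<Rightarrow> real" where
  "gauss_scaled e x = gauss (x /\<^sub>R e) / e ^ DIM('v)"

definition gauss_law :: "'v::euclidean_space \<Rightarrow> 'v measure" where
  "gauss_law k = density lborel (\<lambda>x. ennreal (gauss (x - k)))"

lemma gauss_pos: "0 < gauss x"
  by (simp add: gauss_def)

lemma gauss_nonneg [simp]: "0 \<le> gauss x"
  by (rule less_imp_le[OF gauss_pos])

lemma gauss_measurable [measurable]: "gauss \<in> borel_measurable borel"
  unfolding gauss_def by measurable

lemma gauss_scaled_pos: "0 < e \<Longrightarrow> 0 < gauss_scaled e x"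
  by (simp add: gauss_scaled_def gauss_pos)

lemma gauss_scaled_measurable [measurable]: "gauss_scaled e \<in> borel_measurable borel"
  unfolding gauss_scaled_def by measurable

lemma gauss_eq_prod: "gauss (x::'v::euclidean_space) = (\<Prod>b\<in>Basis. std_normal_density (x \<bullet> b))"
proof -
  have "(norm x)\<^sup>2 = (\<Sum>b\<in>Basis. (x \<bullet> b)\<^sup>2)"
    unfolding power2_norm_eq_inner euclidean_inner[of x x] by (simp add: power2_eq_square)
  then have "exp (- (norm x)\<^sup>2 / 2) = (\<Prod>b\<in>Basis. exp (- (x \<bullet> b)\<^sup>2 / 2))"
    by (simp add: exp_sum[symmetric] sum_negf sum_divide_distrib)
  then show ?thesis
    by (simp add: gauss_def std_normal_density_def prod.distrib prod_dividef power_divide)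
qed

text \<open>Reduces the normalisation and the characteristic function of the multivariate law to
  one-dimensional facts about \<open>std_normal_distribution\<close>.\<close>

lemma gauss_law_0_eq:
  "gauss_law (0::'v::euclidean_space)
    = distr (PiM Basis (\<lambda>_. std_normal_distribution)) borel (\<lambda>f. \<Sum>b\<in>Basis. f b *\<^sub>R b)"
proof -
  have "PiM (Basis::'v set) (\<lambda>_. std_normal_distribution)
      = density (PiM Basis (\<lambda>_. lborel)) (\<lambda>f. \<Prod>b\<in>Basis. ennreal (std_normal_density (f b)))"
    using prob_space_normal_density[of 1 0]
    by (intro PiM_density sigma_finite_lborel prob_space_imp_sigma_finite) auto
  also have "\<dots> = density (PiM Basis (\<lambda>_. lborel)) (\<lambda>f. ennreal (gauss (\<Sum>b\<in>Basis. f b *\<^sub>R b :: 'v)))"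
    by (intro density_cong) (auto simp: gauss_eq_prod prod_ennreal)
  finally show ?thesis
    unfolding gauss_law_def diff_zero by (subst lborel_eq, subst density_distr) auto
qed

lemma gauss_exp_inner: "gauss x * exp (v \<bullet> x) = exp ((norm v)\<^sup>2 / 2) * gauss (x - v)"
proof -
  have "- (norm x)\<^sup>2 / 2 + v \<bullet> x = (norm v)\<^sup>2 / 2 + - (norm (x - v))\<^sup>2 / 2"
    by (simp add: power2_norm_eq_inner inner_diff inner_commute field_simps)
  then show ?thesis
    unfolding gauss_def by (simp add: exp_add[symmetric] mult.commute)
qed

lemma prob_space_gauss_law_0: "prob_space (gauss_law (0::'v::euclidean_space))"
proof -
  interpret prob_space "PiM (Basis::'v set) (\<lambda>_. std_normal_distribution)"
    by (rule prob_space_PiM) (use prob_space_normal_density[of 1 0] in simp)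
  show ?thesis unfolding gauss_law_0_eq by (rule prob_space_distr) simp
qed

lemma nn_integral_gauss_scaled:
  fixes c :: "'v::euclidean_space"
  assumes e: "0 < e"
  shows "(\<integral>\<^sup>+x. ennreal (gauss_scaled e (x - c)) \<partial>lborel) = 1"
proof -
  have 1: "(\<integral>\<^sup>+x. ennreal (gauss (x::'v)) \<partial>lborel) = 1"
    using prob_space.emeasure_space_1[OF prob_space_gauss_law_0[where 'v='v]]
    by (simp add: gauss_law_def emeasure_density)
  have "(\<integral>\<^sup>+x. ennreal (gauss_scaled e (x - c)) \<partial>lborel)
      = (\<integral>\<^sup>+x. ennreal (gauss_scaled e (x - c)) \<partial>density (distr lborel borel (\<lambda>x. c + e *\<^sub>R x)) (\<lambda>_. \<bar>e\<bar>^DIM('v)))"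
    by (subst lborel_affine[of e c, symmetric]) (use e in auto)
  also have "\<dots> = (\<integral>\<^sup>+x. ennreal (gauss (x::'v)) \<partial>lborel)"
    using e by (simp add: nn_integral_density nn_integral_distr gauss_scaled_def ennreal_mult[symmetric])
  finally show ?thesis using 1 by simp
qed

lemma gauss_scaled_1: "gauss_scaled 1 = gauss"
  by (simp add: gauss_scaled_def fun_eq_iff)

lemma nn_integral_gauss: "(\<integral>\<^sup>+x. ennreal (gauss (x - c)) \<partial>lborel) = 1"
  using nn_integral_gauss_scaled[of 1 c] by (simp add: gauss_scaled_1)

lemma prob_space_gauss_law: "prob_space (gauss_law k)"
  by (rule prob_spaceI) (simp add: gauss_law_def emeasure_density nn_integral_gauss)

lemma sets_gauss_law [simp, measurable_cong]: "sets (gauss_law k) = sets borel"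
  by (simp add: gauss_law_def)

lemma space_gauss_law [simp]: "space (gauss_law k) = UNIV"
  by (simp add: gauss_law_def)

section \<open>Fourier representation and limits of smoothed densities\<close>

lemma char_gauss_law_0:
  fixes t :: "'v::euclidean_space"
  shows "(\<integral>z. iexp (t \<bullet> z) \<partial>gauss_law 0) = complex_of_real (exp (- (norm t)\<^sup>2 / 2))"
proof -
  interpret N: prob_space std_normal_distribution using prob_space_normal_density[of 1 0] by simp
  interpret product_sigma_finite "\<lambda>_::'v. std_normal_distribution"
    by (simp add: product_sigma_finite_def N.sigma_finite_measure_axioms)
  have "(\<integral>z. iexp (t \<bullet> z) \<partial>gauss_law 0)
      = (\<integral>f. iexp (t \<bullet> (\<Sum>b\<in>Basis. f b *\<^sub>R b)) \<partial>PiM Basis (\<lambda>_. std_normal_distribution))"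
    unfolding gauss_law_0_eq by (subst integral_distr) auto
  also have "\<dots> = (\<integral>f. (\<Prod>b\<in>Basis. iexp ((t \<bullet> b) * f b)) \<partial>PiM Basis (\<lambda>_. std_normal_distribution))"
    by (simp add: inner_sum_right exp_sum[symmetric] sum_distrib_left mult_ac)
  also have "\<dots> = (\<Prod>b\<in>Basis. \<integral>x. iexp ((t \<bullet> b) * x) \<partial>std_normal_distribution)"
    by (rule product_integral_prod) (auto intro!: N.integrable_iexp)
  also have "\<dots> = (\<Prod>b\<in>Basis. complex_of_real (exp (- (t \<bullet> b)\<^sup>2 / 2)))"
    using char_std_normal_distribution by (simp add: char_def fun_eq_iff)
  also have "\<dots> = complex_of_real (exp (\<Sum>b\<in>Basis. - (t \<bullet> b)\<^sup>2 / 2))"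
    by (simp add: exp_sum)
  also have "(\<Sum>b\<in>Basis. - (t \<bullet> b)\<^sup>2 / 2) = - (norm t)\<^sup>2 / 2"
    unfolding power2_norm_eq_inner euclidean_inner[of t t]
    by (simp add: power2_eq_square sum_negf sum_divide_distrib)
  finally show ?thesis .
qed

text \<open>A Gaussian density is, up to a constant, its own characteristic function, so the
  smoothing kernel is an average of characters under a probability measure. This makes Fourier
  inversion explicit.\<close>

lemma gauss_scaled_fourier:
  fixes x :: "'v::euclidean_space"
  shows "complex_of_real (gauss_scaled e x) = of_real (gauss_scaled e (0::'v)) * (\<integral>t. iexp (t \<bullet> (x /\<^sub>R e)) \<partial>gauss_law 0)"
  using char_gauss_law_0[of "x /\<^sub>R e"]
  by (simp add: gauss_scaled_def gauss_def inner_commute)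

text \<open>For \<open>0 < e\<close> the integral on the left is the density at \<open>y\<close> of
  \<open>a *\<^sub>R Y + e *\<^sub>R Z\<close> with an independent standard Gaussian
  \<open>Z\<close>. The characters have modulus 1, which is what permits Fubini's theorem here and
  dominated convergence later.\<close>

lemma smoothed_density_fourier:
  fixes Y :: "'a \<Rightarrow> 'v::euclidean_space"
  assumes M: "prob_space M" and [measurable]: "Y \<in> borel_measurable M"
  shows "complex_of_real (\<integral>\<omega>. gauss_scaled e (y - a *\<^sub>R Y \<omega>) \<partial>M) = of_real (gauss_scaled e (0::'v)) *
    (\<integral>t. iexp (t \<bullet> (y /\<^sub>R e)) * (\<integral>\<omega>. iexp ((- (a / e) *\<^sub>R t) \<bullet> Y \<omega>) \<partial>M) \<partial>gauss_law 0)"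
proof -
  interpret M: prob_space M by (rule M)
  interpret G: prob_space "gauss_law (0::'v)" by (rule prob_space_gauss_law)
  interpret pair_prob_space M "gauss_law (0::'v)" ..
  let ?F = "\<lambda>\<omega> t. iexp (t \<bullet> ((y - a *\<^sub>R Y \<omega>) /\<^sub>R e))"
  have int: "integrable (M \<Otimes>\<^sub>M gauss_law 0) (\<lambda>(\<omega>, t). ?F \<omega> t)"
    by (rule P.integrable_const_bound[where B=1]) (auto simp: split_beta)
  have "complex_of_real (\<integral>\<omega>. gauss_scaled e (y - a *\<^sub>R Y \<omega>) \<partial>M)
      = (\<integral>\<omega>. complex_of_real (gauss_scaled e (y - a *\<^sub>R Y \<omega>)) \<partial>M)"
    by simp
  also have "\<dots> = of_real (gauss_scaled e (0::'v)) * (\<integral>\<omega>. (\<integral>t. ?F \<omega> t \<partial>gauss_law 0) \<partial>M)"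
    by (subst gauss_scaled_fourier) simp
  also have "(\<integral>\<omega>. (\<integral>t. ?F \<omega> t \<partial>gauss_law 0) \<partial>M) = (\<integral>t. (\<integral>\<omega>. ?F \<omega> t \<partial>M) \<partial>gauss_law 0)"
    by (rule Fubini_integral[OF int, symmetric])
  also have "\<dots> = (\<integral>t. (\<integral>\<omega>. iexp (t \<bullet> (y /\<^sub>R e)) * iexp ((- (a / e) *\<^sub>R t) \<bullet> Y \<omega>) \<partial>M) \<partial>gauss_law 0)"
    by (intro Bochner_Integration.integral_cong refl)
       (simp add: exp_add[symmetric] inner_diff_right algebra_simps divide_inverse)
  finally show ?thesis by simp
qed

text \<open>Rotation invariance: both sides are the joint density of two standard Gaussians with
  correlation \<open>a\<close>, which is symmetric in \<open>x\<close> and \<open>z\<close>.\<close>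

lemma gauss_convolution:
  fixes x z :: "'v::euclidean_space"
  assumes "a\<^sup>2 + e\<^sup>2 = 1" "0 < e"
  shows "gauss z * gauss_scaled e (x - a *\<^sub>R z) = gauss x * gauss_scaled e (z - a *\<^sub>R x)"
proof -
  have "(norm (x - a *\<^sub>R z))\<^sup>2 + e\<^sup>2 * (norm z)\<^sup>2 = (norm (z - a *\<^sub>R x))\<^sup>2 + e\<^sup>2 * (norm x)\<^sup>2"
  proof -
    have e: "e\<^sup>2 = 1 - a\<^sup>2" using assms by simp
    show ?thesis unfolding e
      by (simp add: power2_norm_eq_inner inner_diff inner_commute algebra_simps power2_eq_square[of a])
  qed
  then have "- (norm z)\<^sup>2 / 2 + - (norm ((x - a *\<^sub>R z) /\<^sub>R e))\<^sup>2 / 2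
    = - (norm x)\<^sup>2 / 2 + - (norm ((z - a *\<^sub>R x) /\<^sub>R e))\<^sup>2 / 2"
    unfolding norm_scaleR power_mult_distrib power2_abs using assms(2)
    by (simp add: power_inverse field_simps)
  from arg_cong[OF this, of exp, unfolded exp_add] show ?thesis
    by (simp add: gauss_scaled_def gauss_def)
qed

lemma integral_gauss_scaled_gauss_law:
  fixes x :: "'v::euclidean_space"
  assumes "a\<^sup>2 + e\<^sup>2 = 1" "0 < e"
  shows "(\<integral>z. gauss_scaled e (x - a *\<^sub>R z) \<partial>gauss_law 0) = gauss x"
proof -
  have "(\<integral>\<^sup>+z. ennreal (gauss x * gauss_scaled e (z - a *\<^sub>R x)) \<partial>lborel) = ennreal (gauss x)"
    using nn_integral_gauss_scaled[OF assms(2), of "a *\<^sub>R x"]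
    by (subst ennreal_mult') (simp_all add: nn_integral_cmult)
  then have "(\<integral>z. gauss x * gauss_scaled e (z - a *\<^sub>R x) \<partial>lborel) = gauss x"
    by (subst integral_eq_nn_integral) (auto simp: less_imp_le gauss_scaled_pos[OF assms(2)])
  moreover have "(\<integral>z. gauss_scaled e (x - a *\<^sub>R z) \<partial>gauss_law 0) = (\<integral>z. gauss z * gauss_scaled e (x - a *\<^sub>R z) \<partial>lborel)"
    unfolding gauss_law_def by (subst integral_density) auto
  ultimately show ?thesis by (simp add: gauss_convolution[OF assms])
qed

text \<open>The limit is brought into the same Fourier form, with the identity under
  \<open>gauss_law 0\<close> in place of \<open>Y\<close>, so only characteristic functions have to
  be compared and the constant 1 dominates. The evaluation point may move with \<open>n\<close>,
  since the local parameter will shift it.\<close>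

lemma smoothed_density_tendsto:
  fixes Y :: "nat \<Rightarrow> 'a \<Rightarrow> 'v::euclidean_space"
  assumes M: "\<And>n. prob_space (M n)" and Y[measurable]: "\<And>n. Y n \<in> borel_measurable (M n)"
    and ch: "\<And>t. (\<lambda>n. \<integral>\<omega>. iexp (t \<bullet> Y n \<omega>) \<partial>M n) \<longlonglongrightarrow> complex_of_real (exp (- (norm t)\<^sup>2 / 2))"
    and ae: "a\<^sup>2 + e\<^sup>2 = 1" "0 < e" and x: "x \<longlonglongrightarrow> x0"
  shows "(\<lambda>n. \<integral>\<omega>. gauss_scaled e (x n - a *\<^sub>R Y n \<omega>) \<partial>M n) \<longlonglongrightarrow> gauss x0"
proof -
  interpret G: prob_space "gauss_law (0::'v)" by (rule prob_space_gauss_law)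
  let ?H = "\<lambda>n t. iexp (t \<bullet> (x n /\<^sub>R e)) * (\<integral>\<omega>. iexp ((- (a / e) *\<^sub>R t) \<bullet> Y n \<omega>) \<partial>M n)"
  let ?L = "\<lambda>t. iexp (t \<bullet> (x0 /\<^sub>R e)) * (\<integral>z. iexp ((- (a / e) *\<^sub>R t) \<bullet> z) \<partial>gauss_law 0)"
  have "(\<lambda>n. \<integral>t. ?H n t \<partial>gauss_law 0) \<longlonglongrightarrow> (\<integral>t. ?L t \<partial>gauss_law 0)"
  proof (rule integral_dominated_convergence[where w="\<lambda>_. 1"])
    show "AE t in gauss_law 0. (\<lambda>n. ?H n t) \<longlonglongrightarrow> ?L t"
      unfolding char_gauss_law_0 by (intro always_eventually allI tendsto_intros x ch)
    show "AE t in gauss_law 0. norm (?H n t) \<le> 1" for n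
    proof (intro always_eventually allI)
      fix t
      interpret M: prob_space "M n" by (rule M)
      have "norm (\<integral>\<omega>. iexp ((- (a / e) *\<^sub>R t) \<bullet> Y n \<omega>) \<partial>M n)
          \<le> (\<integral>\<omega>. norm (iexp ((- (a / e) *\<^sub>R t) \<bullet> Y n \<omega>)) \<partial>M n)" by (rule integral_norm_bound)
      then show "norm (?H n t) \<le> 1" by (simp add: norm_mult M.prob_space)
    qed
    show "?H n \<in> borel_measurable (gauss_law 0)" for n
    proof -
      interpret M: prob_space "M n" by (rule M)
      show ?thesis by measurable
    qed
    show "?L \<in> borel_measurable (gauss_law 0)" unfolding char_gauss_law_0 by measurable
  qed simp
  then have "(\<lambda>n. complex_of_real (\<integral>\<omega>. gauss_scaled e (x n - a *\<^sub>R Y n \<omega>) \<partial>M n))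
     \<longlonglongrightarrow> complex_of_real (\<integral>z. gauss_scaled e (x0 - a *\<^sub>R z) \<partial>gauss_law 0)"
    unfolding smoothed_density_fourier[OF M Y]
    by (subst smoothed_density_fourier[OF prob_space_gauss_law]) (auto intro!: tendsto_intros)
  then show ?thesis
    unfolding integral_gauss_scaled_gauss_law[OF ae] tendsto_of_real_iff .
qed

section \<open>Whitening a positive definite matrix\<close>

lemma whitening_matrix_exists:
  fixes J :: "real^'n^'n"
  assumes sym: "transpose J = J" and pos: "\<And>v. v \<noteq> 0 \<Longrightarrow> 0 < v \<bullet> (J *v v)"
  shows "\<exists>B::real^'n^'n. transpose B ** J ** B = mat 1"
proof -
  let ?b = "\<lambda>u v. u \<bullet> (J *v v)"
  have bsym: "?b u v = ?b v u" for u v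
    by (metis sym dot_lmul_matrix inner_commute transpose_matrix_vector)
  \<comment> \<open>Gram-Schmidt for the inner product \<open>u \<bullet> (J *v v)\<close>. The
    vectors are indexed by coordinates so that in the end they can be read as the columns of
    \<open>B\<close>.\<close>
  have "\<exists>f. \<forall>i\<in>S. \<forall>j\<in>S. ?b (f i) (f j) = (if i = j then 1 else 0)" if "finite S" for S :: "'n set"
    using that
  proof (induction S)
    case (insert s S)
    then obtain f where f: "\<And>i j. i \<in> S \<Longrightarrow> j \<in> S \<Longrightarrow> ?b (f i) (f j) = (if i = j then 1 else 0)" by blast
    \<comment> \<open>Fewer than \<open>CARD('n)\<close> vectors cannot span, which leaves a
      \<open>v\<close> to orthogonalise. The residual \<open>w\<close> is nonzero because
      \<open>v\<close> is outside the span, and \<open>pos\<close> allows it to be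
      normalised.\<close>
    have "dim (span (f ` S)) \<le> card (f ` S)" using dim_le_card'[of "f ` S"] by simp
    also have "\<dots> \<le> card S" by (rule card_image_le) simp
    also have "\<dots> < CARD('n)" using insert(2) by (intro psubset_card_mono) auto
    finally have dlt: "dim (span (f ` S)) < CARD('n)" .
    have "span (f ` S) \<noteq> UNIV"
    proof
      assume "span (f ` S) = UNIV"
      with dlt have "dim (UNIV :: (real^'n) set) < CARD('n)" by (simp only:)
      then show False by (simp add: dim_UNIV)
    qed
    then obtain v where v: "v \<notin> span (f ` S)" by blast
    define w where "w = v - (\<Sum>i\<in>S. ?b (f i) v *\<^sub>R f i)"
    have "(\<Sum>i\<in>S. ?b (f i) v *\<^sub>R f i) \<in> span (f ` S)"
      by (intro span_sum span_mul span_base imageI)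
    then have "w \<noteq> 0" using v unfolding w_def by auto
    then have wp: "0 < ?b w w" by (rule pos)
    have wf: "?b (f j) w = 0" if j: "j \<in> S" for j
    proof -
      have "?b (f j) w = ?b (f j) v - (\<Sum>i\<in>S. ?b (f i) v * ?b (f j) (f i))"
        by (simp add: w_def matrix_vector_mult_diff_distrib vec.sum matrix_vector_mult_scaleR inner_diff_right
            inner_sum_right linear_sum[OF matrix_vector_mul_linear])
      also have "\<dots> = ?b (f j) v - (\<Sum>i\<in>S. ?b (f i) v * (if j = i then 1 else 0))"
        using f j by (intro arg_cong2[where f="(-)"] refl sum.cong) auto
      also have "\<dots> = 0" using j by (simp add: if_distrib cong: if_cong)
      finally show ?thesis .
    qed
    have fw: "?b w (f j) = 0" if j: "j \<in> S" for j
      using wf[OF j] by (subst bsym)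
    define g where "g = f(s := w /\<^sub>R sqrt (?b w w))"
    have "?b (g i) (g j) = (if i = j then 1 else 0)" if "i \<in> insert s S" "j \<in> insert s S" for i j
    proof -
      have ww: "inverse (sqrt (?b w w)) * (inverse (sqrt (?b w w)) * ?b w w) = 1"
        using wp by (simp add: mult.assoc[symmetric] inverse_mult_distrib[symmetric] del: inverse_mult_distrib)
      show ?thesis
        using that insert(2) by (auto simp: g_def f ww matrix_vector_mult_scaleR wf fw)
    qed
    then show ?case by blast
  qed simp
  from this[OF finite[of UNIV]] obtain f :: "'n \<Rightarrow> real^'n"
    where "\<forall>i\<in>UNIV. \<forall>j\<in>UNIV. ?b (f i) (f j) = (if i = j then 1 else 0)" ..
  then have f: "?b (f i) (f j) = (if i = j then 1 else 0)" for i j :: 'n by simp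
  define B :: "real^'n^'n" where "B = (\<chi> r c. f c $ r)"
  have "(transpose B ** J ** B) $ i $ j = ?b (f i) (f j)" for i j
    by (simp add: B_def matrix_matrix_mult_def transpose_def inner_vec_def matrix_vector_mult_def
        sum_distrib_left sum_distrib_right mult_ac) (rule sum.swap)
  then have "transpose B ** J ** B = mat 1" using f by (simp add: vec_eq_iff mat_def)
  then show ?thesis ..
qed

lemma matrix_inv_eqI:
  fixes A B :: "real^'n^'n"
  assumes "A ** B = mat 1" "B ** A = mat 1"
  shows "matrix_inv A = B"
proof -
  have inv: "A ** matrix_inv A = mat 1 \<and> matrix_inv A ** A = mat 1"
    unfolding matrix_inv_def by (rule someI[where x=B]) (use assms in simp)
  have "matrix_inv A = (B ** A) ** matrix_inv A" using assms by simp
  also have "\<dots> = B ** (A ** matrix_inv A)" by (simp only: matrix_mul_assoc)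
  finally show ?thesis using inv by simp
qed

lemma inner_matrix_mult_left: "(B *v v) \<bullet> w = v \<bullet> (transpose B *v w)" for B :: "real^'n^'n"
  by (metis dot_lmul_matrix inner_commute transpose_matrix_vector transpose_transpose)

lemma inner_whitening:
  fixes B J :: "real^'n^'n"
  assumes "transpose B ** J ** B = mat 1"
  shows "(B *v v) \<bullet> (J *v (B *v v)) = (norm v)\<^sup>2"
proof -
  have "(B *v v) \<bullet> (J *v (B *v v)) = v \<bullet> ((transpose B ** J ** B) *v v)"
    unfolding inner_matrix_mult_left by (simp add: matrix_vector_mul_assoc matrix_mul_assoc)
  then show ?thesis by (simp add: assms power2_norm_eq_inner)
qed

text \<open>The hypothesis gives \<open>B ** transpose B = matrix_inv J\<close>, so \<open>B\<close>
  carries unit covariance to the required one. On the level of densities, the determinant in the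
  normalising constant is \<open>(det B)\<^sup>2\<close>, and its root cancels the Jacobian.\<close>

lemma mvnormal_eq_distr_gauss_law:
  fixes B J :: "real^'n^'n"
  assumes BJ: "transpose B ** J ** B = mat 1"
  shows "mvnormal (B *v k) (matrix_inv J) = distr (gauss_law k) borel ((*v) B)"
proof (rule measure_eqI)
  have [measurable]: "(*v) A \<in> borel_measurable borel" for A :: "real^'n^'n"
    by (intro borel_measurable_continuous_onI continuous_intros)
  have "det (transpose B ** J ** B) = 1" using BJ by simp
  then have dB: "(det B)\<^sup>2 * det J = 1" by (simp add: det_mul power2_eq_square mult_ac)
  then have d0: "det B \<noteq> 0" "det J \<noteq> 0" by auto
  obtain J' where J': "J ** J' = mat 1" "J' ** J = mat 1"
    using d0 unfolding invertible_det_nz[symmetric] invertible_def by blast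
  then have JJ: "J ** matrix_inv J = mat 1" "matrix_inv J ** J = mat 1"
    using matrix_inv_eqI[OF J'] by simp_all
  have JJ': "matrix_inv (matrix_inv J) = J"
    using JJ by (intro matrix_inv_eqI)
  have "det J * det (matrix_inv J) = 1" using arg_cong[OF JJ(1), of det] by (simp add: det_mul)
  then have dJ: "det (matrix_inv J) = (det B)\<^sup>2" using dB d0
    by (metis mult.commute mult_left_cancel)
  have dens: "\<bar>det B\<bar> * mvnormal_density (B *v k) (matrix_inv J) (B *v x) = gauss (x - k)" for x
  proof -
    have "(B *v x - B *v k) \<bullet> (J *v (B *v x - B *v k)) = (norm (x - k))\<^sup>2"
      by (simp add: matrix_vector_mult_diff_distrib[symmetric] inner_whitening[OF BJ])
    moreover have "sqrt ((2 * pi) ^ CARD('n) * (det B)\<^sup>2) = sqrt (2 * pi) ^ CARD('n) * \<bar>det B\<bar>"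
      unfolding real_sqrt_mult[of "(2 * pi) ^ _"] real_sqrt_power[of "2 * pi"] real_sqrt_abs ..
    ultimately show ?thesis
      using d0 by (simp add: mvnormal_density_def JJ' dJ gauss_def del: real_sqrt_mult)
  qed
  have [measurable]: "mvnormal_density (B *v k) (matrix_inv J) \<in> borel_measurable borel"
    unfolding mvnormal_density_def by measurable
  show "sets (mvnormal (B *v k) (matrix_inv J)) = sets (distr (gauss_law k) borel ((*v) B))"
    by (simp add: mvnormal_def)
  fix A assume "A \<in> sets (mvnormal (B *v k) (matrix_inv J))"
  then have [measurable]: "A \<in> sets borel" by (simp add: mvnormal_def)
  have "emeasure (mvnormal (B *v k) (matrix_inv J)) A
      = (\<integral>\<^sup>+x. ennreal (mvnormal_density (B *v k) (matrix_inv J) x) * indicator A x \<partial>lborel)"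
    unfolding mvnormal_def by (subst emeasure_density) auto
  also have "\<dots> = ennreal \<bar>det B\<bar> *
      (\<integral>\<^sup>+x. ennreal (mvnormal_density (B *v k) (matrix_inv J) (B *v x)) * indicator A (B *v x) \<partial>lborel)"
    using nn_integral_lborel_linear[of "(*v) B"
        "\<lambda>x. ennreal (mvnormal_density (B *v k) (matrix_inv J) x) * indicator A x"] d0
    by simp
  also have "\<dots> = (\<integral>\<^sup>+x. ennreal (gauss (x - k)) * indicator A (B *v x) \<partial>lborel)"
    by (subst nn_integral_cmult[symmetric]) (auto simp: dens[symmetric] ennreal_mult' mult.assoc)
  also have "\<dots> = emeasure (distr (gauss_law k) borel ((*v) B)) A"
    using measurable_sets[of "(*v) B" borel borel A] unfolding gauss_law_def
    by (subst emeasure_distr; (subst emeasure_density)?) (auto intro!: nn_integral_cong simp: indicator_def)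
  finally show "emeasure (mvnormal (B *v k) (matrix_inv J)) A = emeasure (distr (gauss_law k) borel ((*v) B)) A" .
qed

subsection \<open>Exponential tilting of a standardised score\<close>

text \<open>The score after whitening. Exponential moments are asked of the norm so that one
  function of \<open>norm (s x)\<close> dominates the Taylor remainders for all \<open>u\<close> in
  a ball.\<close>

locale std_score = prob_space P for P :: "'a measure" +
  fixes s :: "'a \<Rightarrow> 'v::euclidean_space"
  assumes s_measurable [measurable]: "s \<in> borel_measurable P"
    and integrable_exp_norm: "\<And>c. integrable P (\<lambda>x. exp (c * norm (s x)))"
    and mean_score: "\<And>v. (\<integral>x. v \<bullet> s x \<partial>P) = 0"
    and variance_score: "\<And>v. (\<integral>x. (v \<bullet> s x)\<^sup>2 \<partial>P) = (norm v)\<^sup>2"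
begin

definition mgf :: "'v \<Rightarrow> real" where
  "mgf u = (\<integral>x. exp (u \<bullet> s x) \<partial>P)"

definition cumulant :: "'v \<Rightarrow> real" where
  "cumulant u = ln (mgf u)"

definition score_sum :: "nat \<Rightarrow> (nat \<Rightarrow> 'a) \<Rightarrow> 'v" where
  "score_sum n X = (1 / sqrt (real n)) *\<^sub>R (\<Sum>i<n. s (X i))"

lemma integrable_power_exp: "integrable P (\<lambda>x. norm (s x) ^ k * exp (c * norm (s x)))"
proof (rule Bochner_Integration.integrable_bound[OF integrable_exp_norm[of "real k + c"]])
  have "norm (s x) ^ k * exp (c * norm (s x)) \<le> exp ((real k + c) * norm (s x))" for x
  proof -
    have "norm (s x) \<le> exp (norm (s x))" using exp_ge_add_one_self[of "norm (s x)"] by linarith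
    then have "norm (s x) ^ k \<le> exp (norm (s x)) ^ k" by (intro power_mono) auto
    also have "\<dots> = exp (real k * norm (s x))" by (simp add: exp_of_nat_mult)
    finally show ?thesis by (simp add: distrib_right exp_add)
  qed
  then show "AE x in P. norm (norm (s x) ^ k * exp (c * norm (s x))) \<le> norm (exp ((real k + c) * norm (s x)))"
    by (simp add: abs_mult)
qed measurable

lemma integrable_power_exp_bound:
  fixes f :: "'a \<Rightarrow> 'b::{banach, second_countable_topology}"
  assumes [measurable]: "f \<in> borel_measurable P"
    and "\<And>x. norm (f x) \<le> C * (norm (s x) ^ k * exp (c * norm (s x)))"
  shows "integrable P f"
proof (rule Bochner_Integration.integrable_bound[OF integrable_mult_right[OF integrable_power_exp]])
  show "AE x in P. norm (f x) \<le> norm (C * (norm (s x) ^ k * exp (c * norm (s x))))"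
    by (intro AE_I2 order_trans[OF assms(2)]) (simp only: real_norm_def abs_ge_self)
qed fact

lemma inner_score_le: "\<bar>u \<bullet> s x\<bar> \<le> norm u * norm (s x)"
  by (rule Cauchy_Schwarz_ineq2)

lemma integrable_inner_power: "integrable P (\<lambda>x. (u \<bullet> s x) ^ k)"
proof (rule integrable_power_exp_bound[where C="norm u ^ k" and c=0 and k=k])
  show "norm ((u \<bullet> s x) ^ k) \<le> norm u ^ k * (norm (s x) ^ k * exp (0 * norm (s x)))" for x
    using power_mono[OF inner_score_le, of u x k] by (simp add: power_abs power_mult_distrib)
qed measurable

lemma integrable_inner: "integrable P (\<lambda>x. u \<bullet> s x)"
  using integrable_inner_power[of u 1] by simp

lemma integrable_exp_inner: "integrable P (\<lambda>x. exp (u \<bullet> s x))"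
proof (rule integrable_power_exp_bound[where C=1 and c="norm u" and k=0])
  show "norm (exp (u \<bullet> s x)) \<le> 1 * (norm (s x) ^ 0 * exp (norm u * norm (s x)))" for x
    using inner_score_le[of u x] by simp
qed measurable

text \<open>\<open>exp y\<close> is at least \<open>1 + y\<close>, and the score has mean zero. The
  resulting sign of the cumulant is used in the Hellinger estimate for tilted laws.\<close>

lemma mgf_ge_1: "1 \<le> mgf u"
proof -
  have "(\<integral>x. 1 + u \<bullet> s x \<partial>P) \<le> mgf u"
    unfolding mgf_def by (intro integral_mono) (auto simp: integrable_inner integrable_exp_inner)
  then show ?thesis by (simp add: integrable_inner mean_score prob_space)
qed

lemma exp_cumulant: "exp (cumulant u) = mgf u"
  using mgf_ge_1[of u] by (simp add: cumulant_def)

lemma cumulant_nonneg: "0 \<le> cumulant u"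
  using mgf_ge_1[of u] by (simp add: cumulant_def)

text \<open>Taylor expansion with cubic remainder, the first two moments being those of the locale.
  The radius \<open>r\<close> is decoupled from \<open>u\<close> so that the remainder constant
  stays fixed along a sequence of parameters.\<close>

lemma mgf_expansion:
  assumes "norm u \<le> r"
  shows "\<bar>mgf u - 1 - (norm u)\<^sup>2 / 2\<bar> \<le> norm u ^ 3 * (\<integral>x. norm (s x) ^ 3 * exp (r * norm (s x)) \<partial>P)"
proof -
  have "mgf u - 1 - (norm u)\<^sup>2 / 2 = (\<integral>x. exp (u \<bullet> s x) - (1 + u \<bullet> s x + (u \<bullet> s x)\<^sup>2 / 2) \<partial>P)"
    by (simp add: integrable_inner integrable_exp_inner integrable_inner_power mean_score variance_score
        prob_space mgf_def)
  also have "\<bar>\<dots>\<bar> \<le> (\<integral>x. \<bar>exp (u \<bullet> s x) - (1 + u \<bullet> s x + (u \<bullet> s x)\<^sup>2 / 2)\<bar> \<partial>P)"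
    by (rule integral_abs_bound)
  also have "\<dots> \<le> (\<integral>x. norm u ^ 3 * (norm (s x) ^ 3 * exp (r * norm (s x))) \<partial>P)"
  proof (intro integral_mono integrable_mult_right integrable_power_exp)
    fix x
    have "\<bar>exp (u \<bullet> s x) - (1 + u \<bullet> s x + (u \<bullet> s x)\<^sup>2 / 2)\<bar> \<le> exp \<bar>u \<bullet> s x\<bar> * \<bar>u \<bullet> s x\<bar> ^ 3 / 2"
      using Taylor_exp_field[of "u \<bullet> s x" 2] by (simp add: numeral_eq_Suc)
    also have "\<dots> \<le> exp \<bar>u \<bullet> s x\<bar> * \<bar>u \<bullet> s x\<bar> ^ 3" by simp
    also have "\<dots> \<le> exp (r * norm (s x)) * (norm u * norm (s x)) ^ 3"
    proof (intro mult_mono power_mono inner_score_le)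
      show "exp \<bar>u \<bullet> s x\<bar> \<le> exp (r * norm (s x))"
        using inner_score_le[of u x] mult_right_mono[OF assms, of "norm (s x)"] by simp
    qed auto
    finally show "\<bar>exp (u \<bullet> s x) - (1 + u \<bullet> s x + (u \<bullet> s x)\<^sup>2 / 2)\<bar>
        \<le> norm u ^ 3 * (norm (s x) ^ 3 * exp (r * norm (s x)))"
      by (simp add: power_mult_distrib mult_ac)
  qed (auto simp: integrable_inner integrable_exp_inner integrable_inner_power)
  finally show ?thesis by simp
qed

section \<open>Local parameters at the scale of the inverse square root of the sample size\<close>

lemma local_parameter_bound:
  fixes h :: "nat \<Rightarrow> 'v"
  assumes "h \<longlonglongrightarrow> h0"
  obtains r where "\<And>n. norm ((1 / sqrt (real n)) *\<^sub>R h n) \<le> r"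
proof -
  from convergent_imp_Bseq[of h] assms obtain r where r: "\<And>n. norm (h n) \<le> r"
    unfolding convergent_def Bseq_def by blast
  have "norm ((1 / sqrt (real n)) *\<^sub>R h n) \<le> r" for n
  \<comment> \<open>The factor \<open>1 / sqrt (real n)\<close> is at most 1 for positive
    \<open>n\<close> and is 0 at \<open>n = 0\<close> by the convention for division by zero, so one
    bound serves every index.\<close>
  proof (cases "n = 0")
    case False
    then have "1 / sqrt (real n) * norm (h n) \<le> 1 * norm (h n)"
      by (intro mult_right_mono) auto
    with r[of n] show ?thesis by simp
  qed (use order_trans[OF norm_ge_zero r[of 0]] in simp)
  then show ?thesis by (rule that)
qed

text \<open>For positive \<open>n\<close> the expression is \<open>norm (h n) ^ k\<close> times
  \<open>n\<close> to the power \<open>1 - k / 2\<close>, a negative exponent exactly when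
  \<open>2 < k\<close>. The cubic and quartic remainders below vanish for this reason.\<close>

lemma scaled_power_tendsto_0:
  fixes h :: "nat \<Rightarrow> 'v"
  assumes "h \<longlonglongrightarrow> h0" "2 < k"
  shows "(\<lambda>n. real n * norm ((1 / sqrt (real n)) *\<^sub>R h n) ^ k) \<longlonglongrightarrow> 0"
proof -
  have "(\<lambda>n. norm (h n) ^ k * (1 / sqrt (real n)) ^ (k - 2)) \<longlonglongrightarrow> norm h0 ^ k * 0 ^ (k - 2)"
    by (intro tendsto_intros assms tendsto_divide_0[OF tendsto_const]
        filterlim_at_top_imp_at_infinity filterlim_compose[OF sqrt_at_top] filterlim_real_sequentially)
  then have "(\<lambda>n. norm (h n) ^ k * (1 / sqrt (real n)) ^ (k - 2)) \<longlonglongrightarrow> 0"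
    using assms(2) by (simp add: power_0_left)
  then show ?thesis
  proof (rule Lim_transform_eventually)
    show "\<forall>\<^sub>F n in sequentially. norm (h n) ^ k * (1 / sqrt (real n)) ^ (k - 2)
        = real n * norm ((1 / sqrt (real n)) *\<^sub>R h n) ^ k"
      using eventually_gt_at_top[of 0]
    proof eventually_elim
      case (elim n)
      have "k = k - 2 + 2" using assms(2) by simp
      then have "(1 / sqrt (real n)) ^ k = (1 / sqrt (real n)) ^ (k - 2 + 2)" by (rule arg_cong)
      also have "\<dots> = (1 / sqrt (real n)) ^ (k - 2) * (1 / sqrt (real n))\<^sup>2"
        by (rule power_add)
      also have "(1 / sqrt (real n))\<^sup>2 = 1 / real n" by (simp add: power_divide)
      finally have pk: "(1 / sqrt (real n)) ^ k = (1 / sqrt (real n)) ^ (k - 2) * (1 / real n)" .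
      have "norm ((1 / sqrt (real n)) *\<^sub>R h n) = (1 / sqrt (real n)) * norm (h n)" by simp
      then show ?case using elim by (simp only: power_mult_distrib pk) simp
    qed
  qed
qed

lemma scaled_norm_square: "0 < n \<Longrightarrow> real n * (norm ((1 / sqrt (real n)) *\<^sub>R (h::'v)))\<^sup>2 = (norm h)\<^sup>2"
  by (simp add: power_mult_distrib power_divide)

lemma mgf_scaled_tendsto:
  assumes h: "h \<longlonglongrightarrow> h0"
  shows "(\<lambda>n. real n * (mgf ((1 / sqrt (real n)) *\<^sub>R h n) - 1)) \<longlonglongrightarrow> (norm h0)\<^sup>2 / 2"
proof -
  let ?u = "\<lambda>n. (1 / sqrt (real n)) *\<^sub>R h n"
  obtain r where r: "\<And>n. norm (?u n) \<le> r" using local_parameter_bound[OF h] by blast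
  define K where "K = (\<integral>x. norm (s x) ^ 3 * exp (r * norm (s x)) \<partial>P)"
  have "(\<lambda>n. real n * (mgf (?u n) - 1) - real n * ((norm (?u n))\<^sup>2 / 2)) \<longlonglongrightarrow> 0"
  proof (rule Lim_null_comparison)
    show "\<forall>\<^sub>F n in sequentially. norm (real n * (mgf (?u n) - 1) - real n * ((norm (?u n))\<^sup>2 / 2))
        \<le> (real n * norm (?u n) ^ 3) * K"
    proof (intro always_eventually allI)
      fix n
      have "\<bar>real n * (mgf (?u n) - 1 - (norm (?u n))\<^sup>2 / 2)\<bar> \<le> real n * (norm (?u n) ^ 3 * K)"
        unfolding abs_mult K_def abs_of_nat by (intro mult_left_mono mgf_expansion r) auto
      then show "norm (real n * (mgf (?u n) - 1) - real n * ((norm (?u n))\<^sup>2 / 2)) \<le> (real n * norm (?u n) ^ 3) * K"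
        unfolding real_norm_def right_diff_distrib[symmetric] by (simp only: mult.assoc)
    qed
    show "(\<lambda>n. (real n * norm (?u n) ^ 3) * K) \<longlonglongrightarrow> 0"
      by (rule tendsto_mult_left_zero[OF scaled_power_tendsto_0[OF h]]) simp
  qed
  moreover have "(\<lambda>n. real n * ((norm (?u n))\<^sup>2 / 2)) \<longlonglongrightarrow> (norm h0)\<^sup>2 / 2"
  proof (rule Lim_transform_eventually)
    show "(\<lambda>n. (norm (h n))\<^sup>2 / 2) \<longlonglongrightarrow> (norm h0)\<^sup>2 / 2" by (intro tendsto_intros h) auto
    show "\<forall>\<^sub>F n in sequentially. (norm (h n))\<^sup>2 / 2 = real n * ((norm (?u n))\<^sup>2 / 2)"
      using eventually_gt_at_top[of 0]
    proof eventually_elim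
      case (elim n)
      then show ?case using scaled_norm_square[of n "h n"] by simp
    qed
  qed
  ultimately show ?thesis by (rule Lim_transform[rotated])
qed

text \<open>With \<open>b = mgf u - 1\<close>, the inequalities
  \<open>b / (1 + b) \<le> ln (1 + b) \<le> b\<close> sandwich the logarithm, and \<open>b\<close>
  is of order \<open>1 / n\<close>.\<close>

lemma cumulant_scaled_tendsto:
  assumes h: "h \<longlonglongrightarrow> h0"
  shows "(\<lambda>n. real n * cumulant ((1 / sqrt (real n)) *\<^sub>R h n)) \<longlonglongrightarrow> (norm h0)\<^sup>2 / 2"
proof -
  let ?u = "\<lambda>n. (1 / sqrt (real n)) *\<^sub>R h n"
  define b where "b n = mgf (?u n) - 1" for n
  have b0: "0 \<le> b n" for n using mgf_ge_1[of "?u n"] by (simp add: b_def)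
  have nb: "(\<lambda>n. real n * b n) \<longlonglongrightarrow> (norm h0)\<^sup>2 / 2"
    unfolding b_def by (rule mgf_scaled_tendsto[OF h])
  have "(\<lambda>n. real n * b n * (1 / real n)) \<longlonglongrightarrow> 0"
    using tendsto_mult[OF nb lim_1_over_n] by (simp only: mult_zero_right)
  then have bt: "b \<longlonglongrightarrow> 0"
    by (rule Lim_transform_eventually) (use eventually_gt_at_top[of 0] in eventually_elim, simp)
  have "(\<lambda>n. real n * b n / (1 + b n)) \<longlonglongrightarrow> ((norm h0)\<^sup>2 / 2) / (1 + 0)"
    by (intro tendsto_intros nb bt) auto
  then have low: "(\<lambda>n. real n * b n / (1 + b n)) \<longlonglongrightarrow> (norm h0)\<^sup>2 / 2" by simp
  have c: "cumulant (?u n) = ln (1 + b n)" for n by (simp add: cumulant_def b_def)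
  show ?thesis
  proof (rule tendsto_sandwich[OF _ _ low nb]; intro always_eventually allI)
    fix n
    show "real n * cumulant (?u n) \<le> real n * b n"
      unfolding c by (intro mult_left_mono ln_add_one_self_le_self b0) auto
    have "1 - 1 / (1 + b n) \<le> ln (1 + b n)"
      using ln_le_minus_one[of "1 / (1 + b n)"] b0[of n] by (simp add: ln_div)
    moreover have "1 - 1 / (1 + b n) = b n / (1 + b n)"
      using b0[of n] by (simp add: field_simps)
    ultimately have "b n / (1 + b n) \<le> ln (1 + b n)" by simp
    from mult_left_mono[OF this, of "real n"]
    show "real n * b n / (1 + b n) \<le> real n * cumulant (?u n)" unfolding c by simp
  qed
qed

lemma integrable_tilt_residual: "integrable P (\<lambda>x. (1 + u \<bullet> s x / 2 - exp ((u \<bullet> s x - c) / 2))\<^sup>2)"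
proof (rule Bochner_Integration.integrable_bound)
  show "integrable P (\<lambda>x. 3 * (1 + (u \<bullet> s x)\<^sup>2 / 4 + exp (u \<bullet> s x) * exp (- c)))"
    by (intro integrable_mult_right Bochner_Integration.integrable_add integrable_divide integrable_inner_power
        integrable_mult_left integrable_exp_inner) simp
  have sq3: "(\<alpha> + \<beta> - \<gamma>)\<^sup>2 \<le> 3 * (\<alpha>\<^sup>2 + \<beta>\<^sup>2 + \<gamma>\<^sup>2)" for \<alpha> \<beta> \<gamma> :: real
    using sum_squares_bound[of \<alpha> \<beta>] sum_squares_bound[of \<alpha> "- \<gamma>"] sum_squares_bound[of \<beta> "- \<gamma>"]
    by (simp add: power2_eq_square algebra_simps)
  have "(exp ((y - c) / 2))\<^sup>2 = exp y * exp (- c)" for y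
    by (simp add: exp_double[symmetric] exp_add[symmetric])
  with sq3[of 1 "u \<bullet> s x / 2" "exp ((u \<bullet> s x - c) / 2)" for x]
  have "(1 + u \<bullet> s x / 2 - exp ((u \<bullet> s x - c) / 2))\<^sup>2 \<le> 3 * (1 + (u \<bullet> s x)\<^sup>2 / 4 + exp (u \<bullet> s x) * exp (- c))" for x
    by (simp add: power_divide)
  then show "AE x in P. norm ((1 + u \<bullet> s x / 2 - exp ((u \<bullet> s x - c) / 2))\<^sup>2)
      \<le> norm (3 * (1 + (u \<bullet> s x)\<^sup>2 / 4 + exp (u \<bullet> s x) * exp (- c)))"
    by (intro AE_I2) (simp only: real_norm_def abs_power2 order_trans[OF _ abs_ge_self])
qed measurable

text \<open>The root of the tilted density and its linearisation
  \<open>1 + u \<bullet> s x / 2\<close> differ in quadratic mean by an amount of order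
  \<open>|u|^2\<close>. Differentiability in quadratic mean uses the same linearisation, so the two
  estimates can be chained.\<close>

lemma tilt_hellinger_tendsto:
  assumes h: "h \<longlonglongrightarrow> h0"
  shows "(\<lambda>n. real n * (\<integral>x. (1 + ((1 / sqrt (real n)) *\<^sub>R h n) \<bullet> s x / 2
      - exp ((((1 / sqrt (real n)) *\<^sub>R h n) \<bullet> s x - cumulant ((1 / sqrt (real n)) *\<^sub>R h n)) / 2))\<^sup>2 \<partial>P)) \<longlonglongrightarrow> 0"
proof -
  let ?u = "\<lambda>n. (1 / sqrt (real n)) *\<^sub>R h n"
  obtain r where r: "\<And>n. norm (?u n) \<le> r" using local_parameter_bound[OF h] by blast
  define K where "K = (\<integral>x. norm (s x) ^ 4 * exp (r * norm (s x)) \<partial>P)"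
  define c where "c n = cumulant (?u n)" for n
  let ?f = "\<lambda>n x. (1 + ?u n \<bullet> s x / 2 - exp ((?u n \<bullet> s x - c n) / 2))\<^sup>2"
  \<comment> \<open>Two sources of error: the quadratic Taylor remainder of
    \<open>exp (y / 2)\<close>, and the normalisation \<open>c n\<close>, which is of order
    \<open>1 / n\<close>. Squared and integrated, both are of order
    \<open>1 / n\<^sup>2\<close>.\<close>
  have pw: "?f n x \<le> 2 * (norm (?u n) ^ 4 * (norm (s x) ^ 4 * exp (r * norm (s x))))
      + 2 * ((c n)\<^sup>2 * exp (?u n \<bullet> s x))" for n x
  proof -
    define y where "y = ?u n \<bullet> s x"
    have y: "\<bar>y\<bar> \<le> norm (?u n) * norm (s x)" unfolding y_def by (rule inner_score_le)
    also have "\<dots> \<le> r * norm (s x)" using r[of n] by (rule mult_right_mono) simp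
    finally have yr: "\<bar>y\<bar> \<le> r * norm (s x)" .
    have "\<bar>1 + y / 2 - exp (y / 2)\<bar> \<le> exp (\<bar>y\<bar> / 2) * (\<bar>y\<bar> / 2)\<^sup>2"
      using Taylor_exp_field[of "y / 2" 1] by (simp add: numeral_eq_Suc abs_minus_commute)
    also have "\<dots> \<le> exp (\<bar>y\<bar> / 2) * \<bar>y\<bar>\<^sup>2"
      by (intro mult_left_mono power_mono) auto
    finally have "(1 + y / 2 - exp (y / 2))\<^sup>2 \<le> (exp (\<bar>y\<bar> / 2) * \<bar>y\<bar>\<^sup>2)\<^sup>2"
      by (intro power2_le_iff_abs_le[THEN iffD2]) auto
    also have "\<dots> = exp \<bar>y\<bar> * \<bar>y\<bar> ^ 4"
      by (simp add: power_mult_distrib exp_double[symmetric])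
    also have "\<dots> \<le> exp (r * norm (s x)) * (norm (?u n) * norm (s x)) ^ 4"
      using y yr by (intro mult_mono power_mono) auto
    finally have 1: "(1 + y / 2 - exp (y / 2))\<^sup>2 \<le> norm (?u n) ^ 4 * (norm (s x) ^ 4 * exp (r * norm (s x)))"
      by (simp only: power_mult_distrib mult_ac)
    have c0: "0 \<le> c n" unfolding c_def by (rule cumulant_nonneg)
    have "exp ((y - c n) / 2) = exp (y / 2) * exp (- c n / 2)"
      by (simp add: exp_add[symmetric] diff_divide_distrib)
    then have eq: "exp (y / 2) - exp ((y - c n) / 2) = exp (y / 2) * (1 - exp (- c n / 2))"
      by (simp add: algebra_simps)
    have "1 - exp (- c n / 2) \<le> c n" using exp_ge_add_one_self[of "- c n / 2"] c0 by linarith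
    moreover have "0 \<le> 1 - exp (- c n / 2)" using c0 by simp
    ultimately have "(1 - exp (- c n / 2))\<^sup>2 \<le> (c n)\<^sup>2" by (rule power_mono)
    then have "exp y * (1 - exp (- c n / 2))\<^sup>2 \<le> exp y * (c n)\<^sup>2" by (rule mult_left_mono) simp
    then have 2: "(exp (y / 2) - exp ((y - c n) / 2))\<^sup>2 \<le> (c n)\<^sup>2 * exp y"
      unfolding eq by (simp add: power_mult_distrib exp_double[symmetric] mult.commute)
    have "(1 + y / 2 - exp ((y - c n) / 2))\<^sup>2
        \<le> 2 * (1 + y / 2 - exp (y / 2))\<^sup>2 + 2 * (exp (y / 2) - exp ((y - c n) / 2))\<^sup>2"
      using sum_squares_bound[of "1 + y / 2 - exp (y / 2)" "exp (y / 2) - exp ((y - c n) / 2)"]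
      by (simp add: power2_eq_square algebra_simps)
    with 1 2 show ?thesis unfolding y_def by linarith
  qed
  have bd: "(\<integral>x. ?f n x \<partial>P) \<le> 2 * (norm (?u n) ^ 4 * K) + 2 * ((c n)\<^sup>2 * exp (c n))" for n
  proof -
    let ?g = "\<lambda>x. 2 * (norm (?u n) ^ 4 * (norm (s x) ^ 4 * exp (r * norm (s x)))) + 2 * ((c n)\<^sup>2 * exp (?u n \<bullet> s x))"
    have gi: "integrable P ?g"
      by (intro Bochner_Integration.integrable_add integrable_mult_right integrable_power_exp integrable_exp_inner)
    have "(\<integral>x. ?f n x \<partial>P) \<le> (\<integral>x. ?g x \<partial>P)"
      using gi pw by (intro integral_mono integrable_tilt_residual) auto
    also have "\<dots> = 2 * (norm (?u n) ^ 4 * K) + 2 * ((c n)\<^sup>2 * exp (c n))"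
      unfolding c_def exp_cumulant unfolding K_def mgf_def
      by (simp add: integrable_power_exp integrable_exp_inner del: inner_scaleR_left norm_scaleR)
    finally show ?thesis .
  qed
  have nc: "(\<lambda>n. real n * c n) \<longlonglongrightarrow> (norm h0)\<^sup>2 / 2"
    unfolding c_def by (rule cumulant_scaled_tendsto[OF h])
  have "(\<lambda>n. real n * c n * (1 / real n)) \<longlonglongrightarrow> 0"
    using tendsto_mult[OF nc lim_1_over_n] by (simp only: mult_zero_right)
  then have ct: "c \<longlonglongrightarrow> 0"
    by (rule Lim_transform_eventually) (use eventually_gt_at_top[of 0] in eventually_elim, simp)
  show ?thesis
    unfolding c_def[symmetric]
  proof (rule tendsto_sandwich[OF _ _ tendsto_const]; (intro always_eventually allI)?)
    fix n
    show "0 \<le> real n * (\<integral>x. ?f n x \<partial>P)" by simp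
    show "real n * (\<integral>x. ?f n x \<partial>P)
      \<le> 2 * (real n * norm (?u n) ^ 4) * K + 2 * (real n * c n) * c n * exp (c n)"
      using mult_left_mono[OF bd[of n], of "real n"] by (simp add: algebra_simps power2_eq_square)
  next
    have "(\<lambda>n. 2 * (real n * norm (?u n) ^ 4) * K + 2 * (real n * c n) * c n * exp (c n))
      \<longlonglongrightarrow> 2 * 0 * K + 2 * ((norm h0)\<^sup>2 / 2) * 0 * exp 0"
      by (intro tendsto_intros nc ct scaled_power_tendsto_0[OF h]) simp
    then show "(\<lambda>n. 2 * (real n * norm (?u n) ^ 4) * K + 2 * (real n * c n) * c n * exp (c n)) \<longlonglongrightarrow> 0"
      by simp
  qed
qed

text \<open>Numbers in the closed unit disc satisfy \<open>|z^n - w^n| \<le> n |z - w|\<close>. This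
  reduces the central limit theorem to an expansion of a single factor up to a cubic remainder and
  to the limit of \<open>(1 + x / n)^n\<close>.\<close>

lemma char_score_sum_tendsto:
  "(\<lambda>n. \<integral>X. iexp (t \<bullet> score_sum n X) \<partial>PiM {..<n} (\<lambda>_. P)) \<longlonglongrightarrow> complex_of_real (exp (- (norm t)\<^sup>2 / 2))"
proof -
  interpret PP: product_sigma_finite "\<lambda>_::nat. P"
    by (simp add: product_sigma_finite_def sigma_finite_measure_axioms)
  let ?u = "\<lambda>n. (1 / sqrt (real n)) *\<^sub>R t"
  define \<phi> where "\<phi> n = (\<integral>x. iexp (?u n \<bullet> s x) \<partial>P)" for n
  define K where "K = (\<integral>x. norm (s x) ^ 3 * exp (0 * norm (s x)) \<partial>P)"
  have prod: "(\<integral>X. iexp (t \<bullet> score_sum n X) \<partial>PiM {..<n} (\<lambda>_. P)) = \<phi> n ^ n" for n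
  proof -
    have "iexp (t \<bullet> score_sum n X) = (\<Prod>i<n. iexp (?u n \<bullet> s (X i)))" for X
      by (simp add: score_sum_def inner_sum_right exp_sum[symmetric] sum_distrib_left)
    then have "(\<integral>X. iexp (t \<bullet> score_sum n X) \<partial>PiM {..<n} (\<lambda>_. P))
        = (\<integral>X. (\<Prod>i<n. iexp (?u n \<bullet> s (X i))) \<partial>PiM {..<n} (\<lambda>_. P))" by simp
    also have "\<dots> = (\<Prod>i<n. \<phi> n)"
      unfolding \<phi>_def by (rule PP.product_integral_prod) (simp, rule integrable_iexp, auto)
    finally show ?thesis by simp
  qed
  have \<phi>1: "norm (\<phi> n) \<le> 1" for n
    using integral_norm_bound[of P "\<lambda>x. iexp (?u n \<bullet> s x)"] by (simp add: \<phi>_def prob_space)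
  have \<phi>2: "norm (\<phi> n - of_real (1 - (norm (?u n))\<^sup>2 / 2)) \<le> norm (?u n) ^ 3 * K" for n
  proof -
    have i2: "integrable P (\<lambda>x. complex_of_real (?u n \<bullet> s x))"
      "integrable P (\<lambda>x. complex_of_real ((?u n \<bullet> s x)\<^sup>2))"
      using integrable_inner[of "?u n"] integrable_inner_power[of "?u n" 2] by (simp_all del: inner_scaleR_left of_real_power)
    have i1: "integrable P (\<lambda>x. iexp (?u n \<bullet> s x))" by (rule integrable_iexp) auto
    have "(\<integral>x. iexp (?u n \<bullet> s x) - (1 + \<i> * complex_of_real (?u n \<bullet> s x) - complex_of_real ((?u n \<bullet> s x)\<^sup>2) / 2) \<partial>P)
       = \<phi> n - (1 + \<i> * complex_of_real (\<integral>x. ?u n \<bullet> s x \<partial>P) - complex_of_real (\<integral>x. (?u n \<bullet> s x)\<^sup>2 \<partial>P) / 2)"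
      using i1 i2 unfolding \<phi>_def by (simp del: inner_scaleR_left of_real_power add: prob_space)
    also have "\<dots> = \<phi> n - of_real (1 - (norm (?u n))\<^sup>2 / 2)"
      unfolding mean_score variance_score by simp
    finally have "norm (\<phi> n - of_real (1 - (norm (?u n))\<^sup>2 / 2)) =
      norm (\<integral>x. iexp (?u n \<bullet> s x) - (1 + \<i> * complex_of_real (?u n \<bullet> s x) - complex_of_real ((?u n \<bullet> s x)\<^sup>2) / 2) \<partial>P)"
      by simp
    also have "\<dots> \<le> (\<integral>x. norm (iexp (?u n \<bullet> s x) - (1 + \<i> * complex_of_real (?u n \<bullet> s x) - complex_of_real ((?u n \<bullet> s x)\<^sup>2) / 2)) \<partial>P)"
      by (rule integral_norm_bound)
    also have "\<dots> \<le> (\<integral>x. norm (?u n) ^ 3 * (norm (s x) ^ 3 * exp (0 * norm (s x))) \<partial>P)"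
    proof (intro integral_mono integrable_mult_right integrable_power_exp integrable_norm)
      fix x
      define y where "y = ?u n \<bullet> s x"
      have "norm (iexp y - (1 + \<i> * complex_of_real y - complex_of_real (y\<^sup>2) / 2)) \<le> \<bar>y\<bar> ^ 3 / 6"
        using iexp_approx1[of y 2] by (simp add: numeral_eq_Suc power_mult_distrib)
      also have "\<dots> \<le> \<bar>y\<bar> ^ 3" by simp
      also have "\<dots> \<le> (norm (?u n) * norm (s x)) ^ 3" unfolding y_def by (intro power_mono inner_score_le) auto
      finally show "norm (iexp (?u n \<bullet> s x) - (1 + \<i> * complex_of_real (?u n \<bullet> s x) - complex_of_real ((?u n \<bullet> s x)\<^sup>2) / 2))
        \<le> norm (?u n) ^ 3 * (norm (s x) ^ 3 * exp (0 * norm (s x)))"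
        unfolding y_def by (simp only: power_mult_distrib mult_zero_left exp_zero mult_1_right)
    qed (use i1 i2 in \<open>simp del: inner_scaleR_left of_real_power\<close>)
    also have "\<dots> = norm (?u n) ^ 3 * K" unfolding K_def by (rule integral_mult_right_zero)
    finally show ?thesis .
  qed
  have "(\<lambda>n. \<phi> n ^ n - complex_of_real (1 + (- (norm t)\<^sup>2 / 2) / real n) ^ n) \<longlonglongrightarrow> 0"
  proof (rule Lim_null_comparison)
    \<comment> \<open>From \<open>N\<close> on, \<open>1 - |t|^2 / (2 n)\<close> lies in the unit
      interval, as the comparison of powers requires.\<close>
    obtain N :: nat where N: "(norm t)\<^sup>2 \<le> real N" using real_arch_simple by blast
    show "\<forall>\<^sub>F n in sequentially. norm (\<phi> n ^ n - complex_of_real (1 + (- (norm t)\<^sup>2 / 2) / real n) ^ n)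
        \<le> (real n * norm (?u n) ^ 3) * K"
      using eventually_gt_at_top[of 0] eventually_ge_at_top[of N]
    proof eventually_elim
      case (elim n)
      have u2: "1 + (- (norm t)\<^sup>2 / 2) / real n = 1 - (norm (?u n))\<^sup>2 / 2"
        using elim by (simp add: power_mult_distrib power_divide)
      have tn: "(norm t)\<^sup>2 / real n \<le> 1" using N elim by (simp add: divide_le_eq)
      have "norm (complex_of_real (1 + (- (norm t)\<^sup>2 / 2) / real n)) \<le> 1"
      proof -
        have "1 + (- (norm t)\<^sup>2 / 2) / real n = 1 - ((norm t)\<^sup>2 / real n) / 2" by simp
        moreover have "0 \<le> (norm t)\<^sup>2 / real n" by simp
        ultimately show ?thesis unfolding norm_of_real using tn by linarith
      qed
      then have "norm (\<phi> n ^ n - complex_of_real (1 + (- (norm t)\<^sup>2 / 2) / real n) ^ n)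
        \<le> real n * norm (\<phi> n - complex_of_real (1 + (- (norm t)\<^sup>2 / 2) / real n))"
        by (intro norm_power_diff \<phi>1)
      also have "\<dots> \<le> real n * (norm (?u n) ^ 3 * K)"
        unfolding u2 by (intro mult_left_mono \<phi>2) auto
      finally show ?case by (simp only: mult.assoc)
    qed
    show "(\<lambda>n. (real n * norm (?u n) ^ 3) * K) \<longlonglongrightarrow> 0"
      by (rule tendsto_mult_left_zero[OF scaled_power_tendsto_0[OF tendsto_const]]) simp
  qed
  moreover have "(\<lambda>n. complex_of_real (1 + (- (norm t)\<^sup>2 / 2) / real n) ^ n) \<longlonglongrightarrow> complex_of_real (exp (- (norm t)\<^sup>2 / 2))"
    unfolding of_real_power[symmetric] by (intro tendsto_of_real tendsto_exp_limit_sequentially)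
  ultimately show ?thesis
    unfolding prod by (rule Lim_transform[rotated])
qed

end

subsection \<open>The lifting kernel\<close>

lemma gauss_shift: "gauss (x - b *\<^sub>R h) = gauss x * exp (b * (h \<bullet> x) - b\<^sup>2 * (norm h)\<^sup>2 / 2)"
proof -
  have "gauss x * exp (b * (h \<bullet> x)) = exp (b\<^sup>2 * (norm h)\<^sup>2 / 2) * gauss (x - b *\<^sub>R h)"
    using gauss_exp_inner[of x "b *\<^sub>R h"] by (simp add: power_mult_distrib)
  then show ?thesis unfolding exp_diff by (simp add: nonzero_eq_divide_eq mult.commute)
qed

text \<open>Completing the square in \<open>w\<close>: the factor
  \<open>exp (h \<bullet> w / 2)\<close> moves the centre of the smoothing kernel and otherwise
  leaves a term in \<open>x\<close> alone. An integral over the sample thereby becomes the smoothed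
  density at a shifted point.\<close>

lemma gauss_scaled_tilt:
  fixes x w h :: "'v::euclidean_space"
  assumes "0 < e" "0 < a"
  shows "gauss_scaled e (x - a *\<^sub>R w) * exp (h \<bullet> w / 2)
    = exp (h \<bullet> x / (2 * a) + e\<^sup>2 * (norm h)\<^sup>2 / (8 * a\<^sup>2)) * gauss_scaled e (x + (e\<^sup>2 / (2 * a)) *\<^sub>R h - a *\<^sub>R w)"
proof -
  define y where "y = x - a *\<^sub>R w"
  have 1: "(x + (e\<^sup>2 / (2 * a)) *\<^sub>R h - a *\<^sub>R w) /\<^sub>R e = y /\<^sub>R e - (- e / (2 * a)) *\<^sub>R h"
    using assms by (simp add: y_def algebra_simps power2_eq_square)
  have 2: "h \<bullet> w / 2 = h \<bullet> x / (2 * a) - h \<bullet> y / (2 * a)"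
    using assms by (simp add: y_def inner_diff_right field_simps)
  show ?thesis
    unfolding gauss_scaled_def 1 gauss_shift y_def[symmetric] 2
    using assms by (simp add: exp_add[symmetric] exp_diff power2_eq_square field_simps)
qed

section \<open>The kernel and its affinity with the tilted products\<close>

context std_score
begin

abbreviation "sample n \<equiv> PiM {..<n} (\<lambda>_. P)"

definition tilt :: "'v \<Rightarrow> 'a measure" where
  "tilt u = density P (\<lambda>x. ennreal (exp (u \<bullet> s x - cumulant u)))"

definition smooth_density :: "real \<Rightarrow> real \<Rightarrow> nat \<Rightarrow> 'v \<Rightarrow> real" where
  "smooth_density a e n x = (\<integral>X. gauss_scaled e (x - a *\<^sub>R score_sum n X) \<partial>sample n)"

text \<open>The conditional law of the sample, given that the randomised statistic
  \<open>a *\<^sub>R score_sum n X + e *\<^sub>R Z\<close> with standard Gaussian \<open>Z\<close> takes the value \<open>x\<close>.\<close>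
definition lift_kernel :: "real \<Rightarrow> real \<Rightarrow> nat \<Rightarrow> 'v \<Rightarrow> (nat \<Rightarrow> 'a) measure" where
  "lift_kernel a e n x = density (sample n)
    (\<lambda>X. ennreal (gauss_scaled e (x - a *\<^sub>R score_sum n X) / smooth_density a e n x))"

lemma prob_space_sample: "prob_space (sample n)"
  by (rule prob_space_PiM) (rule prob_space_axioms)

lemma score_sum_measurable [measurable]: "score_sum n \<in> borel_measurable (sample n)"
  unfolding score_sum_def by measurable

lemma prob_space_tilt: "prob_space (tilt u)"
proof (rule prob_spaceI)
  have "(\<integral>x. exp (u \<bullet> s x - cumulant u) \<partial>P) = 1"
    using mgf_ge_1[of u] by (simp add: exp_diff exp_cumulant mgf_def[symmetric])
  moreover have "integrable P (\<lambda>x. exp (u \<bullet> s x - cumulant u))"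
    by (simp add: exp_diff integrable_exp_inner)
  ultimately have "(\<integral>\<^sup>+x. ennreal (exp (u \<bullet> s x - cumulant u)) \<partial>P) = 1"
    by (subst nn_integral_eq_integral) auto
  then show "emeasure (tilt u) (space (tilt u)) = 1"
    by (simp add: tilt_def emeasure_density cong: nn_integral_cong)
qed

lemma sets_tilt [simp]: "sets (tilt u) = sets P"
  by (simp add: tilt_def)

text \<open>The scaling of the parameter matches that inside \<open>score_sum\<close>, so the
  density depends on the sample only through \<open>score_sum n X\<close>. This sufficiency is what
  allows a kernel free of \<open>h\<close>.\<close>

lemma PiM_tilt:
  "PiM {..<n} (\<lambda>_. tilt ((1 / sqrt (real n)) *\<^sub>R h)) = density (sample n)
    (\<lambda>X. ennreal (exp (h \<bullet> score_sum n X - real n * cumulant ((1 / sqrt (real n)) *\<^sub>R h))))"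
proof -
  let ?u = "(1 / sqrt (real n)) *\<^sub>R h"
  have "PiM {..<n} (\<lambda>_. tilt ?u) = density (sample n) (\<lambda>X. \<Prod>i<n. ennreal (exp (?u \<bullet> s (X i) - cumulant ?u)))"
    unfolding tilt_def
    by (rule PiM_density[OF sigma_finite_measure_axioms
          prob_space_imp_sigma_finite[OF prob_space_tilt[of ?u, unfolded tilt_def]]]) auto
  moreover have "(\<Prod>i<n. ennreal (exp (?u \<bullet> s (X i) - cumulant ?u)))
      = ennreal (exp (h \<bullet> score_sum n X - real n * cumulant ?u))" for X
    by (simp add: prod_ennreal exp_sum[symmetric] sum_subtractf score_sum_def inner_sum_right sum_divide_distrib)
  ultimately show ?thesis by simp
qed

context
  fixes a e :: real
  assumes a_pos: "0 < a" and e_pos: "0 < e" and ae: "a\<^sup>2 + e\<^sup>2 = 1"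
begin

lemma gauss_scaled_bounds: "0 \<le> gauss_scaled e x" "gauss_scaled e (x::'v) \<le> gauss_scaled e (0::'v)"
  using gauss_scaled_pos[OF e_pos, of x] e_pos
  by (auto simp: gauss_scaled_def gauss_def intro!: divide_right_mono)

lemma integrable_gauss_scaled: "integrable (sample n) (\<lambda>X. gauss_scaled e (x - a *\<^sub>R score_sum n X))"
proof -
  interpret S: prob_space "sample n" by (rule prob_space_sample)
  show ?thesis
    by (rule S.integrable_const_bound[where B="gauss_scaled e (0::'v)"]) (auto simp: gauss_scaled_bounds)
qed

text \<open>The Gaussian kernel is positive everywhere, so the normalisation in
  \<open>lift_kernel\<close> never divides by zero and no exceptional set of \<open>x\<close>
  arises.\<close>

lemma smooth_density_pos: "0 < smooth_density a e n x"
proof -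
  interpret S: prob_space "sample n" by (rule prob_space_sample)
  have "0 \<le> smooth_density a e n x"
    unfolding smooth_density_def by (intro integral_nonneg_AE) (simp add: gauss_scaled_bounds)
  moreover have "smooth_density a e n x \<noteq> 0"
  proof
    assume "smooth_density a e n x = 0"
    then have "AE X in sample n. gauss_scaled e (x - a *\<^sub>R score_sum n X) = 0"
      unfolding smooth_density_def
      by (subst (asm) integral_nonneg_eq_0_iff_AE[OF integrable_gauss_scaled]) (auto simp: gauss_scaled_bounds)
    then have "AE X in sample n. False"
      by eventually_elim (use gauss_scaled_pos[OF e_pos] in \<open>metis less_irrefl\<close>)
    then show False by (simp add: S.AE_False)
  qed
  ultimately show ?thesis by simp
qed

lemma nn_integral_smooth_density:
  "(\<integral>\<^sup>+X. ennreal (gauss_scaled e (x - a *\<^sub>R score_sum n X)) \<partial>sample n) = ennreal (smooth_density a e n x)"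
  unfolding smooth_density_def
  by (rule nn_integral_eq_integral[OF integrable_gauss_scaled]) (simp add: gauss_scaled_bounds)

lemma smooth_density_measurable [measurable]: "smooth_density a e n \<in> borel_measurable borel"
proof -
  interpret S: prob_space "sample n" by (rule prob_space_sample)
  show ?thesis unfolding smooth_density_def by measurable
qed

lemma smooth_density_tendsto: "x \<longlonglongrightarrow> x0 \<Longrightarrow> (\<lambda>n. smooth_density a e n (x n)) \<longlonglongrightarrow> gauss x0"
  unfolding smooth_density_def
  by (rule smoothed_density_tendsto[OF prob_space_sample score_sum_measurable char_score_sum_tendsto ae e_pos])

lemma sets_lift_kernel: "sets (lift_kernel a e n x) = sets (sample n)"
  by (simp add: lift_kernel_def)

lemma emeasure_lift_kernel:
  assumes [measurable]: "A \<in> sets (sample n)"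
  shows "emeasure (lift_kernel a e n x) A
    = (\<integral>\<^sup>+X. ennreal (gauss_scaled e (x - a *\<^sub>R score_sum n X) / smooth_density a e n x) * indicator A X \<partial>sample n)"
  unfolding lift_kernel_def by (subst emeasure_density) auto

lemma prob_space_lift_kernel: "prob_space (lift_kernel a e n x)"
proof (rule prob_spaceI)
  have "emeasure (lift_kernel a e n x) (space (sample n))
      = (\<integral>\<^sup>+X. ennreal (gauss_scaled e (x - a *\<^sub>R score_sum n X)) / ennreal (smooth_density a e n x) \<partial>sample n)"
    by (subst emeasure_lift_kernel)
       (auto intro!: nn_integral_cong simp: divide_ennreal gauss_scaled_bounds smooth_density_pos)
  also have "\<dots> = 1"
    using smooth_density_pos[of n x] by (simp add: nn_integral_divide nn_integral_smooth_density ennreal_divide_self)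
  finally show "emeasure (lift_kernel a e n x) (space (lift_kernel a e n x)) = 1"
    by (simp add: lift_kernel_def)
qed

lemma lift_kernel_measurable: "lift_kernel a e n \<in> borel \<rightarrow>\<^sub>M prob_algebra (sample n)"
proof (rule measurable_prob_algebraI[OF prob_space_lift_kernel measurable_subprob_algebra])
  interpret S: prob_space "sample n" by (rule prob_space_sample)
  fix A assume [measurable]: "A \<in> sets (sample n)"
  show "(\<lambda>x. emeasure (lift_kernel a e n x) A) \<in> borel_measurable borel"
    by (subst emeasure_lift_kernel) measurable
qed (simp_all add: prob_space_imp_subprob_space prob_space_lift_kernel sets_lift_kernel)

text \<open>Both measures are marginals of joint laws of sample and smoothed statistic, and passing
  to marginals does not increase the distance. The joint densities share the smoothing kernel as a
  factor, so their geometric mean is that kernel times a tilt, and the sample can be integrated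
  out.\<close>

lemma lift_kernel_affinity:
  fixes h :: 'v and n :: nat
  defines "\<kappa> \<equiv> real n * cumulant ((1 / sqrt (real n)) *\<^sub>R h)"
  assumes aff: "ennreal (1 - \<delta>\<^sup>2 / 8) \<le> (\<integral>\<^sup>+x. ennreal (sqrt (gauss (x - h) / smooth_density a e n x) * exp (- \<kappa> / 2)
      * exp (h \<bullet> x / (2 * a) + e\<^sup>2 * (norm h)\<^sup>2 / (8 * a\<^sup>2)) * smooth_density a e n (x + (e\<^sup>2 / (2 * a)) *\<^sub>R h)) \<partial>lborel)"
    and \<delta>: "0 < \<delta>" and A: "A \<in> sets (sample n)"
  shows "\<bar>measure (PiM {..<n} (\<lambda>_. tilt ((1 / sqrt (real n)) *\<^sub>R h))) A
    - measure (gauss_law h \<bind> lift_kernel a e n) A\<bar> \<le> \<delta>"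
proof -
  interpret S: prob_space "sample n" by (rule prob_space_sample)
  interpret pair_sigma_finite "sample n" lborel ..
  let ?J = "sample n \<Otimes>\<^sub>M lborel"
  let ?\<psi> = "\<lambda>X x. gauss_scaled e (x - a *\<^sub>R score_sum n X)"
  let ?g = "smooth_density a e n"
  \<comment> \<open>\<open>f1\<close> describes a sample from the tilted product to which noise is
    added; \<open>f2\<close> describes a point from \<open>gauss_law h\<close> followed by a sample
    from the kernel. Sets of the form \<open>A \<times> UNIV\<close> forget the statistic.\<close>
  define f1 where "f1 = (\<lambda>(X, x). ?\<psi> X x * exp (h \<bullet> score_sum n X - \<kappa>))"
  define f2 where "f2 = (\<lambda>(X, x). ?\<psi> X x * (gauss (x - h) / ?g x))"
  have [measurable]: "f1 \<in> borel_measurable ?J" "f2 \<in> borel_measurable ?J"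
    unfolding f1_def f2_def by measurable
  have nn: "0 \<le> f1 z" "0 \<le> f2 z" for z
    unfolding f1_def f2_def
    by (auto simp: split_beta gauss_scaled_bounds less_imp_le[OF smooth_density_pos] intro!: mult_nonneg_nonneg divide_nonneg_nonneg)
  have m1: "emeasure (density ?J (\<lambda>z. ennreal (f1 z))) (B \<times> UNIV)
      = emeasure (PiM {..<n} (\<lambda>_. tilt ((1 / sqrt (real n)) *\<^sub>R h))) B" if [measurable]: "B \<in> sets (sample n)" for B
  proof -
    have "emeasure (density ?J (\<lambda>z. ennreal (f1 z))) (B \<times> UNIV)
      = (\<integral>\<^sup>+z. ennreal (f1 z) * indicator (B \<times> UNIV) z \<partial>?J)"
      by (subst emeasure_density) auto
    also have "\<dots> = (\<integral>\<^sup>+X. \<integral>\<^sup>+x. ennreal (f1 (X, x)) * indicator (B \<times> UNIV) (X, x) \<partial>lborel \<partial>sample n)"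
      by (rule lborel.nn_integral_fst[symmetric]) measurable
    also have "\<dots> = (\<integral>\<^sup>+X. ennreal (exp (h \<bullet> score_sum n X - \<kappa>)) * indicator B X \<partial>sample n)"
    proof (rule nn_integral_cong)
      fix X
      have "(\<integral>\<^sup>+x. ennreal (f1 (X, x)) * indicator (B \<times> UNIV) (X, x) \<partial>lborel)
        = (\<integral>\<^sup>+x. ennreal (?\<psi> X x) * (ennreal (exp (h \<bullet> score_sum n X - \<kappa>)) * indicator B X) \<partial>lborel)"
        by (intro nn_integral_cong) (auto simp: f1_def indicator_def ennreal_mult gauss_scaled_bounds)
      also have "\<dots> = ennreal (exp (h \<bullet> score_sum n X - \<kappa>)) * indicator B X"
        by (subst nn_integral_multc) (auto simp: nn_integral_gauss_scaled[OF e_pos])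
      finally show "(\<integral>\<^sup>+x. ennreal (f1 (X, x)) * indicator (B \<times> UNIV) (X, x) \<partial>lborel)
        = ennreal (exp (h \<bullet> score_sum n X - \<kappa>)) * indicator B X" .
    qed
    also have "\<dots> = emeasure (PiM {..<n} (\<lambda>_. tilt ((1 / sqrt (real n)) *\<^sub>R h))) B"
      unfolding PiM_tilt \<kappa>_def by (subst emeasure_density) auto
    finally show ?thesis .
  qed
  have kernel[measurable]: "lift_kernel a e n \<in> gauss_law h \<rightarrow>\<^sub>M subprob_algebra (sample n)"
    using measurable_prob_algebraD[OF lift_kernel_measurable] by simp
  have m2: "emeasure (density ?J (\<lambda>z. ennreal (f2 z))) (B \<times> UNIV)
      = emeasure (gauss_law h \<bind> lift_kernel a e n) B" if [measurable]: "B \<in> sets (sample n)" for B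
  proof -
    have "emeasure (density ?J (\<lambda>z. ennreal (f2 z))) (B \<times> UNIV)
      = (\<integral>\<^sup>+z. ennreal (f2 z) * indicator (B \<times> UNIV) z \<partial>?J)"
      by (subst emeasure_density) auto
    also have "\<dots> = (\<integral>\<^sup>+x. \<integral>\<^sup>+X. ennreal (f2 (X, x)) * indicator (B \<times> UNIV) (X, x) \<partial>sample n \<partial>lborel)"
      by (rule nn_integral_snd[symmetric]) measurable
    also have "\<dots> = (\<integral>\<^sup>+x. ennreal (gauss (x - h)) * emeasure (lift_kernel a e n x) B \<partial>lborel)"
      by (intro nn_integral_cong, subst emeasure_lift_kernel, simp, subst nn_integral_cmult[symmetric])
         (auto intro!: nn_integral_cong simp: f2_def indicator_def ennreal_mult[symmetric]
           gauss_scaled_bounds less_imp_le[OF smooth_density_pos] mult.commute)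
    also have "\<dots> = (\<integral>\<^sup>+x. emeasure (lift_kernel a e n x) B \<partial>gauss_law h)"
    proof -
      have [measurable]: "(\<lambda>x. emeasure (lift_kernel a e n x) B) \<in> borel_measurable borel"
        using measurable_compose[OF measurable_prob_algebraD[OF lift_kernel_measurable]
            measurable_emeasure_subprob_algebra[OF that]] .
      show ?thesis unfolding gauss_law_def by (subst nn_integral_density) auto
    qed
    also have "\<dots> = emeasure (gauss_law h \<bind> lift_kernel a e n) B"
      by (rule emeasure_bind[symmetric, OF _ kernel]) auto
    finally show ?thesis .
  qed
  have spJ: "space ?J = space (sample n) \<times> UNIV" by (simp add: space_pair_measure)
  have total: "(\<integral>\<^sup>+z. ennreal (f z) \<partial>?J) = emeasure (density ?J (\<lambda>z. ennreal (f z))) (space ?J)"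
    if "f \<in> borel_measurable ?J" for f :: "(nat \<Rightarrow> 'a) \<times> 'v \<Rightarrow> real"
    using that by (subst emeasure_density[OF _ sets.top]) (auto intro!: nn_integral_cong)
  have i1: "(\<integral>\<^sup>+z. ennreal (f1 z) \<partial>?J) = 1"
  proof -
    interpret T: prob_space "PiM {..<n} (\<lambda>_. tilt ((1 / sqrt (real n)) *\<^sub>R h))"
      by (rule prob_space_PiM) (rule prob_space_tilt)
    have "space (sample n) = space (PiM {..<n} (\<lambda>_. tilt ((1 / sqrt (real n)) *\<^sub>R h)))"
      by (intro sets_eq_imp_space_eq sets_PiM_cong) auto
    then have "emeasure (density ?J (\<lambda>z. ennreal (f1 z))) (space ?J) = 1"
      unfolding spJ m1[OF sets.top] by (simp add: T.emeasure_space_1)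
    then show ?thesis by (subst total) simp_all
  qed
  have bsets: "sets (gauss_law h \<bind> lift_kernel a e n) = sets (sample n)"
    using sets_bind[of "gauss_law h" "lift_kernel a e n" "sample n"] by (simp add: lift_kernel_def)
  have i2: "(\<integral>\<^sup>+z. ennreal (f2 z) \<partial>?J) = 1"
  proof -
    interpret T: prob_space "gauss_law h \<bind> lift_kernel a e n"
      by (rule prob_space.prob_space_bind[OF prob_space_gauss_law _ kernel]) (simp add: prob_space_lift_kernel)
    have "emeasure (density ?J (\<lambda>z. ennreal (f2 z))) (space ?J) = 1"
      unfolding spJ using T.emeasure_space_1 sets_eq_imp_space_eq[OF bsets] by (subst m2) simp_all
    then show ?thesis by (subst total) simp_all
  qed
  have "(\<integral>\<^sup>+z. ennreal (sqrt (f1 z * f2 z)) \<partial>?J) = (\<integral>\<^sup>+x. \<integral>\<^sup>+X. ennreal (sqrt (f1 (X, x) * f2 (X, x))) \<partial>sample n \<partial>lborel)"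
    by (rule nn_integral_snd[symmetric]) measurable
  also have "\<dots> = (\<integral>\<^sup>+x. ennreal (sqrt (gauss (x - h) / ?g x) * exp (- \<kappa> / 2)
      * exp (h \<bullet> x / (2 * a) + e\<^sup>2 * (norm h)\<^sup>2 / (8 * a\<^sup>2)) * ?g (x + (e\<^sup>2 / (2 * a)) *\<^sub>R h)) \<partial>lborel)"
  proof (rule nn_integral_cong)
    fix x
    define C where "C = sqrt (gauss (x - h) / ?g x) * exp (- \<kappa> / 2)
      * exp (h \<bullet> x / (2 * a) + e\<^sup>2 * (norm h)\<^sup>2 / (8 * a\<^sup>2))"
    have C: "0 \<le> C" by (simp add: C_def less_imp_le[OF smooth_density_pos])
    \<comment> \<open>Each density contributes the root of its kernel factor, so the kernel appears
      to the first power, while the likelihood ratio is halved in the exponent;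
      \<open>gauss_scaled_tilt\<close> treats exactly this product.\<close>
    have "sqrt (f1 (X, x) * f2 (X, x)) = C * gauss_scaled e (x + (e\<^sup>2 / (2 * a)) *\<^sub>R h - a *\<^sub>R score_sum n X)" for X
    proof -
      have "f1 (X, x) * f2 (X, x) = (?\<psi> X x)\<^sup>2 * (exp ((h \<bullet> score_sum n X - \<kappa>) / 2))\<^sup>2 * (gauss (x - h) / ?g x)"
        by (simp add: f1_def f2_def power2_eq_square exp_add[symmetric])
      then have "sqrt (f1 (X, x) * f2 (X, x)) = ?\<psi> X x * exp ((h \<bullet> score_sum n X - \<kappa>) / 2) * sqrt (gauss (x - h) / ?g x)"
        by (simp only: real_sqrt_mult real_sqrt_abs) (simp add: gauss_scaled_bounds)
      also have "exp ((h \<bullet> score_sum n X - \<kappa>) / 2) = exp (h \<bullet> score_sum n X / 2) * exp (- \<kappa> / 2)"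
        by (simp add: exp_add[symmetric] diff_divide_distrib)
      finally have "sqrt (f1 (X, x) * f2 (X, x))
          = (?\<psi> X x * exp (h \<bullet> score_sum n X / 2)) * (exp (- \<kappa> / 2) * sqrt (gauss (x - h) / ?g x))"
        by (simp only: mult_ac)
      then show ?thesis
        unfolding gauss_scaled_tilt[OF e_pos a_pos] C_def by (simp only: mult_ac)
    qed
    then show "(\<integral>\<^sup>+X. ennreal (sqrt (f1 (X, x) * f2 (X, x))) \<partial>sample n) = ennreal (sqrt (gauss (x - h) / ?g x) * exp (- \<kappa> / 2)
      * exp (h \<bullet> x / (2 * a) + e\<^sup>2 * (norm h)\<^sup>2 / (8 * a\<^sup>2)) * ?g (x + (e\<^sup>2 / (2 * a)) *\<^sub>R h))"
      unfolding C_def[symmetric]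
      using C by (simp add: ennreal_mult gauss_scaled_bounds nn_integral_cmult nn_integral_smooth_density
          less_imp_le[OF smooth_density_pos])
  qed
  finally have "ennreal (1 - \<delta>\<^sup>2 / 8) \<le> (\<integral>\<^sup>+z. ennreal (sqrt (f1 z * f2 z)) \<partial>?J)"
    using aff by simp
  then have "\<bar>measure (density ?J (\<lambda>z. ennreal (f1 z))) (A \<times> UNIV) - measure (density ?J (\<lambda>z. ennreal (f2 z))) (A \<times> UNIV)\<bar> \<le> \<delta>"
    by (intro measure_density_diff_le nn i1 i2 \<delta>) (use A in auto)
  then show ?thesis unfolding measure_def m1[OF A] m2[OF A] .
qed

text \<open>The hypothesis \<open>near\<close> says that the limiting affinity exceeds the threshold
  of \<open>lift_kernel_affinity\<close>; being strict, it passes from the limit inferior to the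
  integrals at all large \<open>n\<close>.\<close>

lemma lift_kernel_approx:
  fixes h :: "nat \<Rightarrow> 'v"
  assumes h: "h \<longlonglongrightarrow> h0" and \<delta>: "0 < \<delta>" and near: "1 - \<delta>\<^sup>2 / 8 < exp (- (1 - a) * (norm h0)\<^sup>2 / 4)"
  shows "\<forall>\<^sub>F n in sequentially. \<forall>A\<in>sets (sample n).
    \<bar>measure (PiM {..<n} (\<lambda>_. tilt ((1 / sqrt (real n)) *\<^sub>R h n))) A
      - measure (gauss_law (h n) \<bind> lift_kernel a e n) A\<bar> \<le> \<delta>"
proof -
  define \<kappa> where "\<kappa> n = real n * cumulant ((1 / sqrt (real n)) *\<^sub>R h n)" for n
  define F where "F n x = sqrt (gauss (x - h n) / smooth_density a e n x) * exp (- \<kappa> n / 2)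
      * exp (h n \<bullet> x / (2 * a) + e\<^sup>2 * (norm (h n))\<^sup>2 / (8 * a\<^sup>2)) * smooth_density a e n (x + (e\<^sup>2 / (2 * a)) *\<^sub>R h n)" for n x
  define L where "L x = sqrt (gauss (x - h0) / gauss x) * exp (- ((norm h0)\<^sup>2 / 2) / 2)
      * exp (h0 \<bullet> x / (2 * a) + e\<^sup>2 * (norm h0)\<^sup>2 / (8 * a\<^sup>2)) * gauss (x + (e\<^sup>2 / (2 * a)) *\<^sub>R h0)" for x
  have [measurable]: "F n \<in> borel_measurable borel" for n unfolding F_def by measurable
  have \<kappa>: "\<kappa> \<longlonglongrightarrow> (norm h0)\<^sup>2 / 2"
    unfolding \<kappa>_def by (rule cumulant_scaled_tendsto[OF h])
  have gc: "(\<lambda>n. gauss (x - h n)) \<longlonglongrightarrow> gauss (x - h0)" for x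
    unfolding gauss_def by (intro tendsto_intros h) auto
  have "(\<lambda>n. F n x) \<longlonglongrightarrow> L x" for x
    unfolding F_def L_def
    by (intro tendsto_intros \<kappa> h gc smooth_density_tendsto) (use a_pos gauss_pos[of x] in auto)
  then have lim: "liminf (\<lambda>n. ennreal (F n x)) = ennreal (L x)" for x
    by (intro lim_imp_Liminf tendsto_ennrealI) auto
  \<comment> \<open>The limit is a Gaussian density times the limiting affinity. Its centre is
    midway between the means \<open>a h0\<close> and \<open>h0\<close> of the statistic under the
    two joint laws.\<close>
  have L: "L x = exp (- (1 - a) * (norm h0)\<^sup>2 / 4) * gauss (x - ((1 + a) / 2) *\<^sub>R h0)" for x
  proof -
    define q r where "q = h0 \<bullet> x" and "r = (norm h0)\<^sup>2"
    have "gauss (x - h0) / gauss x = (exp ((q - r / 2) / 2))\<^sup>2"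
      using gauss_shift[of x 1 h0] gauss_pos[of x] by (simp add: q_def r_def exp_double[symmetric])
    then have s1: "sqrt (gauss (x - h0) / gauss x) = exp ((q - r / 2) / 2)" by simp
    have s2: "gauss (x + (e\<^sup>2 / (2 * a)) *\<^sub>R h0) = gauss x * exp (- (e\<^sup>2 / (2 * a)) * q - (e\<^sup>2 / (2 * a))\<^sup>2 * r / 2)"
      using gauss_shift[of x "- (e\<^sup>2 / (2 * a))" h0] by (simp add: q_def r_def)
    have s3: "gauss (x - ((1 + a) / 2) *\<^sub>R h0) = gauss x * exp (((1 + a) / 2) * q - ((1 + a) / 2)\<^sup>2 * r / 2)"
      using gauss_shift[of x "(1 + a) / 2" h0] by (simp add: q_def r_def)
    have e2: "e\<^sup>2 = 1 - a\<^sup>2" using ae by simp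
    have ex: "(q - r / 2) / 2 + - (r / 2) / 2 + (q / (2 * a) + e\<^sup>2 * r / (8 * a\<^sup>2)) +
        (- (e\<^sup>2 / (2 * a)) * q - (e\<^sup>2 / (2 * a))\<^sup>2 * r / 2)
      = - (1 - a) * r / 4 + (((1 + a) / 2) * q - ((1 + a) / 2)\<^sup>2 * r / 2)"
      unfolding e2 using a_pos by (simp add: field_simps power2_eq_square)
    have "L x = gauss x * exp ((q - r / 2) / 2 + - (r / 2) / 2 + (q / (2 * a) + e\<^sup>2 * r / (8 * a\<^sup>2)) +
        (- (e\<^sup>2 / (2 * a)) * q - (e\<^sup>2 / (2 * a))\<^sup>2 * r / 2))"
      unfolding L_def s1 s2 q_def[symmetric] r_def[symmetric] exp_add by (simp only: mult_ac)
    also have "\<dots> = exp (- (1 - a) * r / 4) * (gauss x * exp (((1 + a) / 2) * q - ((1 + a) / 2)\<^sup>2 * r / 2))"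
      unfolding ex exp_add by (simp only: mult_ac)
    finally show ?thesis unfolding s3 r_def .
  qed
  have "ennreal (exp (- (1 - a) * (norm h0)\<^sup>2 / 4)) = (\<integral>\<^sup>+x. ennreal (L x) \<partial>lborel)"
    unfolding L by (simp add: ennreal_mult nn_integral_cmult nn_integral_gauss)
  also have "\<dots> \<le> liminf (\<lambda>n. \<integral>\<^sup>+x. ennreal (F n x) \<partial>lborel)"
    unfolding lim[symmetric] by (rule nn_integral_liminf) measurable
  finally have "ennreal (1 - \<delta>\<^sup>2 / 8) < liminf (\<lambda>n. \<integral>\<^sup>+x. ennreal (F n x) \<partial>lborel)"
    using near by (meson ennreal_lessI exp_gt_zero less_le_trans)
  then have "\<forall>\<^sub>F n in sequentially. ennreal (1 - \<delta>\<^sup>2 / 8) < (\<integral>\<^sup>+x. ennreal (F n x) \<partial>lborel)"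
    by (rule less_LiminfD)
  then show ?thesis
  proof eventually_elim
    case (elim n)
    show ?case
      using lift_kernel_affinity[where h="h n" and n=n and \<delta>=\<delta>] elim \<delta> unfolding F_def \<kappa>_def by (auto simp: less_imp_le)
  qed
qed

end

end

subsection \<open>Differentiability in quadratic mean\<close>

text \<open>Some coordinate has absolute value at least \<open>norm y / DIM('v)\<close>, so the
  exponential of the norm is dominated by a finite sum of exponentials in the directions plus and
  minus a basis vector.\<close>

lemma integrable_exp_norm_of_inner:
  fixes Y :: "'a \<Rightarrow> 'v::euclidean_space"
  assumes [measurable]: "Y \<in> borel_measurable M" and int: "\<And>v. integrable M (\<lambda>x. exp (v \<bullet> Y x))"
  shows "integrable M (\<lambda>x. exp (c * norm (Y x)))"
proof -
  define D where "D = \<bar>c\<bar> * real DIM('v)"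
  have bd: "exp (c * norm y) \<le> (\<Sum>b\<in>Basis. exp ((D *\<^sub>R b) \<bullet> y) + exp ((- D *\<^sub>R b) \<bullet> y))" for y :: 'v
  proof -
    have "\<exists>b\<in>Basis. norm y \<le> real DIM('v) * \<bar>y \<bullet> b\<bar>"
    proof (rule ccontr)
      assume "\<not> ?thesis"
      then have "\<bar>y \<bullet> b\<bar> < norm y / real DIM('v)" if "b \<in> Basis" for b
        using that by (auto simp: field_simps not_le)
      then have "(\<Sum>b\<in>Basis. \<bar>y \<bullet> b\<bar>) < (\<Sum>b\<in>(Basis::'v set). norm y / real DIM('v))"
        by (intro sum_strict_mono) auto
      then show False using norm_le_l1[of y] by simp
    qed
    then obtain b where b: "b \<in> Basis" "norm y \<le> real DIM('v) * \<bar>y \<bullet> b\<bar>" by blast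
    have "c * norm y \<le> \<bar>c\<bar> * norm y" by (intro mult_right_mono) auto
    also have "\<dots> \<le> D * \<bar>y \<bullet> b\<bar>" using mult_left_mono[OF b(2), of "\<bar>c\<bar>"] by (simp add: D_def mult.assoc)
    finally have "exp (c * norm y) \<le> exp (D * \<bar>y \<bullet> b\<bar>)" by simp
    also have "\<dots> \<le> exp ((D *\<^sub>R b) \<bullet> y) + exp ((- D *\<^sub>R b) \<bullet> y)"
      by (cases "0 \<le> y \<bullet> b") (auto simp: inner_commute)
    also have "\<dots> \<le> (\<Sum>b\<in>Basis. exp ((D *\<^sub>R b) \<bullet> y) + exp ((- D *\<^sub>R b) \<bullet> y))"
      using b(1) by (intro member_le_sum) (auto intro: add_nonneg_nonneg)
    finally show ?thesis .
  qed
  show ?thesis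
  proof (rule Bochner_Integration.integrable_bound)
    show "integrable M (\<lambda>x. \<Sum>b\<in>Basis. exp ((D *\<^sub>R b) \<bullet> Y x) + exp ((- D *\<^sub>R b) \<bullet> Y x))"
      by (intro Bochner_Integration.integrable_sum Bochner_Integration.integrable_add int)
    show "AE x in M. norm (exp (c * norm (Y x)))
        \<le> norm (\<Sum>b\<in>Basis. exp ((D *\<^sub>R b) \<bullet> Y x) + exp ((- D *\<^sub>R b) \<bullet> Y x))"
      unfolding real_norm_def abs_exp_cancel by (intro AE_I2 order_trans[OF bd abs_ge_self])
  qed measurable
qed

text \<open>Putting \<open>u = h n / sqrt n\<close> turns the factor \<open>1 / |u|^2\<close> into
  \<open>n / |h n|^2\<close>, and \<open>h\<close> is bounded. Measurability is asked only near 0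
  because only parameters in the open set are admissible. Integrability is recorded because the
  Bochner integral of a nonintegrable function is 0, which would make the limit
  uninformative.\<close>

lemma dqm_residual_tendsto:
  fixes r :: "'v::euclidean_space \<Rightarrow> 'a \<Rightarrow> real"
  assumes lim: "((\<lambda>u. ennreal (1 / (norm u)\<^sup>2) * (\<integral>\<^sup>+x. ennreal ((r u x)\<^sup>2) \<partial>\<mu>)) \<longlongrightarrow> 0) (at 0)"
    and r0: "\<And>x. x \<in> space \<mu> \<Longrightarrow> r 0 x = 0"
    and meas: "\<forall>\<^sub>F u in nhds 0. r u \<in> borel_measurable \<mu>"
    and h: "h \<longlonglongrightarrow> h0"
  shows "\<forall>\<^sub>F n in sequentially. integrable \<mu> (\<lambda>x. (r ((1 / sqrt (real n)) *\<^sub>R h n) x)\<^sup>2)"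
    and "(\<lambda>n. real n * (\<integral>x. (r ((1 / sqrt (real n)) *\<^sub>R h n) x)\<^sup>2 \<partial>\<mu>)) \<longlonglongrightarrow> 0"
proof -
  let ?u = "\<lambda>n. (1 / sqrt (real n)) *\<^sub>R h n"
  have u0: "?u \<longlonglongrightarrow> 0"
  proof -
    have "?u \<longlonglongrightarrow> 0 *\<^sub>R h0"
      by (intro tendsto_scaleR h tendsto_divide_0[OF tendsto_const]
          filterlim_at_top_imp_at_infinity filterlim_compose[OF sqrt_at_top] filterlim_real_sequentially)
    then show ?thesis by simp
  qed
  obtain C where C: "\<And>n. norm (h n) \<le> C" "0 < C"
    using convergent_imp_Bseq[of h] h unfolding convergent_def Bseq_def by blast
  have ev: "\<forall>\<^sub>F n in sequentially. r (?u n) \<in> borel_measurable \<mu> \<and>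
      (\<integral>\<^sup>+x. ennreal ((r (?u n) x)\<^sup>2) \<partial>\<mu>) \<le> ennreal (\<epsilon> * (norm (?u n))\<^sup>2)" if \<epsilon>: "0 < \<epsilon>" for \<epsilon>
  proof -
    have "\<forall>\<^sub>F u in at 0. ennreal (1 / (norm u)\<^sup>2) * (\<integral>\<^sup>+x. ennreal ((r u x)\<^sup>2) \<partial>\<mu>) < ennreal \<epsilon>"
      using lim \<epsilon> by (intro order_tendstoD(2)) auto
    \<comment> \<open>The limit at 0 ignores \<open>u = 0\<close>, a value that the sequence may
      take; \<open>r0\<close> fills this point.\<close>
    then have "\<forall>\<^sub>F u in nhds 0. u \<noteq> 0 \<longrightarrow> ennreal (1 / (norm u)\<^sup>2) * (\<integral>\<^sup>+x. ennreal ((r u x)\<^sup>2) \<partial>\<mu>) < ennreal \<epsilon>"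
      by (simp add: eventually_at_filter)
    with meas have "\<forall>\<^sub>F u in nhds 0. r u \<in> borel_measurable \<mu> \<and>
        (\<integral>\<^sup>+x. ennreal ((r u x)\<^sup>2) \<partial>\<mu>) \<le> ennreal (\<epsilon> * (norm u)\<^sup>2)"
    proof eventually_elim
      case (elim u)
      show ?case
      proof (cases "u = 0")
        case True
        then show ?thesis using elim by (simp add: r0 cong: nn_integral_cong)
      next
        case False
        let ?I = "\<integral>\<^sup>+x. ennreal ((r u x)\<^sup>2) \<partial>\<mu>"
        have "?I = ennreal ((norm u)\<^sup>2) * (ennreal (1 / (norm u)\<^sup>2) * ?I)"
          using False by (simp add: mult.assoc[symmetric] ennreal_mult[symmetric])
        also have "\<dots> \<le> ennreal ((norm u)\<^sup>2) * ennreal \<epsilon>"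
          using elim False by (intro mult_left_mono) auto
        finally show ?thesis using elim \<epsilon> by (simp add: ennreal_mult mult.commute)
      qed
    qed
    from eventually_compose_filterlim[OF this u0] show ?thesis .
  qed
  have bnd: "\<forall>\<^sub>F n in sequentially. integrable \<mu> (\<lambda>x. (r (?u n) x)\<^sup>2) \<and>
      real n * (\<integral>x. (r (?u n) x)\<^sup>2 \<partial>\<mu>) \<le> \<epsilon> * C\<^sup>2" if \<epsilon>: "0 < \<epsilon>" for \<epsilon>
    using ev[OF \<epsilon>] eventually_gt_at_top[of 0]
  proof eventually_elim
    case (elim n)
    then have int: "integrable \<mu> (\<lambda>x. (r (?u n) x)\<^sup>2)"
      by (intro integrableI_nonneg) (auto intro: le_less_trans simp del: norm_scaleR)
    have "ennreal (\<integral>x. (r (?u n) x)\<^sup>2 \<partial>\<mu>) \<le> ennreal (\<epsilon> * (norm (?u n))\<^sup>2)"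
      using elim by (subst nn_integral_eq_integral[symmetric, OF int]) auto
    then have "(\<integral>x. (r (?u n) x)\<^sup>2 \<partial>\<mu>) \<le> \<epsilon> * (norm (?u n))\<^sup>2"
      using \<epsilon> by (subst (asm) ennreal_le_iff) auto
    from mult_left_mono[OF this, of "real n"]
    have "real n * (\<integral>x. (r (?u n) x)\<^sup>2 \<partial>\<mu>) \<le> \<epsilon> * (real n * (norm (?u n))\<^sup>2)" by (simp only: mult_ac of_nat_0_le_iff)
    also have "real n * (norm (?u n))\<^sup>2 = (norm (h n))\<^sup>2"
      using elim by (simp add: power_mult_distrib power_divide)
    also have "\<epsilon> * (norm (h n))\<^sup>2 \<le> \<epsilon> * C\<^sup>2"
      using \<epsilon> C by (intro mult_left_mono power_mono) auto
    finally show ?case using int by blast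
  qed
  show "\<forall>\<^sub>F n in sequentially. integrable \<mu> (\<lambda>x. (r (?u n) x)\<^sup>2)"
    using bnd[of 1] by (auto elim: eventually_mono)
  show "(\<lambda>n. real n * (\<integral>x. (r (?u n) x)\<^sup>2 \<partial>\<mu>)) \<longlonglongrightarrow> 0"
  proof (rule tendstoI)
    fix e :: real assume e: "0 < e"
    have "\<forall>\<^sub>F n in sequentially. real n * (\<integral>x. (r (?u n) x)\<^sup>2 \<partial>\<mu>) \<le> (e / (2 * C\<^sup>2)) * C\<^sup>2"
      using bnd[of "e / (2 * C\<^sup>2)"] e C by (auto elim: eventually_mono)
    then show "\<forall>\<^sub>F n in sequentially. dist (real n * (\<integral>x. (r (?u n) x)\<^sup>2 \<partial>\<mu>)) 0 < e"
    proof eventually_elim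
      case (elim n)
      have "0 \<le> real n * (\<integral>x. (r (?u n) x)\<^sup>2 \<partial>\<mu>)" by simp
      moreover have "(e / (2 * C\<^sup>2)) * C\<^sup>2 < e" using e C by simp
      ultimately show ?case using elim by (simp only: dist_real_def)
    qed
  qed
qed

text \<open>Since \<open>q n\<close> and \<open>p\<close> have equal mass, the linear term
  \<open>t m\<close> in the expansion of \<open>q n - p\<close>, with \<open>t = 1 / sqrt n\<close>,
  has to be absorbed by the remainders. These are an arbitrarily small multiple of \<open>t\<close>
  plus \<open>o(t)\<close>, which forces \<open>m = 0\<close>.\<close>

lemma dqm_mean_zero:
  fixes p y :: "'a \<Rightarrow> real" and q :: "nat \<Rightarrow> 'a \<Rightarrow> real"
  assumes p: "integrable \<mu> p" "integral\<^sup>L \<mu> p = 1" "\<And>x. x \<in> space \<mu> \<Longrightarrow> 0 \<le> p x"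
    and yp: "integrable \<mu> (\<lambda>x. y x * p x)" "integrable \<mu> (\<lambda>x. (y x)\<^sup>2 * p x)"
    and q: "\<forall>\<^sub>F n in sequentially. integrable \<mu> (q n) \<and> integral\<^sup>L \<mu> (q n) = 1 \<and> (\<forall>x\<in>space \<mu>. 0 \<le> q n x)"
    and res: "\<forall>\<^sub>F n in sequentially. integrable \<mu> (\<lambda>x. (sqrt (q n x) - sqrt (p x) - (1/2) * (1 / sqrt (real n) * y x) * sqrt (p x))\<^sup>2)"
    and lim: "(\<lambda>n. real n * (\<integral>x. (sqrt (q n x) - sqrt (p x) - (1/2) * (1 / sqrt (real n) * y x) * sqrt (p x))\<^sup>2 \<partial>\<mu>)) \<longlonglongrightarrow> 0"
  shows "(\<integral>x. y x * p x \<partial>\<mu>) = 0"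
proof -
  define m V where "m = (\<integral>x. y x * p x \<partial>\<mu>)" and "V = (\<integral>x. (y x)\<^sup>2 * p x \<partial>\<mu>)"
  define d where "d n = real n * (\<integral>x. (sqrt (q n x) - sqrt (p x) - (1/2) * (1 / sqrt (real n) * y x) * sqrt (p x))\<^sup>2 \<partial>\<mu>)" for n
  have "\<bar>m\<bar> \<le> 2 * \<eta>" if \<eta>: "0 < \<eta>" for \<eta>
  proof -
    have bound: "\<forall>\<^sub>F n in sequentially. \<bar>m\<bar> \<le> (1 / sqrt (real n)) * V / 4 + \<eta> * (2 + (1 / sqrt (real n))\<^sup>2 * V / 2)
        + d n / \<eta> + d n * (1 / sqrt (real n))"
      using q res eventually_gt_at_top[of 0]
    proof eventually_elim
      case (elim n)
      define t where "t = 1 / sqrt (real n)"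
      have t: "0 < t" "real n = 1 / t\<^sup>2" using elim by (auto simp: t_def power_divide)
      define R where "R x = sqrt (q n x) - sqrt (p x) - (1/2) * (t * y x) * sqrt (p x)" for x
      have Ri: "integrable \<mu> (\<lambda>x. (R x)\<^sup>2)" using elim unfolding R_def t_def by simp
      have Rd: "(\<integral>x. (R x)\<^sup>2 \<partial>\<mu>) = d n * t\<^sup>2" unfolding R_def d_def t_def[symmetric] using t by simp
      \<comment> \<open>With \<open>b\<close> the linearised root density, \<open>q n - p\<close>
        contains the cross term \<open>2 b R\<close>. AM-GM with weight \<open>\<eta> t\<close>
        splits it. As the integral of \<open>R\<^sup>2\<close> is \<open>d n * t\<^sup>2\<close>,
        both parts are of order \<open>t\<close>: the first carries the factor
        \<open>\<eta>\<close>, the second \<open>d n / \<eta>\<close>, and \<open>d n\<close> tends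
        to 0.\<close>
      have pw: "\<bar>t * (y x * p x) - (q n x - p x)\<bar>
          \<le> (t\<^sup>2 / 4) * ((y x)\<^sup>2 * p x) + \<eta> * t * (2 * p x + t\<^sup>2 / 2 * ((y x)\<^sup>2 * p x)) + (R x)\<^sup>2 * (1 / (\<eta> * t) + 1)"
        if x: "x \<in> space \<mu>" for x
      proof -
        define a b where "a = sqrt (p x)" and "b = a * (1 + t * y x / 2)"
        have px: "p x = a\<^sup>2" using p(3)[OF x] by (simp add: a_def)
        have "sqrt (q n x) = b + R x" by (simp add: R_def b_def a_def algebra_simps)
        then have qx: "q n x = (b + R x)\<^sup>2" using elim x by (metis real_sqrt_pow2)
        have e1: "t * (y x * p x) - (q n x - p x) = - (t\<^sup>2 / 4) * ((y x)\<^sup>2 * p x) - 2 * b * R x - (R x)\<^sup>2"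
          unfolding qx px b_def by (simp add: power2_eq_square algebra_simps)
        have "0 \<le> (\<eta> * t * \<bar>b\<bar> - \<bar>R x\<bar>)\<^sup>2 / (\<eta> * t)" using t \<eta> by simp
        also have "\<dots> = \<eta> * t * b\<^sup>2 + (R x)\<^sup>2 * (1 / (\<eta> * t)) - 2 * \<bar>b\<bar> * \<bar>R x\<bar>"
        proof -
          have "(\<eta> * t * \<bar>b\<bar> - \<bar>R x\<bar>)\<^sup>2 = (\<eta> * t)\<^sup>2 * b\<^sup>2 + (R x)\<^sup>2 - 2 * (\<eta> * t) * (\<bar>b\<bar> * \<bar>R x\<bar>)"
            by (simp add: power2_diff power_mult_distrib)
          then show ?thesis using t \<eta> by (simp add: diff_divide_distrib add_divide_distrib power2_eq_square)
        qed
        finally have "\<bar>2 * b * R x\<bar> \<le> \<eta> * t * b\<^sup>2 + (R x)\<^sup>2 * (1 / (\<eta> * t))" by (simp add: abs_mult)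
        moreover have "b\<^sup>2 \<le> 2 * p x + t\<^sup>2 / 2 * ((y x)\<^sup>2 * p x)"
        proof -
          have "0 \<le> a\<^sup>2 * (1 - t * y x / 2)\<^sup>2" by simp
          also have "\<dots> = 2 * p x + t\<^sup>2 / 2 * ((y x)\<^sup>2 * p x) - b\<^sup>2"
            unfolding px b_def by (simp add: power2_eq_square algebra_simps)
          finally show ?thesis by simp
        qed
        then have "\<eta> * t * b\<^sup>2 \<le> \<eta> * t * (2 * p x + t\<^sup>2 / 2 * ((y x)\<^sup>2 * p x))"
          using t \<eta> by (intro mult_left_mono) auto
        moreover have "0 \<le> (t\<^sup>2 / 4) * ((y x)\<^sup>2 * p x)" using p(3)[OF x] by simp
        moreover have "0 \<le> (R x)\<^sup>2" by simp
        moreover have "(R x)\<^sup>2 * (1 / (\<eta> * t) + 1) = (R x)\<^sup>2 * (1 / (\<eta> * t)) + (R x)\<^sup>2" by (simp add: distrib_left)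
        ultimately show ?thesis unfolding e1 by linarith
      qed
      have "t * m = (\<integral>x. t * (y x * p x) - (q n x - p x) \<partial>\<mu>)"
        using elim p yp by (simp add: m_def)
      also have "\<bar>\<dots>\<bar> \<le> (\<integral>x. \<bar>t * (y x * p x) - (q n x - p x)\<bar> \<partial>\<mu>)" by (rule integral_abs_bound)
      also have "\<dots> \<le> (\<integral>x. (t\<^sup>2 / 4) * ((y x)\<^sup>2 * p x) + \<eta> * t * (2 * p x + t\<^sup>2 / 2 * ((y x)\<^sup>2 * p x)) + (R x)\<^sup>2 * (1 / (\<eta> * t) + 1) \<partial>\<mu>)"
        using pw elim p yp Ri by (intro integral_mono) auto
      also have "\<dots> = (t\<^sup>2 / 4) * V + \<eta> * t * (2 + t\<^sup>2 / 2 * V) + (d n * t\<^sup>2) * (1 / (\<eta> * t) + 1)"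
        using p yp Ri by (simp add: V_def Rd)
      also have "\<dots> = t * (t * V / 4 + \<eta> * (2 + t\<^sup>2 * V / 2) + d n / \<eta> + d n * t)"
        using t \<eta> by (simp add: power2_eq_square field_simps)
      finally have "t * \<bar>m\<bar> \<le> t * (t * V / 4 + \<eta> * (2 + t\<^sup>2 * V / 2) + d n / \<eta> + d n * t)"
        using t by (simp add: abs_mult)
      then show ?case using t(1) unfolding t_def by (simp only: mult_le_cancel_left_pos)
    qed
    have limit: "(\<lambda>n. (1 / sqrt (real n)) * V / 4 + \<eta> * (2 + (1 / sqrt (real n))\<^sup>2 * V / 2)
        + d n / \<eta> + d n * (1 / sqrt (real n))) \<longlonglongrightarrow> 0 * V / 4 + \<eta> * (2 + 0\<^sup>2 * V / 2) + 0 / \<eta> + 0 * 0"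
      using \<eta> lim unfolding d_def[symmetric]
      by (intro tendsto_intros tendsto_divide_0[OF tendsto_const]
          filterlim_at_top_imp_at_infinity filterlim_compose[OF sqrt_at_top] filterlim_real_sequentially) auto
    have "\<bar>m\<bar> \<le> 0 * V / 4 + \<eta> * (2 + 0\<^sup>2 * V / 2) + 0 / \<eta> + 0 * 0"
      by (rule tendsto_lowerbound[OF limit bound trivial_limit_sequentially])
    then show ?thesis by simp
  qed
  \<comment> \<open>The choice \<open>\<eta> = |m| / 4\<close> yields
    \<open>|m| \<le> |m| / 2\<close>.\<close>
  from this[of "\<bar>m\<bar> / 4"] have "m = 0" by (cases "m = 0") auto
  then show ?thesis by (simp add: m_def)
qed

text \<open>The linearised root density \<open>sqrt (p x) * (1 + u \<bullet> s x / 2)\<close> serves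
  as the intermediate point: \<open>lim\<close> controls its distance to \<open>q n\<close>, and
  \<open>tilt_hellinger_tendsto\<close> its distance to the tilted law. The squared errors, at most
  doubled by the triangle inequality, remain \<open>o(1 / n)\<close>.\<close>

lemma (in std_score) product_tilt_approx:
  fixes p :: "'a \<Rightarrow> real" and q :: "nat \<Rightarrow> 'a \<Rightarrow> real"
  assumes P: "P = density \<mu> (\<lambda>x. ennreal (p x))"
    and p: "p \<in> borel_measurable \<mu>" "\<And>x. x \<in> space \<mu> \<Longrightarrow> 0 \<le> p x"
    and q: "\<forall>\<^sub>F n in sequentially. q n \<in> borel_measurable \<mu> \<and> (\<forall>x\<in>space \<mu>. 0 \<le> q n x)
        \<and> prob_space (density \<mu> (\<lambda>x. ennreal (q n x)))"
    and h: "h \<longlonglongrightarrow> h0" and \<delta>: "0 < \<delta>"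
    and res: "\<forall>\<^sub>F n in sequentially. integrable \<mu> (\<lambda>x. (sqrt (q n x) - sqrt (p x)
        - (1/2) * (((1 / sqrt (real n)) *\<^sub>R h n) \<bullet> s x) * sqrt (p x))\<^sup>2)"
    and lim: "(\<lambda>n. real n * (\<integral>x. (sqrt (q n x) - sqrt (p x)
        - (1/2) * (((1 / sqrt (real n)) *\<^sub>R h n) \<bullet> s x) * sqrt (p x))\<^sup>2 \<partial>\<mu>)) \<longlonglongrightarrow> 0"
  shows "\<forall>\<^sub>F n in sequentially. \<forall>A\<in>sets (sample n).
    \<bar>measure (PiM {..<n} (\<lambda>_. density \<mu> (\<lambda>x. ennreal (q n x)))) A
      - measure (PiM {..<n} (\<lambda>_. tilt ((1 / sqrt (real n)) *\<^sub>R h n))) A\<bar> \<le> \<delta>"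
proof -
  let ?u = "\<lambda>n. (1 / sqrt (real n)) *\<^sub>R h n"
  let ?r = "\<lambda>n x. sqrt (q n x) - sqrt (p x) - (1/2) * (?u n \<bullet> s x) * sqrt (p x)"
  let ?w = "\<lambda>n x. 1 + ?u n \<bullet> s x / 2 - exp ((?u n \<bullet> s x - cumulant (?u n)) / 2)"
  note [measurable] = p(1)
  have setsP: "sets P = sets \<mu>" by (simp add: P)
  have sm[measurable]: "s \<in> borel_measurable \<mu>" using s_measurable by (simp add: P)
  define H where "H n = 2 * (real n * (\<integral>x. (?r n x)\<^sup>2 \<partial>\<mu>)) + 2 * (real n * (\<integral>x. (?w n x)\<^sup>2 \<partial>P))" for n
  have "H \<longlonglongrightarrow> 2 * 0 + 2 * 0"
    unfolding H_def by (intro tendsto_intros lim tilt_hellinger_tendsto[OF h])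
  then have "\<forall>\<^sub>F n in sequentially. H n < \<delta>\<^sup>2 / 4"
    using \<delta> by (intro order_tendstoD(2)[where y=0]) auto
  with q res show ?thesis
  proof eventually_elim
    case (elim n)
    define c where "c = cumulant (?u n)"
    define E where "E x = exp (?u n \<bullet> s x - c)" for x
    define T where "T x = p x + q n x" for x
    have [measurable]: "q n \<in> borel_measurable \<mu>" "E \<in> borel_measurable \<mu>" "T \<in> borel_measurable \<mu>"
      using elim unfolding E_def T_def by auto
    have qn: "0 \<le> q n x" if "x \<in> space \<mu>" for x using elim that by auto
    have T0: "0 \<le> T x" if "x \<in> space \<mu>" for x using qn[OF that] p(2)[OF that] by (simp add: T_def)
    \<comment> \<open>Where \<open>T x = 0\<close> the quotient is 0 by convention, which is
      consistent because \<open>p x\<close> and \<open>q n x\<close> then vanish as well.\<close>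
    have Tq: "T x * (q n x / T x) = q n x" if "x \<in> space \<mu>" for x
      using qn[OF that] p(2)[OF that] by (cases "T x = 0") (auto simp: T_def)
    have Tp: "T x * (p x * E x / T x) = p x * E x" if "x \<in> space \<mu>" for x
      using qn[OF that] p(2)[OF that] by (cases "T x = 0") (auto simp: T_def)
    \<comment> \<open>\<open>\<mu>\<close> need not be sigma-finite, so the products are dominated by powers of the finite measure \<open>\<nu>\<close>.\<close>
    define \<nu> where "\<nu> = density \<mu> (\<lambda>x. ennreal (T x))"
    have dens: "density \<nu> (\<lambda>x. ennreal (f x / T x)) = density \<mu> (\<lambda>x. ennreal (f x))"
      if [measurable]: "f \<in> borel_measurable \<mu>"
        and Tf: "\<And>x. x \<in> space \<mu> \<Longrightarrow> T x * (f x / T x) = f x" for f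
    proof -
      have "ennreal (T x) * ennreal (f x / T x) = ennreal (f x)" if x: "x \<in> space \<mu>" for x
        using Tf[OF x] by (simp only: ennreal_mult'[OF T0[OF x], symmetric])
      then show ?thesis unfolding \<nu>_def
        by (subst density_density_eq) (auto intro!: density_cong)
    qed
    have d1: "density \<nu> (\<lambda>x. ennreal (q n x / T x)) = density \<mu> (\<lambda>x. ennreal (q n x))"
      by (rule dens) (simp_all only: Tq, measurable)
    have d2: "density \<nu> (\<lambda>x. ennreal (p x * E x / T x)) = tilt (?u n)"
    proof -
      have "density \<nu> (\<lambda>x. ennreal (p x * E x / T x)) = density \<mu> (\<lambda>x. ennreal (p x * E x))"
        by (rule dens) (simp_all only: Tp, measurable)
      also have "\<dots> = density (density \<mu> (\<lambda>x. ennreal (p x))) (\<lambda>x. ennreal (E x))"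
        by (subst density_density_eq) (auto intro!: density_cong simp: ennreal_mult' p)
      also have "\<dots> = density P (\<lambda>x. ennreal (E x))"
        by (rule arg_cong[OF P[symmetric], of "\<lambda>M. density M (\<lambda>x. ennreal (E x))"])
      also have "\<dots> = tilt (?u n)" by (simp only: tilt_def E_def c_def)
      finally show ?thesis .
    qed
    have "(\<integral>\<^sup>+x. ennreal (p x) \<partial>\<mu>) = 1"
      using emeasure_space_1 unfolding P by (simp add: emeasure_density cong: nn_integral_cong)
    moreover have "(\<integral>\<^sup>+x. ennreal (q n x) \<partial>\<mu>) = 1"
      using prob_space.emeasure_space_1[of "density \<mu> (\<lambda>x. ennreal (q n x))"] elim
      by (simp add: emeasure_density cong: nn_integral_cong)
    ultimately have "(\<integral>\<^sup>+x. ennreal (T x) \<partial>\<mu>) = 2"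
      by (simp add: T_def ennreal_plus p qn nn_integral_add cong: nn_integral_cong)
    then have fin: "finite_measure \<nu>"
      by (intro finite_measureI) (simp add: \<nu>_def emeasure_density cong: nn_integral_cong)
    have sets\<nu>: "sets \<nu> = sets \<mu>" "space \<nu> = space \<mu>" by (simp_all add: \<nu>_def)
    have sq: "(sqrt (q n x) - sqrt (p x * E x))\<^sup>2 \<le> 2 * (?r n x)\<^sup>2 + 2 * (p x * (?w n x)\<^sup>2)"
      if x: "x \<in> space \<mu>" for x
    proof -
      have "sqrt (E x) = exp ((?u n \<bullet> s x - c) / 2)"
      proof -
        have "E x = (exp ((?u n \<bullet> s x - c) / 2))\<^sup>2"
          unfolding E_def exp_double[symmetric] by simp
        then show ?thesis by simp
      qed
      then have "sqrt (q n x) - sqrt (p x * E x) = ?r n x + sqrt (p x) * ?w n x"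
        unfolding c_def by (simp only: real_sqrt_mult) (simp add: algebra_simps)
      also have "(?r n x + sqrt (p x) * ?w n x)\<^sup>2 \<le> 2 * (?r n x)\<^sup>2 + 2 * (sqrt (p x) * ?w n x)\<^sup>2"
        using sum_squares_bound[of "?r n x" "sqrt (p x) * ?w n x"] by (simp add: power2_sum)
      also have "(sqrt (p x) * ?w n x)\<^sup>2 = p x * (?w n x)\<^sup>2"
        using p(2)[OF x] by (simp add: power_mult_distrib)
      finally show ?thesis .
    qed
    have wP: "integrable P (\<lambda>x. (?w n x)\<^sup>2)"
      by (rule integrable_tilt_residual)
    then have wi: "integrable \<mu> (\<lambda>x. p x * (?w n x)\<^sup>2)"
      unfolding P by (subst (asm) integrable_real_density) (use p in auto)
    have wI: "(\<integral>x. p x * (?w n x)\<^sup>2 \<partial>\<mu>) = (\<integral>x. (?w n x)\<^sup>2 \<partial>P)"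
      unfolding P by (subst integral_real_density) (use p in auto)
    have ri: "integrable \<mu> (\<lambda>x. (?r n x)\<^sup>2)" using elim by blast
    have "(\<integral>x. (sqrt (q n x / T x) - sqrt (p x * E x / T x))\<^sup>2 \<partial>\<nu>)
        = (\<integral>x. T x * (sqrt (q n x / T x) - sqrt (p x * E x / T x))\<^sup>2 \<partial>\<mu>)"
      unfolding \<nu>_def by (subst integral_real_density) (use T0 in auto)
    also have "\<dots> = (\<integral>x. (sqrt (q n x) - sqrt (p x * E x))\<^sup>2 \<partial>\<mu>)"
    proof (rule Bochner_Integration.integral_cong[OF refl])
      fix x assume x: "x \<in> space \<mu>"
      show "T x * (sqrt (q n x / T x) - sqrt (p x * E x / T x))\<^sup>2 = (sqrt (q n x) - sqrt (p x * E x))\<^sup>2"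
      proof (cases "T x = 0")
        case True
        then have "q n x = 0" "p x = 0" using qn[OF x] p(2)[OF x] by (auto simp: T_def)
        then show ?thesis by simp
      next
        case False
        then show ?thesis using T0[OF x]
          by (simp add: real_sqrt_divide diff_divide_distrib[symmetric] power_divide)
      qed
    qed
    also have "\<dots> \<le> (\<integral>x. 2 * (?r n x)\<^sup>2 + 2 * (p x * (?w n x)\<^sup>2) \<partial>\<mu>)"
    proof (rule integral_mono)
      show i: "integrable \<mu> (\<lambda>x. 2 * (?r n x)\<^sup>2 + 2 * (p x * (?w n x)\<^sup>2))" using ri wi by simp
      show "integrable \<mu> (\<lambda>x. (sqrt (q n x) - sqrt (p x * E x))\<^sup>2)"
        by (rule Bochner_Integration.integrable_bound[OF i])
           (use sq in \<open>auto intro!: AE_I2 intro: order_trans[OF _ abs_ge_self]\<close>)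
    qed (rule sq)
    also have "\<dots> = 2 * (\<integral>x. (?r n x)\<^sup>2 \<partial>\<mu>) + 2 * (\<integral>x. (?w n x)\<^sup>2 \<partial>P)"
      unfolding wI[symmetric] using ri wi by simp
    finally have "real n * (\<integral>x. (sqrt (q n x / T x) - sqrt (p x * E x / T x))\<^sup>2 \<partial>\<nu>)
        \<le> real n * (2 * (\<integral>x. (?r n x)\<^sup>2 \<partial>\<mu>) + 2 * (\<integral>x. (?w n x)\<^sup>2 \<partial>P))"
      by (rule mult_left_mono) simp
    also have "\<dots> = H n" unfolding H_def by (simp add: algebra_simps)
    finally have hel: "real n * (\<integral>x. (sqrt (q n x / T x) - sqrt (p x * E x / T x))\<^sup>2 \<partial>\<nu>) \<le> \<delta>\<^sup>2 / 4"
      using elim by linarith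
    show ?case
    proof
      fix A assume "A \<in> sets (sample n)"
      then have A: "A \<in> sets (PiM {..<n} (\<lambda>_. \<nu>))"
        by (metis setsP sets\<nu>(1) sets_PiM_cong)
      show "\<bar>measure (PiM {..<n} (\<lambda>_. density \<mu> (\<lambda>x. ennreal (q n x)))) A
        - measure (PiM {..<n} (\<lambda>_. tilt (?u n))) A\<bar> \<le> \<delta>"
        unfolding d1[symmetric] d2[symmetric]
      proof (rule measure_PiM_diff_le[OF _ _ _ A _ _ _ _ hel \<delta>])
        show "sigma_finite_measure \<nu>" using fin by (simp add: finite_measure_def)
        show "prob_space (density \<nu> (\<lambda>x. ennreal (q n x / T x)))" using elim d1 by simp
        show "prob_space (density \<nu> (\<lambda>x. ennreal (p x * E x / T x)))" using prob_space_tilt d2 by simp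
        show "(\<lambda>x. q n x / T x) \<in> borel_measurable \<nu>" "(\<lambda>x. p x * E x / T x) \<in> borel_measurable \<nu>"
          unfolding \<nu>_def by measurable
      qed (auto simp: sets\<nu> qn p T0 E_def)
    qed
  qed
qed

section \<open>Uniformity on compact sets and diagonal choice\<close>

lemma eventually_uniform_on_compact:
  fixes K :: "'b::metric_space set"
  assumes K: "compact K" and Q: "\<And>h h0. h0 \<in> K \<Longrightarrow> h \<longlonglongrightarrow> h0 \<Longrightarrow> \<forall>\<^sub>F n in sequentially. Q n (h n)"
  shows "\<forall>\<^sub>F n in sequentially. \<forall>x\<in>K. Q n x"
proof (rule ccontr)
  assume "\<not> ?thesis"
  then have "infinite {n. \<exists>x\<in>K. \<not> Q n x}"
    by (simp add: eventually_sequentially infinite_nat_iff_unbounded_le)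
  from infinite_enumerate[OF this] obtain r :: "nat \<Rightarrow> nat"
    where r: "strict_mono r" "\<And>j. \<exists>x\<in>K. \<not> Q (r j) x" by blast
  then obtain x where x: "\<And>j. x j \<in> K" "\<And>j. \<not> Q (r j) (x j)" by metis
  from K[unfolded compact_def] x(1) obtain h0 \<sigma> where \<sigma>: "h0 \<in> K" "strict_mono \<sigma>" "(x \<circ> \<sigma>) \<longlonglongrightarrow> h0"
    by blast
  define \<rho> where "\<rho> = r \<circ> \<sigma>"
  have \<rho>: "strict_mono \<rho>" unfolding \<rho>_def by (rule strict_mono_o[OF r(1) \<sigma>(2)])
  have inj: "inj \<rho>" using \<rho> by (rule strict_mono_imp_inj_on)
  \<comment> \<open>The hypothesis speaks of full sequences indexed by \<open>n\<close>, so a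
    convergent subsequence of bad points does not suffice. The gaps are filled with the limit
    \<open>h0\<close>; the result still converges to \<open>h0\<close> and violates \<open>Q\<close>
    at every index in the range of \<open>\<rho>\<close>.\<close>
  define h where "h n = (if n \<in> range \<rho> then x (\<sigma> (inv \<rho> n)) else h0)" for n
  have h\<rho>: "h (\<rho> j) = x (\<sigma> j)" for j unfolding h_def using inj by simp
  have "h \<longlonglongrightarrow> h0"
  proof (rule metric_LIMSEQ_I)
    fix e :: real assume e: "0 < e"
    then obtain N where N: "\<And>j. j \<ge> N \<Longrightarrow> dist (x (\<sigma> j)) h0 < e"
      using metric_LIMSEQ_D[OF \<sigma>(3)] by auto
    show "\<exists>N. \<forall>n\<ge>N. dist (h n) h0 < e"
    proof (intro exI[of _ "\<rho> N"] allI impI)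
      fix n assume n: "\<rho> N \<le> n"
      show "dist (h n) h0 < e"
      proof (cases "n \<in> range \<rho>")
        case True
        then obtain j where j: "n = \<rho> j" by blast
        with n \<rho> have "N \<le> j" by (simp add: strict_mono_less_eq)
        then show ?thesis using N h\<rho> j by simp
      qed (use e in \<open>simp add: h_def\<close>)
    qed
  qed
  from Q[OF \<sigma>(1) this] obtain N where N: "\<And>n. n \<ge> N \<Longrightarrow> Q n (h n)"
    by (auto simp: eventually_sequentially)
  have "Q (\<rho> N) (h (\<rho> N))" using seq_suble[OF \<rho>, of N] by (rule N)
  then show False using x(2)[of "\<sigma> N"] by (simp add: h\<rho>, simp add: \<rho>_def)
qed

text \<open>For each \<open>n\<close> the witness is taken at the largest level
  \<open>k \<le> n\<close> that is attained at all; by monotonicity it serves every lower level. The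
  cap makes the maximum exist, and a fixed \<open>k\<close> is below the cap from
  \<open>n = k\<close> on. \<open>S\<close> is the condition that must hold at every
  \<open>n\<close>, even where no level is attained.\<close>

lemma diagonal_choice:
  fixes Q :: "nat \<Rightarrow> nat \<Rightarrow> 'b \<Rightarrow> bool"
  assumes base: "\<And>n. \<exists>R. S n R" and QS: "\<And>n k R. Q n k R \<Longrightarrow> S n R"
    and ev: "\<And>k. \<forall>\<^sub>F n in sequentially. \<exists>R. Q n k R"
    and mono: "\<And>n k l R. Q n k R \<Longrightarrow> l \<le> k \<Longrightarrow> Q n l R"
  shows "\<exists>R. (\<forall>n. S n (R n)) \<and> (\<forall>k. \<forall>\<^sub>F n in sequentially. Q n k (R n))"
proof -
  have "\<exists>R. S n R \<and> (\<forall>k\<le>n. (\<exists>R'. Q n k R') \<longrightarrow> Q n k R)" for n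
  proof (cases "\<exists>k\<le>n. \<exists>R. Q n k R")
    case True
    define k where "k = Max {k. k \<le> n \<and> (\<exists>R. Q n k R)}"
    have "k \<in> {k. k \<le> n \<and> (\<exists>R. Q n k R)}" unfolding k_def by (rule Max_in) (use True in auto)
    then obtain R where R: "Q n k R" by blast
    have "l \<le> k" if "l \<le> n" "\<exists>R. Q n l R" for l unfolding k_def by (rule Max_ge) (use that in auto)
    with R mono QS show ?thesis by blast
  qed (use base in blast)
  then obtain R where R: "\<And>n. S n (R n)" "\<And>n k. k \<le> n \<Longrightarrow> \<exists>R'. Q n k R' \<Longrightarrow> Q n k (R n)" by metis
  have "\<forall>\<^sub>F n in sequentially. Q n k (R n)" for k
    using ev[of k] eventually_ge_at_top[of k] by eventually_elim (use R(2) in blast)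
  with R(1) show ?thesis by blast
qed

subsection \<open>Lifting the Gaussian shift experiment\<close>

text \<open>Preimages under \<open>f\<close> of sets of \<open>T\<close> are sets of
  \<open>S\<close>, so images are never easier to tell apart than the originals. The factor 2 is the
  one in \<open>tv_dist\<close>.\<close>

lemma tv_dist_distr_le:
  assumes f: "f \<in> S \<rightarrow>\<^sub>M T" and M: "sets M = sets S" and N: "sets N = sets S"
    and le: "\<And>A. A \<in> sets S \<Longrightarrow> \<bar>measure M A - measure N A\<bar> \<le> \<delta>"
  shows "tv_dist (distr M T f) (distr N T f) \<le> ennreal (2 * \<delta>)"
proof -
  have f': "f \<in> M \<rightarrow>\<^sub>M T" "f \<in> N \<rightarrow>\<^sub>M T"
    using f M N by (auto cong: measurable_cong_sets)
  have sp: "space M = space S" "space N = space S" using sets_eq_imp_space_eq[OF M] sets_eq_imp_space_eq[OF N] .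
  have "(SUP A\<in>sets (distr M T f). ennreal \<bar>measure (distr M T f) A - measure (distr N T f) A\<bar>) \<le> ennreal \<delta>"
  proof (rule SUP_least)
    fix A assume "A \<in> sets (distr M T f)"
    then have A: "A \<in> sets T" by simp
    show "ennreal \<bar>measure (distr M T f) A - measure (distr N T f) A\<bar> \<le> ennreal \<delta>"
      using le[OF measurable_sets[OF f A]] A by (simp add: measure_distr f' sp ennreal_leI)
  qed
  then have "tv_dist (distr M T f) (distr N T f) \<le> 2 * ennreal \<delta>"
    unfolding tv_dist_def by (rule mult_left_mono) simp
  also have "2 * ennreal \<delta> = ennreal (2 * \<delta>)" by (simp add: ennreal_mult')
  finally show ?thesis .
qed

theorem theorem2:
  fixes \<Theta> :: "(real^'m) set"
    and \<mu> :: "'a::polish_space measure"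
    and p :: "real^'m \<Rightarrow> 'a \<Rightarrow> real"
    and sc :: "real^'m \<Rightarrow> 'a \<Rightarrow> real^'m"
    and P :: "real^'m \<Rightarrow> 'a measure"
    and \<theta> :: "real^'m"
  assumes open_\<Theta>: "open \<Theta>"
    and sets_\<mu>: "sets \<mu> = sets borel"
    and p_meas: "\<And>t. t \<in> \<Theta> \<Longrightarrow> p t \<in> borel_measurable \<mu>"
    and p_nonneg: "\<And>t x. t \<in> \<Theta> \<Longrightarrow> x \<in> space \<mu> \<Longrightarrow> 0 \<le> p t x"
    and P_def: "\<And>t. t \<in> \<Theta> \<Longrightarrow> P t = density \<mu> (\<lambda>x. ennreal (p t x))"
    and P_prob: "\<And>t. t \<in> \<Theta> \<Longrightarrow> prob_space (P t)"
    and sc_meas: "\<And>t. t \<in> \<Theta> \<Longrightarrow> sc t \<in> borel_measurable \<mu>"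
    and DQM: "\<And>t. t \<in> \<Theta> \<Longrightarrow>
       ((\<lambda>h. ennreal (1 / (norm h)\<^sup>2) *
           (\<integral>\<^sup>+ x. ennreal ((sqrt (p (t + h) x) - sqrt (p t x)
                 - (1/2) * (h \<bullet> sc t x) * sqrt (p t x))\<^sup>2) \<partial>\<mu>))
        \<longlongrightarrow> 0) (at 0)"
    and exp_moment: "\<And>K h. compact K \<Longrightarrow> K \<subseteq> \<Theta> \<Longrightarrow>
       (SUP t\<in>K. \<integral>\<^sup>+ x. ennreal (exp (h \<bullet> sc t x)) \<partial>P t) < \<infinity>"
    and J_nonsing: "\<And>t. t \<in> \<Theta> \<Longrightarrow> invertible (fisher_info P sc t)"
    and \<theta>_in: "\<theta> \<in> \<Theta>"
  shows "\<exists>(Pt :: nat \<Rightarrow> real^'m \<Rightarrow> ((nat \<Rightarrow> 'a) \<times> ((real^'m) \<times> real)) measure)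
           (R :: nat \<Rightarrow> real^'m \<Rightarrow> ((nat \<Rightarrow> 'a) \<times> ((real^'m) \<times> real)) measure).
     (\<forall>n. \<forall>t\<in>\<Theta>. prob_space (Pt n t) \<and> sets (Pt n t) = sets (ext_space n)
          \<and> distr (Pt n t) (sample_space n) fst = PiM {..<n} (\<lambda>_. P t)) \<and>
     (\<forall>n. R n \<in> borel \<rightarrow>\<^sub>M prob_algebra (ext_space n)) \<and>
     (\<forall>K'. compact K' \<longrightarrow>
        ((\<lambda>n. SUP h\<in>K'. tv_dist (Pt n (\<theta> + (1 / sqrt (real n)) *\<^sub>R h))
                                  (mvnormal h (matrix_inv (fisher_info P sc \<theta>)) \<bind> R n))
         \<longlonglongrightarrow> 0))"
proof -
  define J where "J = fisher_info P sc \<theta>"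
  interpret P0: prob_space "P \<theta>" by (rule P_prob[OF \<theta>_in])
  have setsP: "sets (P t) = sets borel" if "t \<in> \<Theta>" for t using P_def[OF that] sets_\<mu> by simp
  have sc\<theta>[measurable]: "sc \<theta> \<in> borel_measurable (P \<theta>)"
    using sc_meas[OF \<theta>_in] P_def[OF \<theta>_in] by simp

  have exp_int: "integrable (P \<theta>) (\<lambda>x. exp (v \<bullet> sc \<theta> x))" for v
    using exp_moment[of "{\<theta>}" v] \<theta>_in by (intro integrableI_nonneg) auto
  have exp_norm: "integrable (P \<theta>) (\<lambda>x. exp (c * norm (sc \<theta> x)))" for c
    by (rule integrable_exp_norm_of_inner[OF _ exp_int]) simp
  have sq_int: "integrable (P \<theta>) (\<lambda>x. (norm (sc \<theta> x))\<^sup>2)"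
  proof (rule Bochner_Integration.integrable_bound[OF exp_norm[of 2]])
    have "(norm (sc \<theta> x))\<^sup>2 \<le> exp (2 * norm (sc \<theta> x))" for x
    proof -
      have "norm (sc \<theta> x) \<le> exp (norm (sc \<theta> x))"
        using exp_ge_add_one_self[of "norm (sc \<theta> x)"] by linarith
      then have "(norm (sc \<theta> x))\<^sup>2 \<le> (exp (norm (sc \<theta> x)))\<^sup>2" by (intro power_mono) auto
      then show ?thesis by (simp add: exp_double)
    qed
    then show "AE x in P \<theta>. norm ((norm (sc \<theta> x))\<^sup>2) \<le> norm (exp (2 * norm (sc \<theta> x)))" by simp
  qed simp
  have prod_int: "integrable (P \<theta>) (\<lambda>x. (v \<bullet> sc \<theta> x) * (w \<bullet> sc \<theta> x))" for v w
  proof (rule Bochner_Integration.integrable_bound[OF integrable_mult_right[OF sq_int, of "norm v * norm w"]])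
    have "\<bar>(v \<bullet> sc \<theta> x) * (w \<bullet> sc \<theta> x)\<bar> \<le> norm v * norm w * (norm (sc \<theta> x))\<^sup>2" for x
    proof -
      have "\<bar>v \<bullet> sc \<theta> x\<bar> * \<bar>w \<bullet> sc \<theta> x\<bar> \<le> (norm v * norm (sc \<theta> x)) * (norm w * norm (sc \<theta> x))"
        by (intro mult_mono Cauchy_Schwarz_ineq2) auto
      then show ?thesis by (simp add: abs_mult power2_eq_square mult_ac)
    qed
    then show "AE x in P \<theta>. norm ((v \<bullet> sc \<theta> x) * (w \<bullet> sc \<theta> x)) \<le> norm (norm v * norm w * (norm (sc \<theta> x))\<^sup>2)"
      by (intro AE_I2) (simp add: abs_mult)
  qed simp
  have J_bilinear: "v \<bullet> (J *v w) = (\<integral>x. (v \<bullet> sc \<theta> x) * (w \<bullet> sc \<theta> x) \<partial>P \<theta>)" for v w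
  proof -
    have ij: "integrable (P \<theta>) (\<lambda>x. (sc \<theta> x $ i) * (sc \<theta> x $ j))" for i j
      using prod_int[of "axis i 1" "axis j 1"] by (simp add: inner_axis')
    have "(\<lambda>x. (v \<bullet> sc \<theta> x) * (w \<bullet> sc \<theta> x))
        = (\<lambda>x. \<Sum>i\<in>UNIV. \<Sum>j\<in>UNIV. v $ i * (w $ j * ((sc \<theta> x $ i) * (sc \<theta> x $ j))))"
      by (simp add: inner_vec_def sum_product mult_ac)
    then show ?thesis
      using ij by (simp add: J_def fisher_info_def inner_vec_def matrix_vector_mult_def sum_distrib_left
          Bochner_Integration.integral_sum mult_ac)
  qed
  have Jinv: "invertible J" unfolding J_def by (rule J_nonsing[OF \<theta>_in])
  have Jsym: "transpose J = J" by (simp add: J_def fisher_info_def transpose_def vec_eq_iff mult.commute)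
  \<comment> \<open>The form is semidefinite as a second moment. If it vanishes at \<open>v\<close>,
    then \<open>v \<bullet> sc \<theta> x\<close> is zero almost surely, so \<open>J *v v\<close> is
    orthogonal to every \<open>w\<close>, which contradicts invertibility.\<close>
  have Jpos: "0 < v \<bullet> (J *v v)" if v: "v \<noteq> 0" for v
  proof -
    have "0 \<le> v \<bullet> (J *v v)" unfolding J_bilinear by (intro integral_nonneg_AE) simp
    moreover have "v \<bullet> (J *v v) \<noteq> 0"
    proof
      assume "v \<bullet> (J *v v) = 0"
      then have "AE x in P \<theta>. (v \<bullet> sc \<theta> x) * (v \<bullet> sc \<theta> x) = 0"
        unfolding J_bilinear by (subst (asm) integral_nonneg_eq_0_iff_AE[OF prod_int]) auto
      then have ae: "AE x in P \<theta>. (w \<bullet> sc \<theta> x) * (v \<bullet> sc \<theta> x) = 0" for w by (auto elim: AE_mp)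
      have "w \<bullet> (J *v v) = 0" for w
        unfolding J_bilinear using ae[of w] by (rule integral_eq_zero_AE)
      from this[of "J *v v"] have "J *v v = 0" by simp
      then have "matrix_inv J *v (J *v v) = 0" by simp
      moreover obtain J' where "J ** J' = mat 1" "J' ** J = mat 1"
        using Jinv unfolding invertible_def by blast
      then have "matrix_inv J ** J = mat 1" using matrix_inv_eqI[of J J'] by simp
      ultimately show False using v by (simp add: matrix_vector_mul_assoc)
    qed
    ultimately show ?thesis by simp
  qed
  obtain B :: "real^'m^'m" where B: "transpose B ** J ** B = mat 1"
    using whitening_matrix_exists[OF Jsym Jpos] by blast
  have "det (transpose B ** J ** B) = 1" using B by simp
  then have "invertible B" by (auto simp: det_mul invertible_det_nz)
  then obtain B' where B': "B ** B' = mat 1" "B' ** B = mat 1" unfolding invertible_def by blast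
  have BB': "B *v (B' *v h) = h" "B' *v (B *v h) = h" for h
    using B' by (simp_all add: matrix_vector_mul_assoc)
  have mat_meas[measurable]: "(*v) A \<in> borel_measurable borel" for A :: "real^'m^'m"
    by (intro borel_measurable_continuous_onI continuous_intros)

  \<comment> \<open>Whitening acts on parameter and score together: the direction \<open>u\<close>
    stands for the shift \<open>B *v u\<close> of the parameter, along which the score is
    \<open>u \<bullet> s x\<close>. Thus \<open>r u\<close> is the original residual at
    \<open>B *v u\<close>.\<close>
  define s where "s x = transpose B *v sc \<theta> x" for x
  have vs: "v \<bullet> s x = (B *v v) \<bullet> sc \<theta> x" for v x unfolding s_def inner_matrix_mult_left ..
  define r where "r u x = sqrt (p (\<theta> + B *v u) x) - sqrt (p \<theta> x) - (1/2) * (u \<bullet> s x) * sqrt (p \<theta> x)" for u x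
  have in_\<Theta>: "\<forall>\<^sub>F u in nhds 0. \<theta> + B *v u \<in> \<Theta>"
  proof -
    have "((\<lambda>u. \<theta> + B *v u) \<longlongrightarrow> \<theta> + B *v 0) (nhds 0)"
      by (intro tendsto_intros continuous_on_tendsto_compose[where s=UNIV and f="(*v) B"] continuous_intros filterlim_ident) auto
    then show ?thesis using topological_tendstoD[OF _ open_\<Theta>] \<theta>_in by simp
  qed
  have p\<theta>[measurable]: "p \<theta> \<in> borel_measurable \<mu>" by (rule p_meas[OF \<theta>_in])
  have s\<mu>[measurable]: "s \<in> borel_measurable \<mu>"
    unfolding s_def using sc_meas[OF \<theta>_in] by measurable
  have r_meas: "\<forall>\<^sub>F u in nhds 0. r u \<in> borel_measurable \<mu>"
    using in_\<Theta>
  proof eventually_elim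
    case (elim u)
    note [measurable] = p_meas[OF elim]
    show ?case unfolding r_def by measurable
  qed
  \<comment> \<open>The original limit is normalised by the norm of \<open>B *v u\<close> rather
    than of \<open>u\<close>. Boundedness of \<open>B\<close> compares the two, and injectivity
    keeps \<open>B *v u\<close> nonzero, as a limit at 0 demands.\<close>
  have r_lim: "((\<lambda>u. ennreal (1 / (norm u)\<^sup>2) * (\<integral>\<^sup>+x. ennreal ((r u x)\<^sup>2) \<partial>\<mu>)) \<longlongrightarrow> 0) (at 0)"
  proof -
    obtain C where C: "0 < C" "\<And>u. norm (B *v u) \<le> norm u * C"
      using bounded_linear.pos_bounded[of "(*v) B"] matrix_vector_mul_bounded_linear by blast
    have Bf: "filterlim ((*v) B) (at 0) (at 0)"
    proof (rule filterlim_atI)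
      have "((*v) B \<longlongrightarrow> B *v 0) (at 0)"
        by (intro continuous_on_tendsto_compose[where s=UNIV and f="(*v) B"] continuous_intros tendsto_ident_at) auto
      then show "((*v) B \<longlongrightarrow> 0) (at 0)" by simp
      show "\<forall>\<^sub>F u in at 0. B *v u \<noteq> 0"
        using eventually_neq_at_within[of 0 0 UNIV]
        by eventually_elim (metis BB'(2) matrix_vector_mult_0_right)
    qed
    have lim: "((\<lambda>u. ennreal (C\<^sup>2) * (ennreal (1 / (norm (B *v u))\<^sup>2) * (\<integral>\<^sup>+x. ennreal ((r u x)\<^sup>2) \<partial>\<mu>))) \<longlongrightarrow> 0) (at 0)"
      using ennreal_tendsto_cmult[OF _ filterlim_compose[OF DQM[OF \<theta>_in] Bf], of "ennreal (C\<^sup>2)"]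
      unfolding r_def vs by simp
    show ?thesis
    proof (rule tendsto_sandwich[OF _ _ tendsto_const lim])
      show "\<forall>\<^sub>F u in at 0. ennreal (1 / (norm u)\<^sup>2) * (\<integral>\<^sup>+x. ennreal ((r u x)\<^sup>2) \<partial>\<mu>)
          \<le> ennreal (C\<^sup>2) * (ennreal (1 / (norm (B *v u))\<^sup>2) * (\<integral>\<^sup>+x. ennreal ((r u x)\<^sup>2) \<partial>\<mu>))"
        using eventually_neq_at_within[of 0 0 UNIV]
      proof eventually_elim
        case (elim u)
        then have "B *v u \<noteq> 0" by (metis BB'(2) matrix_vector_mult_0_right)
        moreover have "(norm (B *v u))\<^sup>2 \<le> (norm u * C)\<^sup>2" by (intro power_mono C) auto
        ultimately have "1 / (norm u)\<^sup>2 \<le> C\<^sup>2 * (1 / (norm (B *v u))\<^sup>2)"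
          using elim by (simp add: field_simps power_mult_distrib)
        then have "ennreal (1 / (norm u)\<^sup>2) \<le> ennreal (C\<^sup>2) * ennreal (1 / (norm (B *v u))\<^sup>2)"
          by (simp add: ennreal_mult[symmetric] ennreal_leI)
        then show ?case unfolding mult.assoc[symmetric] by (rule mult_right_mono) simp
      qed
    qed simp
  qed
  have r0: "r 0 x = 0" for x by (simp add: r_def)
  note residual = dqm_residual_tendsto[OF r_lim r0 r_meas]
  have u0: "(\<lambda>n. (1 / sqrt (real n)) *\<^sub>R h n) \<longlonglongrightarrow> 0" if "h \<longlonglongrightarrow> h0" for h :: "nat \<Rightarrow> real^'m" and h0
  proof -
    have "(\<lambda>n. (1 / sqrt (real n)) *\<^sub>R h n) \<longlonglongrightarrow> 0 *\<^sub>R h0"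
      by (intro tendsto_scaleR that tendsto_divide_0[OF tendsto_const]
          filterlim_at_top_imp_at_infinity filterlim_compose[OF sqrt_at_top] filterlim_real_sequentially)
    then show ?thesis by simp
  qed
  define t where "t n h = \<theta> + B *v ((1 / sqrt (real n)) *\<^sub>R h)" for n :: nat and h
  have t_in: "\<forall>\<^sub>F n in sequentially. t n (h n) \<in> \<Theta>" if "h \<longlonglongrightarrow> h0" for h h0
    unfolding t_def using eventually_compose_filterlim[OF in_\<Theta> u0[OF that]] .
  have P_mass: "(\<integral>\<^sup>+x. ennreal (p t x) \<partial>\<mu>) = 1" if "t \<in> \<Theta>" for t
    using prob_space.emeasure_space_1[OF P_prob[OF that]] p_meas[OF that] unfolding P_def[OF that]
    by (simp add: emeasure_density cong: nn_integral_cong)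
  have p_int: "integrable \<mu> (p t)" "integral\<^sup>L \<mu> (p t) = 1" if "t \<in> \<Theta>" for t
    using P_mass[OF that] p_meas[OF that] p_nonneg[OF that]
    by (auto intro!: integrableI_nonneg integral_eq_nn_integral[THEN trans])

  have dens_int: "integrable \<mu> (\<lambda>x. f x * p \<theta> x)"
    if [measurable]: "f \<in> borel_measurable \<mu>" and f: "integrable (P \<theta>) f" for f :: "'a \<Rightarrow> real"
  proof -
    have "integrable \<mu> (\<lambda>x. p \<theta> x * f x)"
      using f p_nonneg[OF \<theta>_in] unfolding P_def[OF \<theta>_in] by (subst (asm) integrable_real_density) auto
    then show ?thesis by (simp only: mult.commute)
  qed
  have sP[measurable]: "s \<in> borel_measurable (P \<theta>)" unfolding s_def by measurable
  interpret W: std_score "P \<theta>" s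
  proof
    show "s \<in> borel_measurable (P \<theta>)" by (rule sP)
    show "integrable (P \<theta>) (\<lambda>x. exp (c * norm (s x)))" for c
    proof (rule integrable_exp_norm_of_inner)
      show "integrable (P \<theta>) (\<lambda>x. exp (v \<bullet> s x))" for v unfolding vs by (rule exp_int)
    qed (rule sP)
    show "(\<integral>x. (v \<bullet> s x)\<^sup>2 \<partial>P \<theta>) = (norm v)\<^sup>2" for v
      unfolding vs power2_eq_square[of "_ \<bullet> _"] J_bilinear[symmetric] by (rule inner_whitening[OF B])
    show "(\<integral>x. v \<bullet> s x \<partial>P \<theta>) = 0" for v
    proof -
      have sq: "integrable (P \<theta>) (\<lambda>x. (v \<bullet> s x)\<^sup>2)"
        unfolding vs power2_eq_square by (rule prod_int)
      then have "integrable (P \<theta>) (\<lambda>x. v \<bullet> s x)"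
        by (rule P0.square_integrable_imp_integrable[rotated]) measurable
      note dens = this sq
      have vs\<mu>: "(\<lambda>x. v \<bullet> s x) \<in> borel_measurable \<mu>" by measurable
      \<comment> \<open>The mean of the score vanishes by differentiability in quadratic mean along
        the constant local parameter \<open>v\<close>.\<close>
      have 1: "(\<integral>x. v \<bullet> s x * p \<theta> x \<partial>\<mu>) = 0"
      proof (rule dqm_mean_zero[where q="\<lambda>n. p (t n v)"])
        show "integrable \<mu> (p \<theta>)" "integral\<^sup>L \<mu> (p \<theta>) = 1" by (rule p_int[OF \<theta>_in])+
        show "integrable \<mu> (\<lambda>x. v \<bullet> s x * p \<theta> x)" "integrable \<mu> (\<lambda>x. (v \<bullet> s x)\<^sup>2 * p \<theta> x)"
          by (rule dens_int[OF _ dens(1)], measurable) (rule dens_int[OF _ dens(2)], measurable)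
        show "\<forall>\<^sub>F n in sequentially. integrable \<mu> (p (t n v)) \<and> integral\<^sup>L \<mu> (p (t n v)) = 1
            \<and> (\<forall>x\<in>space \<mu>. 0 \<le> p (t n v) x)"
          using t_in[OF tendsto_const[of v]] by eventually_elim (auto simp: p_int p_nonneg)
        show "\<forall>\<^sub>F n in sequentially. integrable \<mu> (\<lambda>x. (sqrt (p (t n v) x) - sqrt (p \<theta> x)
            - (1/2) * (1 / sqrt (real n) * (v \<bullet> s x)) * sqrt (p \<theta> x))\<^sup>2)"
          using residual(1)[OF tendsto_const[of v]] unfolding r_def t_def inner_scaleR_left .
        show "(\<lambda>n. real n * (\<integral>x. (sqrt (p (t n v) x) - sqrt (p \<theta> x)
            - (1/2) * (1 / sqrt (real n) * (v \<bullet> s x)) * sqrt (p \<theta> x))\<^sup>2 \<partial>\<mu>)) \<longlonglongrightarrow> 0"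
          using residual(2)[OF tendsto_const[of v]] unfolding r_def t_def inner_scaleR_left .
      qed (rule p_nonneg[OF \<theta>_in])
      have "(\<integral>x. v \<bullet> s x \<partial>P \<theta>) = (\<integral>x. p \<theta> x * (v \<bullet> s x) \<partial>\<mu>)"
        unfolding P_def[OF \<theta>_in]
        by (intro integral_real_density vs\<mu> p\<theta> AE_I2 p_nonneg[OF \<theta>_in])
      also have "\<dots> = 0" using 1 by (simp only: mult.commute)
      finally show ?thesis .
    qed
  qed

  define S where "S n R \<longleftrightarrow> R \<in> borel \<rightarrow>\<^sub>M prob_algebra (W.sample n)" for n and R :: "real^'m \<Rightarrow> (nat \<Rightarrow> 'a) measure"
  \<comment> \<open>One index \<open>k\<close> governs both the radius of the ball and the accuracy,
    which makes \<open>Q\<close> monotone in \<open>k\<close> as the diagonal choice requires.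
    Membership in \<open>\<Theta>\<close> is part of \<open>Q\<close> because at small
    \<open>n\<close> the shifted parameter may leave the open set.\<close>
  define Q where "Q n k R \<longleftrightarrow> S n R \<and> (\<forall>h\<in>cball 0 (real k). t n h \<in> \<Theta> \<and> (\<forall>A\<in>sets (W.sample n).
      \<bar>measure (PiM {..<n} (\<lambda>_. P (t n h))) A - measure (gauss_law h \<bind> R) A\<bar> \<le> 1 / real (Suc k)))" for n k R
  have evQ: "\<forall>\<^sub>F n in sequentially. \<exists>R. Q n k R" for k
  proof -
    \<comment> \<open>Half of the accuracy: the error is shared between replacing the true products
      by tilted ones and replacing those by the image under the kernel.\<close>
    define \<delta> where "\<delta> = 1 / (2 * real (Suc k))"
    have \<delta>: "0 < \<delta>" by (simp add: \<delta>_def)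
    \<comment> \<open>The limiting affinity is continuous in \<open>a\<close> and equals 1 at
      \<open>a = 1\<close>, where the noise would disappear. So \<open>a\<close> is taken just below
      1, with \<open>k\<close> as the largest norm of a parameter in the ball.\<close>
    have "((\<lambda>a. exp (- (1 - a) * (real k)\<^sup>2 / 4)) \<longlongrightarrow> exp (- (1 - 1) * (real k)\<^sup>2 / 4)) (at_left 1)"
      by (intro tendsto_intros) auto
    then have "\<forall>\<^sub>F a in at_left 1. 1 - \<delta>\<^sup>2 / 8 < exp (- (1 - a) * (real k)\<^sup>2 / 4)"
      using \<delta> by (intro order_tendstoD(1)) auto
    moreover have "\<forall>\<^sub>F a::real in at_left 1. a \<in> {0<..<1}" by (rule eventually_at_left_real) simp
    ultimately have "\<forall>\<^sub>F a::real in at_left 1. 0 < a \<and> a < 1 \<and> 1 - \<delta>\<^sup>2 / 8 < exp (- (1 - a) * (real k)\<^sup>2 / 4)"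
      by eventually_elim auto
    then obtain a where a: "0 < a" "a < 1" "1 - \<delta>\<^sup>2 / 8 < exp (- (1 - a) * (real k)\<^sup>2 / 4)"
      using eventually_happens'[OF trivial_limit_at_left_real] by blast
    define e where "e = sqrt (1 - a\<^sup>2)"
    have "a\<^sup>2 < 1" using a by (simp add: abs_square_less_1)
    then have e: "0 < e" "a\<^sup>2 + e\<^sup>2 = 1" by (auto simp: e_def)
    have "\<forall>\<^sub>F n in sequentially. \<forall>h\<in>cball 0 (real k). t n h \<in> \<Theta> \<and> (\<forall>A\<in>sets (W.sample n).
      \<bar>measure (PiM {..<n} (\<lambda>_. P (t n h))) A - measure (gauss_law h \<bind> W.lift_kernel a e n) A\<bar> \<le> 1 / real (Suc k))"
    proof (rule eventually_uniform_on_compact[OF compact_cball])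
      fix h and h0 :: "real^'m" assume h0: "h0 \<in> cball 0 (real k)" and h: "h \<longlonglongrightarrow> h0"
      have "(norm h0)\<^sup>2 \<le> (real k)\<^sup>2" using h0 by (intro power_mono) auto
      then have "(1 - a) * (norm h0)\<^sup>2 \<le> (1 - a) * (real k)\<^sup>2" using a by (intro mult_left_mono) auto
      then have "exp (- (1 - a) * (real k)\<^sup>2 / 4) \<le> exp (- (1 - a) * (norm h0)\<^sup>2 / 4)"
        unfolding exp_le_cancel_iff mult_minus_left by linarith
      then have near: "1 - \<delta>\<^sup>2 / 8 < exp (- (1 - a) * (norm h0)\<^sup>2 / 4)" using a(3) by linarith
      have q: "\<forall>\<^sub>F n in sequentially. p (t n (h n)) \<in> borel_measurable \<mu> \<and> (\<forall>x\<in>space \<mu>. 0 \<le> p (t n (h n)) x)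
        \<and> prob_space (density \<mu> (\<lambda>x. ennreal (p (t n (h n)) x)))"
        using t_in[OF h]
      proof eventually_elim
        case (elim n)
        then show ?case using p_meas p_nonneg P_prob[OF elim] unfolding P_def[OF elim] by auto
      qed
      have tilted: "\<forall>\<^sub>F n in sequentially. \<forall>A\<in>sets (W.sample n).
        \<bar>measure (PiM {..<n} (\<lambda>_. density \<mu> (\<lambda>x. ennreal (p (t n (h n)) x)))) A
          - measure (PiM {..<n} (\<lambda>_. W.tilt ((1 / sqrt (real n)) *\<^sub>R h n))) A\<bar> \<le> \<delta>"
        by (rule W.product_tilt_approx[OF P_def[OF \<theta>_in] p\<theta> _ q h \<delta>
              residual(1)[OF h, unfolded r_def, folded t_def] residual(2)[OF h, unfolded r_def, folded t_def]])
           (rule p_nonneg[OF \<theta>_in])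
      show "\<forall>\<^sub>F n in sequentially. t n (h n) \<in> \<Theta> \<and> (\<forall>A\<in>sets (W.sample n).
        \<bar>measure (PiM {..<n} (\<lambda>_. P (t n (h n)))) A - measure (gauss_law (h n) \<bind> W.lift_kernel a e n) A\<bar> \<le> 1 / real (Suc k))"
        using tilted W.lift_kernel_approx[OF a(1) e h \<delta> near] t_in[OF h]
      proof eventually_elim
        case (elim n)
        have "\<bar>measure (PiM {..<n} (\<lambda>_. P (t n (h n)))) A - measure (gauss_law (h n) \<bind> W.lift_kernel a e n) A\<bar> \<le> \<delta> + \<delta>"
          if A: "A \<in> sets (W.sample n)" for A
          using bspec[OF elim(1) A] bspec[OF elim(2) A] unfolding P_def[OF elim(3)] by linarith
        moreover have "\<delta> + \<delta> = 1 / real (Suc k)" by (simp add: \<delta>_def field_simps)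
        ultimately show ?case using elim(3) by simp
      qed
    qed
    then show ?thesis
    proof eventually_elim
      case (elim n)
      then show ?case
        unfolding Q_def S_def using W.lift_kernel_measurable[OF a(1) e] by blast
    qed
  qed
  have Qmono: "Q n l R" if "Q n k R" "l \<le> k" for n k l R
  proof -
    have "1 / real (Suc k) \<le> 1 / real (Suc l)" using that(2) by (simp add: frac_le)
    moreover have "cball 0 (real l) \<subseteq> cball (0::real^'m) (real k)" using that(2) by auto
    ultimately show ?thesis using that(1) unfolding Q_def by (meson order_trans subsetD)
  qed
  \<comment> \<open>The constant kernel is the fallback at those \<open>n\<close> where no level is
    attained.\<close>
  have Sex: "\<exists>R. S n R" for n
  proof
    show "S n (\<lambda>_. W.sample n)"
      unfolding S_def by (intro measurable_const) (simp add: space_prob_algebra W.prob_space_sample)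
  qed
  have "\<exists>R. (\<forall>n. S n (R n)) \<and> (\<forall>k. \<forall>\<^sub>F n in sequentially. Q n k (R n))"
  proof (rule diagonal_choice)
    show "S n R" if "Q n k R" for n k R using that unfolding Q_def by (rule conjunct1)
  qed (rule Sex, rule evQ, rule Qmono)
  then obtain R where R: "\<And>n. S n (R n)" "\<And>k. \<forall>\<^sub>F n in sequentially. Q n k (R n)" by blast

  define \<iota> where "\<iota> X = (X, (0::real^'m, 0::real))" for X :: "nat \<Rightarrow> 'a"
  have sets_PiM: "sets (PiM {..<n} (\<lambda>_. P t)) = sets (sample_space n)" if "t \<in> \<Theta>" for n t
    unfolding sample_space_def by (intro sets_PiM_cong) (auto simp: setsP[OF that])
  have \<iota>: "\<iota> \<in> sample_space n \<rightarrow>\<^sub>M ext_space n" for n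
    unfolding \<iota>_def ext_space_def by (intro measurable_Pair measurable_ident measurable_const) (auto simp: Omega'_def space_restrict_space)
  have \<iota>P: "\<iota> \<in> PiM {..<n} (\<lambda>_. P t) \<rightarrow>\<^sub>M ext_space n" if "t \<in> \<Theta>" for n t
    using \<iota>[of n] sets_PiM[OF that, of n] by (simp cong: measurable_cong_sets)
  define Pt where "Pt n t = distr (PiM {..<n} (\<lambda>_. P t)) (ext_space n) \<iota>" for n t
  \<comment> \<open>\<open>R n\<close> expects a Gaussian with unit covariance and mean
    \<open>B' *v h\<close>; this is the image under \<open>B'\<close> of the law with mean
    \<open>h\<close> and covariance \<open>matrix_inv J\<close>.\<close>
  define R' where "R' n x = distr (R n (B' *v x)) (ext_space n) \<iota>" for n x
  have RB: "(\<lambda>x. R n (B' *v x)) \<in> borel \<rightarrow>\<^sub>M prob_algebra (W.sample n)" for n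
    using R(1)[of n] unfolding S_def by measurable
  have R'_meas: "R' n \<in> borel \<rightarrow>\<^sub>M prob_algebra (ext_space n)" for n
    unfolding R'_def by (rule measurable_compose[OF RB measurable_distr_prob_space[OF \<iota>P[OF \<theta>_in]]])
  have bind_eq: "mvnormal h (matrix_inv J) \<bind> R' n = distr (gauss_law (B' *v h) \<bind> R n) (ext_space n) \<iota>" for n h
  proof -
    have "mvnormal h (matrix_inv J) = distr (gauss_law (B' *v h)) borel ((*v) B)"
      using mvnormal_eq_distr_gauss_law[OF B, of "B' *v h"] by (simp add: BB')
    then have "mvnormal h (matrix_inv J) \<bind> R' n = gauss_law (B' *v h) \<bind> (\<lambda>y. R' n (B *v y))"
      using measurable_prob_algebraD[OF R'_meas[of n]] by (simp add: bind_distr[where K="ext_space n"])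
    also have "(\<lambda>y. R' n (B *v y)) = (\<lambda>y. distr (R n y) (ext_space n) \<iota>)" by (simp add: R'_def BB')
    also have "gauss_law (B' *v h) \<bind> \<dots> = distr (gauss_law (B' *v h) \<bind> R n) (ext_space n) \<iota>"
      using measurable_prob_algebraD[OF R(1)[of n, unfolded S_def]]
      by (intro distr_bind[symmetric, OF _ _ \<iota>P[OF \<theta>_in]]) auto
    finally show ?thesis .
  qed
  have marg: "prob_space (Pt n t) \<and> sets (Pt n t) = sets (ext_space n)
          \<and> distr (Pt n t) (sample_space n) fst = PiM {..<n} (\<lambda>_. P t)" if t: "t \<in> \<Theta>" for n t
  proof (intro conjI)
    interpret prob_space "PiM {..<n} (\<lambda>_. P t)" by (rule prob_space_PiM) (rule P_prob[OF t])
    show "prob_space (Pt n t)" unfolding Pt_def by (rule prob_space_distr[OF \<iota>P[OF t]])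
    show "sets (Pt n t) = sets (ext_space n)" by (simp add: Pt_def)
    have "distr (Pt n t) (sample_space n) fst = distr (PiM {..<n} (\<lambda>_. P t)) (sample_space n) (fst \<circ> \<iota>)"
      unfolding Pt_def by (rule distr_distr[OF _ \<iota>P[OF t]]) (simp add: ext_space_def)
    also have "fst \<circ> \<iota> = (\<lambda>x. x)" by (auto simp: \<iota>_def)
    also have "distr (PiM {..<n} (\<lambda>_. P t)) (sample_space n) (\<lambda>x. x) = PiM {..<n} (\<lambda>_. P t)"
      by (rule distr_id2) (simp add: sets_PiM[OF t])
    finally show "distr (Pt n t) (sample_space n) fst = PiM {..<n} (\<lambda>_. P t)" .
  qed
  have conv: "(\<lambda>n. SUP h\<in>K'. tv_dist (Pt n (\<theta> + (1 / sqrt (real n)) *\<^sub>R h)) (mvnormal h (matrix_inv J) \<bind> R' n)) \<longlonglongrightarrow> 0"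
    if K': "compact K'" for K'
  proof -
    \<comment> \<open>In whitened coordinates a compact set is still bounded, hence contained in the
      ball of \<open>Q\<close> for all large \<open>k\<close>.\<close>
    have "bounded ((*v) B' ` K')"
      by (intro compact_imp_bounded compact_continuous_image K' continuous_intros)
    then obtain b where b: "\<And>h. h \<in> K' \<Longrightarrow> norm (B' *v h) \<le> b" by (auto simp: bounded_iff)
    have main: "\<forall>\<^sub>F n in sequentially. (SUP h\<in>K'. tv_dist (Pt n (\<theta> + (1 / sqrt (real n)) *\<^sub>R h))
        (mvnormal h (matrix_inv J) \<bind> R' n)) \<le> ennreal (2 * (1 / real (Suc k)))" if k: "b \<le> real k" for k
      using R(2)[of k]
    proof eventually_elim
      case (elim n)
      show ?case
      proof (rule SUP_least)
        fix h assume h: "h \<in> K'"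
        have hk: "B' *v h \<in> cball 0 (real k)" using b[OF h] k by simp
        have th: "t n (B' *v h) = \<theta> + (1 / sqrt (real n)) *\<^sub>R h"
          by (simp add: t_def matrix_vector_mult_scaleR BB')
        have t\<Theta>: "\<theta> + (1 / sqrt (real n)) *\<^sub>R h \<in> \<Theta>"
          and le: "\<And>A. A \<in> sets (W.sample n) \<Longrightarrow> \<bar>measure (PiM {..<n} (\<lambda>_. P (\<theta> + (1 / sqrt (real n)) *\<^sub>R h))) A
             - measure (gauss_law (B' *v h) \<bind> R n) A\<bar> \<le> 1 / real (Suc k)"
          using elim hk unfolding Q_def th[symmetric] by blast+
        show "tv_dist (Pt n (\<theta> + (1 / sqrt (real n)) *\<^sub>R h)) (mvnormal h (matrix_inv J) \<bind> R' n)
            \<le> ennreal (2 * (1 / real (Suc k)))"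
          unfolding Pt_def bind_eq
        proof (rule tv_dist_distr_le[OF \<iota>P[OF \<theta>_in] _ _ le])
          show "sets (PiM {..<n} (\<lambda>_. P (\<theta> + (1 / sqrt (real n)) *\<^sub>R h))) = sets (W.sample n)"
            using sets_PiM[OF t\<Theta>] sets_PiM[OF \<theta>_in] by simp
          have "R n x \<in> space (prob_algebra (W.sample n))" for x
            using measurable_space[OF R(1)[of n, unfolded S_def], of x] by simp
          then show "sets (gauss_law (B' *v h) \<bind> R n) = sets (W.sample n)"
            by (intro sets_bind) (auto simp: space_prob_algebra)
        qed
      qed
    qed
    show ?thesis
    proof (rule order_tendstoI)
      fix a :: ennreal assume "0 < a"
      \<comment> \<open>A real \<open>c\<close> replaces \<open>a\<close>, which may be infinite; in
        that case \<open>c = 1\<close> serves.\<close>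
      then obtain c where c: "0 < c" "ennreal c \<le> a"
        by (cases a) (auto intro: that[of 1])
      obtain k where k: "max b (4 / c) \<le> real k" using real_arch_simple by blast
      have "4 / c < real (Suc k)" using k by simp
      then have "2 * (1 / real (Suc k)) < c" using c by (simp add: field_simps)
      then have "ennreal (2 * (1 / real (Suc k))) < a" using c by (meson ennreal_lessI less_le_trans)
      then show "\<forall>\<^sub>F n in sequentially. (SUP h\<in>K'. tv_dist (Pt n (\<theta> + (1 / sqrt (real n)) *\<^sub>R h))
        (mvnormal h (matrix_inv J) \<bind> R' n)) < a"
        using main[of k] k by (auto elim!: eventually_mono intro: le_less_trans)
    qed simp
  qed
  show ?thesis
    by (rule exI[of _ Pt], rule exI[of _ R'], intro conjI allI ballI impI)
       (simp_all only: marg R'_meas conv[unfolded J_def])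
qed

end
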